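(* Let $\mathbf i=(1,\dots,r,\,\dots,\,1,\dots,r,\,1,\dots,i_n)$ ($m-1$ full cycles followed by the $m$-th cycle $1,\dots,i_n$) with $1\le m\le r$, $1\le i_n\le r$, $n=(m-1)r+i_n$, a reduced word for $u=(s_1s_2\cdots s_r)^{m-1}s_1\cdots s_{i_n}$. Let $k\in\{1,\dots,n\}$ be such that its $k$-th entry $i_k$ belongs to the $m'$-th cycle and $d:=i_k=i_n$. Then for $\mathbf Y=(Y_{1,1},\dots,Y_{1,r},\dots,Y_{m-1,r},Y_{m,1},\dots,Y_{m,i_n})\in(\mathbb C^\times)^n$, $$\Delta^L(k;\mathbf i)(\mathbf Y)=\sum_{p\in X_d(m,m')}Q(p).$$
   Context: **Index set.** $J=\{i,\overline i\mid 1\le i\le r\}$ is totally ordered by $1<2<\cdots<r<\overline r<\overline{r-1}<\cdots<\overline 1$; for $1\le l\le r$, $|l|=|\overline l|=l$. **Group.** $G=Sp_{2r}(\mathbb C)$, of type $C_r$, with Chevalley generators $e_i,f_i,h_i$ ($1\le i\le r$) of its Lie algebra, Cartan matrix $a_{i,j}=\alpha_j(h_i)$ with $a_{i,i}=2$, $a_{i,j}=-1$ if $|i-j|=1$ and $(i,j)\ne(r-1,r)$, $a_{r-1,r}=-2$, and $a_{i,j}=0$ otherwise. $\Lambda_i$ are the fundamental weights, $\Lambda_i(h_j)=\delta_{i,j}$, $\Lambda_0=0$. The vector representation $V(\Lambda_1)=\mathbb C^{2r}$ has basis $v_j$ ($j\in J$) with weights $\mathrm{wt}(v_i)=\Lambda_i-\Lambda_{i-1}$,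 $\mathrm{wt}(v_{\overline i})=\Lambda_{i-1}-\Lambda_i$, and action $f_iv_i=v_{i+1}$, $f_iv_{\overline{i+1}}=v_{\overline i}$, $e_iv_{i+1}=v_i$, $e_iv_{\overline i}=v_{\overline{i+1}}$ ($1\le i<r$), $f_rv_r=v_{\overline r}$, $e_rv_{\overline r}=v_r$, all other actions of $e_i,f_i$ on basis vectors being zero. $B,B_-$ are the opposite Borel subgroups (generated by $H$ and the $x_i(t)$, resp. by $H$ and the $y_i(t)$ below), $N,N_-$ their unipotent radicals, $H=B\cap B_-$. $W=\langle s_1,\dots,s_r\rangle=\mathrm{Norm}_G(H)/H$. For $t\in\mathbb C$: $x_i(t)=\exp(te_i)$, $y_i(t)=\exp(tf_i)$. For $t\in\mathbb C^\times$: $\alpha_i^\vee(t)=t^{h_i}\in H$ (acting on a vector of weight $\mu$ by $t^{\mu(h_i)}$) and $x_{-i}(t)=y_i(t)\alpha_i^\vee(t^{-1})$. Representatives: $\overline{s_i}=x_i(-1)y_i(1)x_i(-1)$ and $\overline w=\overline{s_{j_1}}\cdots\overline{s_{j_p}}$ for a reduced expression $w=s_{j_1}\cdots s_{j_p}$. **Generalized minors.** Let $G_0=N_-HN$; for $x\in G_0$ write $x=[x]_-[x]_0[x]_+$ with $[x]_-\in N_-$, $[x]_0\in H$, $[x]_+\in N$. For $w,w'\in W$, $\Delta_{w\Lambda_i,w'\Lambda_i}$ is the regular function on $G$ whose restriction to $\overline wG_0\overline{w'}^{-1}$ is $x\mapsto([\overline w^{-1}x\overline{w'}]_0)^{\Lambda_i}$.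 For $k$ in the $m'$-th cycle, $u_{\le k}=s_{i_1}\cdots s_{i_k}=(s_1\cdots s_r)^{m'-1}s_1\cdots s_{i_k}$, and $\Delta(k;\mathbf i):=\Delta_{u_{\le k}\Lambda_{i_k},\Lambda_{i_k}}$. Put $$x^L_{\mathbf i}(\mathbf Y)=\big(x_{-1}(Y_{1,1})\cdots x_{-r}(Y_{1,r})\big)\cdots\big(x_{-1}(Y_{m-1,1})\cdots x_{-r}(Y_{m-1,r})\big)\,x_{-1}(Y_{m,1})\cdots x_{-i_n}(Y_{m,i_n})$$ and $\Delta^L(k;\mathbf i)(\mathbf Y):=\Delta(k;\mathbf i)(x^L_{\mathbf i}(\mathbf Y))$. **Paths.** $X_d(m,m')$ is the set of all directed paths $$p=\mathrm{vt}(m;a^{(0)}_1,\dots,a^{(0)}_d)\to\mathrm{vt}(m-1;a^{(1)}_1,\dots,a^{(1)}_d)\to\cdots\to\mathrm{vt}(0;a^{(m)}_1,\dots,a^{(m)}_d)$$ (i.e. sequences of $d$-tuples $(a^{(s)}_1,\dots,a^{(s)}_d)$, $0\le s\le m$) such that: (i) $a^{(s)}_\zeta\in J$; (ii) $a^{(s)}_1<a^{(s)}_2<\cdots<a^{(s)}_d$ for all $0\le s\le m$; (iii) for $0\le s\le m-1$: if $a^{(s)}_\zeta\in\{1,\dots,r-1\}$ then $a^{(s+1)}_\zeta\in\{a^{(s)}_\zeta,a^{(s)}_\zeta+1\}$; if $a^{(s)}_\zeta=r$ then $a^{(s+1)}_\zeta\in\{r,\overline r,\overline{r-1},\dots,\overline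 1\}$; if $a^{(s)}_\zeta=\overline j$ then $a^{(s+1)}_\zeta\in\{\overline j,\overline{j-1},\dots,\overline 1\}$; (iv) $(a^{(0)}_1,\dots,a^{(0)}_d)=(1,\dots,d)$, and $(a^{(m)}_1,\dots,a^{(m)}_d)=(m'+1,\dots,r,\overline{d-r+m'},\dots,\overline 2,\overline 1)$ if $m'+d>r$, $=(m'+1,\dots,m'+d)$ if $m'+d\le r$; (v) for $0\le s\le m-1$, $1\le\zeta\le d-1$: if $a^{(s+1)}_\zeta\in\{\overline j\mid 1\le j\le r\}$ then $|a^{(s+1)}_\zeta|>|a^{(s)}_{\zeta+1}|$. **Labels.** For $0\le s\le m-1$ let $Q^{(s)}(p)=\prod_{\zeta=1}^dQ(a^{(s)}_\zeta\to a^{(s+1)}_\zeta)$, where $$Q(a^{(s)}_\zeta\to a^{(s+1)}_\zeta)=\begin{cases}\dfrac{Y_{m-s,a^{(s+1)}_\zeta-1}}{Y_{m-s,a^{(s)}_\zeta}}&\text{if }1\le a^{(s)}_\zeta\le a^{(s+1)}_\zeta\le r,\\[6pt]\dfrac1{Y_{m-s,|a^{(s+1)}_\zeta|-1}}&\text{if }a^{(s)}_\zeta=r,\ \overline r\le a^{(s+1)}_\zeta\le\overline1,\\[6pt]\dfrac{Y_{m-s,|a^{(s)}_\zeta|}}{Y_{m-s,|a^{(s+1)}_\zeta|-1}}&\text{if }\overline r\le a^{(s)}_\zeta\le a^{(s+1)}_\zeta\le\overline1,\end{cases}$$ with the convention $Y_{s,0}=1$. The label of $p$ is $Q(p)=\prod_{s=0}^{m-1}Q^{(s)}(p)$.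 *)

theory Defs
  imports
    "Jordan_Normal_Form.Matrix"
    "HOL-Algebra.Coset"
    "HOL-Algebra.Generated_Groups"
    "HOL-Algebra.Group_Action"
    "HOL-Library.FuncSet"
begin

section \<open>The index set and the symplectic group\<close>

text \<open>
  The ordered index set \<open>1 < \<dots> < r < r-bar < \<dots> < 1-bar\<close> is encoded order-isomorphically as
  \<open>{1..2r}\<close> with its usual order, the barred index of \<open>i\<close> being \<open>2r + 1 - i\<close>.
\<close>

definition J :: "nat \<Rightarrow> nat set" where
  "J r = {1..2 * r}"

definition bar :: "nat \<Rightarrow> nat \<Rightarrow> nat" where
  "bar r i = 2 * r + 1 - i"

definition barred :: "nat \<Rightarrow> nat set" where
  "barred r = bar r ` {1..r}"

definition absidx :: "nat \<Rightarrow> nat \<Rightarrow> nat" where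
  "absidx r a = (if a \<in> barred r then bar r a else a)"

text \<open>
  Matrices act on column vectors in the basis \<open>v\<^sub>a\<close>, \<open>a \<in> J r\<close>; the library indexes rows and
  columns from 0, so \<open>v\<^sub>a\<close> sits at position \<open>a - 1\<close>. \<open>E_unit r a b\<close> maps \<open>v\<^sub>b\<close> to \<open>v\<^sub>a\<close> and
  kills the other basis vectors.
\<close>

definition E_unit :: "nat \<Rightarrow> nat \<Rightarrow> nat \<Rightarrow> complex mat" where
  "E_unit r a b = mat (2 * r) (2 * r) (\<lambda>(p, q). if Suc p = a \<and> Suc q = b then 1 else 0)"

definition chev_e :: "nat \<Rightarrow> nat \<Rightarrow> complex mat" where
  "chev_e r i = (if i < r then E_unit r i (i + 1) + E_unit r (bar r (i + 1)) (bar r i)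
                 else E_unit r r (bar r r))"

definition chev_f :: "nat \<Rightarrow> nat \<Rightarrow> complex mat" where
  "chev_f r i = (if i < r then E_unit r (i + 1) i + E_unit r (bar r i) (bar r (i + 1))
                 else E_unit r (bar r r) r)"

text \<open>
  Up to a scalar this is the only bilinear form invariant under all \<open>e\<^sub>i\<close>, \<open>f\<^sub>i\<close>;
  invariance forces its value on the pair of \<open>v\<^sub>i\<close> and its barred partner to alternate in sign with \<open>i\<close>.
\<close>

definition sp_form :: "nat \<Rightarrow> complex mat" where
  "sp_form r = mat (2 * r) (2 * r) (\<lambda>(p, q).
     if Suc p \<in> {1..r} \<and> Suc q = bar r (Suc p) then (-1) ^ p
     else if Suc q \<in> {1..r} \<and> Suc p = bar r (Suc q) then - ((-1) ^ q)
     else 0)"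

definition Sp :: "nat \<Rightarrow> complex mat monoid" where
  "Sp r = \<lparr>carrier = {g \<in> carrier_mat (2 * r) (2 * r). transpose_mat g * sp_form r * g = sp_form r},
           mult = (*), one = 1\<^sub>m (2 * r)\<rparr>"

definition gprod :: "('a, 'b) monoid_scheme \<Rightarrow> 'a list \<Rightarrow> 'a" where
  "gprod G xs = foldr (mult G) xs \<one>\<^bsub>G\<^esub>"

definition mat_exp :: "complex mat \<Rightarrow> complex mat" where
  "mat_exp A = mat (dim_row A) (dim_row A)
     (\<lambda>(p, q). \<Sum>k. (A ^\<^sub>m k) $$ (p, q) / fact k)"

definition x_sub :: "nat \<Rightarrow> nat \<Rightarrow> complex \<Rightarrow> complex mat" where
  "x_sub r i t = mat_exp (t \<cdot>\<^sub>m chev_e r i)"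

definition y_sub :: "nat \<Rightarrow> nat \<Rightarrow> complex \<Rightarrow> complex mat" where
  "y_sub r i t = mat_exp (t \<cdot>\<^sub>m chev_f r i)"

text \<open>A weight \<open>\<mu>\<close> is represented by its values \<open>\<mu>(h\<^sub>j)\<close>, \<open>1 \<le> j \<le> r\<close>; thus \<open>\<Lambda>\<^sub>0\<close> vanishes there.\<close>

definition fund_weight :: "nat \<Rightarrow> nat \<Rightarrow> int" where
  "fund_weight i j = (if i = j then 1 else 0)"

definition wt :: "nat \<Rightarrow> nat \<Rightarrow> nat \<Rightarrow> int" where
  "wt r a j = (let l = absidx r a in
     if a \<in> barred r then fund_weight (l - 1) j - fund_weight l j
     else fund_weight l j - fund_weight (l - 1) j)"

definition coroot :: "nat \<Rightarrow> nat \<Rightarrow> complex \<Rightarrow> complex mat" where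
  "coroot r i t = mat (2 * r) (2 * r) (\<lambda>(p, q). if p = q then t powi wt r (Suc p) i else 0)"

definition x_neg :: "nat \<Rightarrow> nat \<Rightarrow> complex \<Rightarrow> complex mat" where
  "x_neg r i t = y_sub r i t * coroot r i (inverse t)"


section \<open>Zariski topology and unipotent radicals\<close>

inductive_set poly_fun :: "nat \<Rightarrow> (complex mat \<Rightarrow> complex) set" for n :: nat where
  const: "(\<lambda>_. c) \<in> poly_fun n"
| entry: "i < n \<Longrightarrow> j < n \<Longrightarrow> (\<lambda>x. x $$ (i, j)) \<in> poly_fun n"
| add: "f \<in> poly_fun n \<Longrightarrow> g \<in> poly_fun n \<Longrightarrow> (\<lambda>x. f x + g x) \<in> poly_fun n"
| mult: "f \<in> poly_fun n \<Longrightarrow> g \<in> poly_fun n \<Longrightarrow> (\<lambda>x. f x * g x) \<in> poly_fun n"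

definition zariski_closed :: "nat \<Rightarrow> complex mat set \<Rightarrow> bool" where
  "zariski_closed n S \<longleftrightarrow>
     (\<exists>F \<subseteq> poly_fun n. S = {x \<in> carrier_mat n n. \<forall>f\<in>F. f x = 0})"

definition zariski_connected :: "nat \<Rightarrow> complex mat set \<Rightarrow> bool" where
  "zariski_connected n S \<longleftrightarrow>
     \<not> (\<exists>C D. zariski_closed n C \<and> zariski_closed n D \<and> S \<subseteq> C \<union> D \<and> C \<inter> D \<inter> S = {} \<and>
          C \<inter> S \<noteq> {} \<and> D \<inter> S \<noteq> {})"

definition unipotent_mat :: "nat \<Rightarrow> complex mat \<Rightarrow> bool" where
  "unipotent_mat n x \<longleftrightarrow> (\<exists>k. (x - 1\<^sub>m n) ^\<^sub>m k = 0\<^sub>m n n)"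

text \<open>
  The unipotent radical is the largest closed connected normal unipotent subgroup;
  being the largest, it is the union of all of them.
\<close>

definition unipotent_radical :: "nat \<Rightarrow> complex mat set \<Rightarrow> complex mat set" where
  "unipotent_radical r B = \<Union> {U. U \<lhd> (Sp r)\<lparr>carrier := B\<rparr> \<and> zariski_closed (2 * r) U \<and>
     zariski_connected (2 * r) U \<and> (\<forall>u\<in>U. unipotent_mat (2 * r) u)}"

definition torus :: "nat \<Rightarrow> complex mat set" where
  "torus r = {h \<in> carrier (Sp r). diagonal_mat h}"

definition borel_pos :: "nat \<Rightarrow> complex mat set" where
  "borel_pos r = generate (Sp r) (torus r \<union> {x_sub r i t | i t. i \<in> {1..r}})"

definition borel_neg :: "nat \<Rightarrow> complex mat set" where
  "borel_neg r = generate (Sp r) (torus r \<union> {y_sub r i t | i t. i \<in> {1..r}})"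

definition N_pos :: "nat \<Rightarrow> complex mat set" where
  "N_pos r = unipotent_radical r (borel_pos r)"

definition N_neg :: "nat \<Rightarrow> complex mat set" where
  "N_neg r = unipotent_radical r (borel_neg r)"

text \<open>
  \<open>h\<^sup>\<mu>\<close>: every \<open>h\<close> in the torus is uniquely \<open>\<Prod>\<^sub>j \<alpha>\<^sub>j\<^sup>\<or>(t\<^sub>j)\<close> (the group is simply connected), and
  the character \<open>\<mu>\<close> takes the value \<open>t powi \<mu>(h\<^sub>j)\<close> on \<open>\<alpha>\<^sub>j\<^sup>\<or>(t)\<close>.
\<close>

definition torus_char :: "nat \<Rightarrow> (nat \<Rightarrow> int) \<Rightarrow> complex mat \<Rightarrow> complex" where
  "torus_char r \<mu> h = (THE c. \<exists>t. (\<forall>j\<in>{1..r}. t j \<noteq> 0) \<and>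
     h = gprod (Sp r) (map (\<lambda>j. coroot r j (t j)) [1..<Suc r]) \<and>
     c = (\<Prod>j = 1..r. t j powi \<mu> j))"


section \<open>Weyl group\<close>

definition weyl :: "nat \<Rightarrow> complex mat set monoid" where
  "weyl r = (Sp r)\<lparr>carrier := normalizer (Sp r) (torus r)\<rparr> Mod torus r"

definition s_rep :: "nat \<Rightarrow> nat \<Rightarrow> complex mat" where
  "s_rep r i = x_sub r i (-1) * y_sub r i 1 * x_sub r i (-1)"

definition simple_refl :: "nat \<Rightarrow> nat \<Rightarrow> complex mat set" where
  "simple_refl r i = torus r #>\<^bsub>Sp r\<^esub> s_rep r i"

definition weyl_word :: "nat \<Rightarrow> nat list \<Rightarrow> complex mat set" where
  "weyl_word r js = gprod (weyl r) (map (simple_refl r) js)"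

definition reduced_word :: "nat \<Rightarrow> nat list \<Rightarrow> complex mat set \<Rightarrow> bool" where
  "reduced_word r js w \<longleftrightarrow> set js \<subseteq> {1..r} \<and> weyl_word r js = w \<and>
     (\<forall>js'. set js' \<subseteq> {1..r} \<and> weyl_word r js' = w \<longrightarrow> length js \<le> length js')"

text \<open>By the braid relations the representative does not depend on the chosen reduced word.\<close>

definition weyl_rep :: "nat \<Rightarrow> complex mat set \<Rightarrow> complex mat" where
  "weyl_rep r w = gprod (Sp r) (map (s_rep r) (SOME js. reduced_word r js w))"


section \<open>Generalized minors\<close>

definition G0 :: "nat \<Rightarrow> complex mat set" where
  "G0 r = {y * h * x | y h x. y \<in> N_neg r \<and> h \<in> torus r \<and> x \<in> N_pos r}"

definition gauss0 :: "nat \<Rightarrow> complex mat \<Rightarrow> complex mat" where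
  "gauss0 r g = (THE h. h \<in> torus r \<and> (\<exists>y\<in>N_neg r. \<exists>x\<in>N_pos r. g = y * h * x))"

text \<open>
  Regular functions on the closed subvariety \<open>Sp r\<close> of the matrix space are the restrictions of
  polynomials in the matrix entries.
\<close>

definition regular_on_Sp :: "nat \<Rightarrow> (complex mat \<Rightarrow> complex) \<Rightarrow> bool" where
  "regular_on_Sp r f \<longleftrightarrow> f \<in> extensional (carrier (Sp r)) \<and>
     (\<exists>p\<in>poly_fun (2 * r). \<forall>g\<in>carrier (Sp r). f g = p g)"

text \<open>\<open>gen_minor r w w' i\<close> is \<open>\<Delta>\<close> with subscripts \<open>w \<Lambda>\<^sub>i\<close> and \<open>w' \<Lambda>\<^sub>i\<close>.\<close>

definition gen_minor ::
  "nat \<Rightarrow> complex mat set \<Rightarrow> complex mat set \<Rightarrow> nat \<Rightarrow> complex mat \<Rightarrow> complex" where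
  "gen_minor r w w' i = (THE f. regular_on_Sp r f \<and>
     (\<forall>x \<in> (\<lambda>g. weyl_rep r w * g * inv\<^bsub>Sp r\<^esub> (weyl_rep r w')) ` G0 r.
        f x = torus_char r (fund_weight i)
                (gauss0 r (inv\<^bsub>Sp r\<^esub> (weyl_rep r w) * x * weyl_rep r w'))))"

definition iword :: "nat \<Rightarrow> nat \<Rightarrow> nat \<Rightarrow> nat list" where
  "iword r m i\<^sub>n = concat (replicate (m - 1) [1..<Suc r]) @ [1..<Suc i\<^sub>n]"

text \<open>Words are 1-based: the \<open>k\<close>-th letter of \<open>ws\<close> is \<open>ws ! (k - 1)\<close>.\<close>

definition Delta_k :: "nat \<Rightarrow> nat list \<Rightarrow> nat \<Rightarrow> complex mat \<Rightarrow> complex" where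
  "Delta_k r ws k = gen_minor r (weyl_word r (take k ws)) \<one>\<^bsub>weyl r\<^esub> (ws ! (k - 1))"

definition x_L :: "nat \<Rightarrow> nat \<Rightarrow> nat \<Rightarrow> (nat \<Rightarrow> nat \<Rightarrow> complex) \<Rightarrow> complex mat" where
  "x_L r m i\<^sub>n Y = gprod (Sp r)
     (concat (map (\<lambda>s. map (\<lambda>l. x_neg r l (Y s l)) [1..<Suc r]) [1..<m])
      @ map (\<lambda>l. x_neg r l (Y m l)) [1..<Suc i\<^sub>n])"

definition Delta_L ::
  "nat \<Rightarrow> nat \<Rightarrow> nat \<Rightarrow> nat \<Rightarrow> (nat \<Rightarrow> nat \<Rightarrow> complex) \<Rightarrow> complex" where
  "Delta_L r m i\<^sub>n k Y = Delta_k r (iword r m i\<^sub>n) k (x_L r m i\<^sub>n Y)"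


section \<open>Paths and labels\<close>

text \<open>
  A path is the list of its \<open>m + 1\<close> vertices, each the list of its \<open>d\<close> entries;
  \<open>ent p s \<zeta>\<close> is the entry with upper index \<open>s\<close> and (1-based) lower index \<open>\<zeta>\<close>.
\<close>

definition ent :: "nat list list \<Rightarrow> nat \<Rightarrow> nat \<Rightarrow> nat" where
  "ent p s \<zeta> = p ! s ! (\<zeta> - 1)"

definition path_start :: "nat \<Rightarrow> nat list" where
  "path_start d = [1..<Suc d]"

definition path_end :: "nat \<Rightarrow> nat \<Rightarrow> nat \<Rightarrow> nat list" where
  "path_end r d m' =
     (if m' + d > r then [m' + 1..<Suc r] @ map (bar r) (rev [1..<Suc (d + m' - r)])
      else [m' + 1..<Suc (m' + d)])"

definition succs :: "nat \<Rightarrow> nat \<Rightarrow> nat set" where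
  "succs r a = (if a \<in> {1..<r} then {a, a + 1}
                else if a = r then {r} \<union> barred r
                else bar r ` {1..absidx r a})"

definition paths :: "nat \<Rightarrow> nat \<Rightarrow> nat \<Rightarrow> nat \<Rightarrow> nat list list set" where
  "paths r d m m' = {p. length p = m + 1 \<and> (\<forall>s\<le>m. length (p ! s) = d) \<and>
     (\<forall>s\<le>m. \<forall>\<zeta>\<in>{1..d}. ent p s \<zeta> \<in> J r) \<and>
     (\<forall>s\<le>m. \<forall>\<zeta>\<in>{1..<d}. ent p s \<zeta> < ent p s (\<zeta> + 1)) \<and>
     (\<forall>s<m. \<forall>\<zeta>\<in>{1..d}. ent p (s + 1) \<zeta> \<in> succs r (ent p s \<zeta>)) \<and>
     p ! 0 = path_start d \<and> p ! m = path_end r d m' \<and>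
     (\<forall>s<m. \<forall>\<zeta>\<in>{1..<d}. ent p (s + 1) \<zeta> \<in> barred r \<longrightarrow>
        absidx r (ent p (s + 1) \<zeta>) > absidx r (ent p s (\<zeta> + 1)))}"

definition Y0 :: "(nat \<Rightarrow> nat \<Rightarrow> complex) \<Rightarrow> nat \<Rightarrow> nat \<Rightarrow> complex" where
  "Y0 Y s l = (if l = 0 then 1 else Y s l)"

text \<open>\<open>edge_label r Y c a b\<close> is \<open>Q(a \<rightarrow> b)\<close> for an edge with cycle index \<open>c = m - s\<close>;
  the last branch is never reached along a path.\<close>

definition edge_label :: "nat \<Rightarrow> (nat \<Rightarrow> nat \<Rightarrow> complex) \<Rightarrow> nat \<Rightarrow> nat \<Rightarrow> nat \<Rightarrow> complex" where
  "edge_label r Y c a b =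
     (if 1 \<le> a \<and> a \<le> b \<and> b \<le> r then Y0 Y c (b - 1) / Y0 Y c a
      else if a = r \<and> b \<in> barred r then 1 / Y0 Y c (absidx r b - 1)
      else if a \<in> barred r \<and> b \<in> barred r \<and> a \<le> b
        then Y0 Y c (absidx r a) / Y0 Y c (absidx r b - 1)
      else 0)"

definition path_label ::
  "nat \<Rightarrow> nat \<Rightarrow> nat \<Rightarrow> (nat \<Rightarrow> nat \<Rightarrow> complex) \<Rightarrow> nat list list \<Rightarrow> complex" where
  "path_label r d m Y p =
     (\<Prod>s<m. \<Prod>\<zeta> = 1..d. edge_label r Y (m - s) (ent p s \<zeta>) (ent p (s + 1) \<zeta>))"

end

theory Submission
  imports Defs "Jordan_Normal_Form.Determinant" "HOL-Computational_Algebra.Polynomial"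
begin

text \<open>
  A generalized minor is identified with an ordinary minor of the \<open>2 r \<times> 2 r\<close> matrix: by Gaussian
  elimination inside \<open>Sp\<close> with the one-parameter subgroups, \<open>N\<close> and \<open>N\<^sub>-\<close> are the groups of unitriangular
  symplectic matrices and \<open>G\<^sub>0\<close> is the Zariski dense set where the leading minors of orders \<open>1, \<dots>, r\<close> do not
  vanish; on it the character of weight \<open>\<Lambda>\<^sub>d\<close> is the leading minor of order \<open>d\<close>. Any reduced word
  for \<open>w\<close> moves the index set \<open>{1, \<dots>, d}\<close> monotonically upwards, hence its representative carries the leading
  minor, without a sign, to the minor with rows \<open>w {1, \<dots>, d}\<close> and columns \<open>1, \<dots>, d\<close>.

  That minor of \<open>x\<^sup>L(Y)\<close> is expanded by the Cauchy--Binet formula over the \<open>m\<close> cycles. The entry of a cycle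
  in row \<open>b\<close> and column \<open>a\<close> is the label of the edge from \<open>a\<close> to \<open>b\<close>, and because the columns with index at
  least \<open>r\<close> are proportional below the diagonal, each of its minors is either the product of the diagonal
  labels or zero, according to condition (v) on paths.
\<close>

section \<open>Minors and the Cauchy--Binet formula\<close>

text \<open>\<open>gen_minor\<close>, \<open>gauss0\<close> and \<open>torus_char\<close> are
  definite descriptions, so identifying them with minors takes both existence and uniqueness.
  Uniqueness of \<open>gen_minor\<close> is what calls for the density of the big cell; it rests on
  one-variable polynomials with infinitely many zeros. The unipotent radicals are known only through
  their characterization, hence the unitriangular groups have to be shown closed, connected, normal
  and unipotent. \<open>weyl_rep\<close> picks an unspecified reduced word, so the argument treats
  all reduced words at once, through the exchange condition for permutations of \<open>J\<close>.
  The obstacle there is signs: each \<open>s_rep\<close> is a signed permutation matrix, and a sign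
  can enter only when the set of rows being moved contains the upper end of an arrow without its
  lower end; a shorter word would then exist. Minors of order at most \<open>r\<close> suffice
  because, once the first \<open>r\<close> columns are upper triangular with nonzero diagonal, the
  symplectic pairing forces the same triangular shape on the remaining ones.\<close>

definition minor :: "(nat \<Rightarrow> nat \<Rightarrow> 'a::comm_ring_1) \<Rightarrow> nat list \<Rightarrow> nat list \<Rightarrow> 'a" where
  "minor g B A = det (mat (length B) (length B) (\<lambda>(p, q). g (B ! p) (A ! q)))"

text \<open>Increasing lists stand for the \<open>d\<close>-element subsets of \<open>S\<close>.
  They index minors, and they are also the path vertices allowed by conditions (i) and (ii).\<close>

definition incl :: "nat set \<Rightarrow> nat \<Rightarrow> nat list set" where
  "incl S d = {K. length K = d \<and> sorted_wrt (<) K \<and> set K \<subseteq> S}"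

lemma finite_incl: "finite S \<Longrightarrow> finite (incl S d)"
  by (rule finite_subset[OF _ finite_lists_length_eq[of S d]]) (auto simp: incl_def)

lemma incl_eqI: "K \<in> incl S d \<Longrightarrow> L \<in> incl S d \<Longrightarrow> set K = set L \<Longrightarrow> K = L"
  by (auto simp: incl_def strict_sorted_iff intro: sorted_distinct_set_unique)

text \<open>An injection is the increasing enumeration of its image composed with a permutation.
  Being the identity outside \<open>{0..<d}\<close> matches the functions over which
  \<open>det_linear_rows_sum\<close> sums.\<close>

lemma injective_as_increasing_permuted:
  assumes "inj_on f {0..<d}" "\<And>i. i < d \<Longrightarrow> f i \<in> S" "\<And>i. \<not> i < d \<Longrightarrow> f i = i" "finite S"
  shows "\<exists>K p. K \<in> incl S d \<and> p permutes {0..<d} \<and> f = (\<lambda>i. if i < d then K ! p i else i)"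
proof -
  let ?K = "sorted_list_of_set (f ` {0..<d})"
  have fin: "finite (f ` {0..<d})" by simp
  have setK: "set ?K = f ` {0..<d}" by simp
  have len: "length ?K = d" using assms(1) by (simp add: card_image)
  have K: "?K \<in> incl S d"
    using assms(2) len by (auto simp: incl_def)
  have bijK: "bij_betw (\<lambda>j. ?K ! j) {0..<d} (f ` {0..<d})"
    using bij_betw_nth[of ?K "{..<length ?K}" "set ?K"] len setK by (simp add: lessThan_atLeast0)
  have bijf: "bij_betw f {0..<d} (f ` {0..<d})" using assms(1) by (simp add: bij_betw_imageI)
  let ?g = "the_inv_into {0..<d} (\<lambda>j. ?K ! j)"
  have bijg: "bij_betw ?g (f ` {0..<d}) {0..<d}" by (rule bij_betw_the_inv_into[OF bijK])
  define p where "p = (\<lambda>i. if i < d then ?g (f i) else i)"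
  have "bij_betw (?g \<circ> f) {0..<d} {0..<d}" by (rule bij_betw_trans[OF bijf bijg])
  then have "bij_betw p {0..<d} {0..<d}"
    by (rule bij_betw_cong[THEN iffD1, rotated]) (auto simp: p_def)
  then have p: "p permutes {0..<d}"
    by (rule bij_imp_permutes) (auto simp: p_def)
  have "?K ! p i = f i" if "i < d" for i
    unfolding p_def using that f_the_inv_into_f_bij_betw[OF bijK, of "f i"] by auto
  then have "f = (\<lambda>i. if i < d then ?K ! p i else i)" using assms(3) by fastforce
  with K p show ?thesis by blast
qed

text \<open>Multilinearity in the rows expands the determinant over all functions from row positions
  to \<open>S\<close>. A function that is not injective yields two equal rows; the injective ones
  are grouped by their image, and the permutations belonging to one image make up the Leibniz
  formula of the other factor.\<close>

lemma Cauchy_Binet: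
  fixes g h :: "nat \<Rightarrow> nat \<Rightarrow> 'a::comm_ring_1"
  assumes S: "finite S" and B: "length B = d" and A: "length A = d"
  shows "minor (\<lambda>a b. \<Sum>c\<in>S. g a c * h c b) B A = (\<Sum>K\<in>incl S d. minor g B K * minor h K A)"
proof -
  define F where "F = {f :: nat \<Rightarrow> nat. (\<forall>i\<in>{0..<d}. f i \<in> S) \<and> (\<forall>i. i \<notin> {0..<d} \<longrightarrow> f i = i)}"
  define hr where "hr c = vec d (\<lambda>q. h c (A ! q))" for c
  have hr: "hr c \<in> carrier_vec d" for c by (simp add: hr_def)
  define D where "D f = det (mat\<^sub>r d d (\<lambda>i. hr (f i)))" for f :: "nat \<Rightarrow> nat"
  define w where "w f = (\<Prod>i\<in>{0..<d}. g (B ! i) (f i)) * D f" for f :: "nat \<Rightarrow> nat"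
  define \<phi> :: "nat list \<times> (nat \<Rightarrow> nat) \<Rightarrow> nat \<Rightarrow> nat"
    where "\<phi> = (\<lambda>(K, p) i. if i < d then K ! p i else i)"
  define P where "P = {p. p permutes {0..<d}}"
  have finP: "finite P" by (simp add: P_def finite_permutations)
  have "mat (length B) (length B) (\<lambda>(p, q). \<Sum>c\<in>S. g (B ! p) c * h c (A ! q))
      = mat\<^sub>r d d (\<lambda>i. finsum_vec TYPE('a) d (\<lambda>c. g (B ! i) c \<cdot>\<^sub>v hr c) S)"
    using B hr by (intro eq_matI) (auto simp: index_finsum_vec[OF S] hr_def)
  then have "minor (\<lambda>a b. \<Sum>c\<in>S. g a c * h c b) B A
      = det (mat\<^sub>r d d (\<lambda>i. finsum_vec TYPE('a) d (\<lambda>c. g (B ! i) c \<cdot>\<^sub>v hr c) S))"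
    by (simp add: minor_def)
  also have "\<dots> = (\<Sum>f\<in>F. det (mat\<^sub>r d d (\<lambda>i. g (B ! i) (f i) \<cdot>\<^sub>v hr (f i))))"
    unfolding F_def by (rule det_linear_rows_sum[OF S]) (use hr in auto)
  also have "\<dots> = (\<Sum>f\<in>F. w f)"
    unfolding w_def D_def by (intro sum.cong refl det_rows_mul) (use hr in auto)
  also have "\<dots> = (\<Sum>f\<in>\<phi> ` (incl S d \<times> P). w f)"
  proof (rule sum.mono_neutral_right)
    show "finite F" unfolding F_def by (rule finite_bounded_functions[OF S]) simp
    show "\<phi> ` (incl S d \<times> P) \<subseteq> F"
    proof clarify
      fix K p assume K: "K \<in> incl S d" and p: "p \<in> P"
      have "p i < d" if "i < d" for i using p that permutes_in_image[of p "{0..<d}" i] by (auto simp: P_def)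
      then show "\<phi> (K, p) \<in> F"
        using K by (auto simp: F_def \<phi>_def incl_def)
    qed
    show "\<forall>f\<in>F - \<phi> ` (incl S d \<times> P). w f = 0"
    proof
      fix f assume f: "f \<in> F - \<phi> ` (incl S d \<times> P)"
      have "\<not> inj_on f {0..<d}"
      proof
        assume "inj_on f {0..<d}"
        from injective_as_increasing_permuted[OF this _ _ S] f
        obtain K p where "K \<in> incl S d" "p permutes {0..<d}" "f = \<phi> (K, p)"
          by (auto simp: F_def \<phi>_def)
        then show False using f by (auto simp: P_def)
      qed
      then obtain i j where ij: "i < d" "j < d" "i \<noteq> j" "f i = f j" by (auto simp: inj_on_def)
      have "D f = 0" unfolding D_def
        by (rule det_identical_rows[of _ d i j]) (use ij hr in auto)
      then show "w f = 0" by (simp add: w_def)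
    qed
  qed
  also have "\<dots> = (\<Sum>x\<in>incl S d \<times> P. w (\<phi> x))"
  proof (rule sum.reindex_cong[of \<phi>])
    show "inj_on \<phi> (incl S d \<times> P)"
    proof (rule inj_onI, clarify)
      fix K p L q assume KL: "K \<in> incl S d" "L \<in> incl S d" and pq: "p \<in> P" "q \<in> P"
        and eq: "\<phi> (K, p) = \<phi> (L, q)"
      have e: "K ! p i = L ! q i" if "i < d" for i
        using fun_cong[OF eq, of i] that by (simp add: \<phi>_def)
      have pr: "p ` {0..<d} = {0..<d}" "q ` {0..<d} = {0..<d}"
        using pq permutes_image by (auto simp: P_def)
      have range: "set M = (\<lambda>i. M ! s i) ` {0..<d}" if "length M = d" "s ` {0..<d} = {0..<d}"
        for M :: "nat list" and s
      proof -
        have "(\<lambda>i. M ! s i) ` {0..<d} = (\<lambda>j. M ! j) ` {0..<d}"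
          using that(2) by (metis image_image)
        also have "\<dots> = set M" using that(1) by (auto simp: set_conv_nth)
        finally show ?thesis by simp
      qed
      from range[OF _ pr(1), of K] range[OF _ pr(2), of L]
      have "set K = (\<lambda>i. K ! p i) ` {0..<d}" "set L = (\<lambda>i. L ! q i) ` {0..<d}"
        using KL by (auto simp only: incl_def)
      then have "set K = set L" using e by (simp cong: image_cong_simp)
      then have KeqL: "K = L" using KL incl_eqI by blast
      have "p i = q i" for i
      proof (cases "i < d")
        case True
        then have "p i < d" "q i < d"
          using pq permutes_in_image[of p "{0..<d}" i] permutes_in_image[of q "{0..<d}" i]
          by (auto simp: P_def)
        then show ?thesis using e[OF True] KL KeqL
          by (auto simp: incl_def strict_sorted_iff nth_eq_iff_index_eq)
      next
        case False
        then show ?thesis using pq permutes_not_in[of p "{0..<d}" i] permutes_not_in[of q "{0..<d}" i]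
          by (auto simp: P_def)
      qed
      then show "K = L \<and> p = q" using KeqL by auto
    qed
  qed auto
  also have "\<dots> = (\<Sum>K\<in>incl S d. \<Sum>p\<in>P. w (\<phi> (K, p)))"
    by (simp add: sum.cartesian_product)
  also have "\<dots> = (\<Sum>K\<in>incl S d. minor g B K * minor h K A)"
  proof (rule sum.cong[OF refl])
    fix K assume K: "K \<in> incl S d"
    then have lenK: "length K = d" by (simp add: incl_def)
    have "w (\<phi> (K, p)) = (signof p * (\<Prod>i\<in>{0..<d}. g (B ! i) (K ! p i))) * minor h K A" if p: "p \<in> P" for p
    proof -
      have "p i < d" if "i < d" for i using p that permutes_in_image[of p "{0..<d}" i] by (auto simp: P_def)
      then have "mat\<^sub>r d d (\<lambda>i. hr (\<phi> (K, p) i))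
          = mat d d (\<lambda>(i, j). mat d d (\<lambda>(i, j). h (K ! i) (A ! j)) $$ (p i, j))"
        by (intro eq_matI) (auto simp: hr_def \<phi>_def)
      then have "D (\<phi> (K, p)) = signof p * minor h K A"
        using p lenK det_permute_rows[of "mat d d (\<lambda>(i, j). h (K ! i) (A ! j))" d p]
        by (simp add: D_def minor_def P_def)
      moreover have "(\<Prod>i\<in>{0..<d}. g (B ! i) (\<phi> (K, p) i)) = (\<Prod>i\<in>{0..<d}. g (B ! i) (K ! p i))"
        by (intro prod.cong) (auto simp: \<phi>_def)
      ultimately show ?thesis by (simp add: w_def mult_ac)
    qed
    then have "(\<Sum>p\<in>P. w (\<phi> (K, p))) = (\<Sum>p\<in>P. signof p * (\<Prod>i\<in>{0..<d}. g (B ! i) (K ! p i))) * minor h K A"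
      by (simp add: sum_distrib_right)
    also have "(\<Sum>p\<in>P. signof p * (\<Prod>i\<in>{0..<d}. g (B ! i) (K ! p i))) = minor g B K"
    proof -
      have "mat d d (\<lambda>(p, q). g (B ! p) (K ! q)) \<in> carrier_mat d d" by simp
      from det_def'[OF this] show ?thesis unfolding minor_def B P_def
        by (auto intro!: sum.cong prod.cong simp: permutes_in_image)
    qed
    finally show "(\<Sum>p\<in>P. w (\<phi> (K, p))) = minor g B K * minor h K A" .
  qed
  finally show ?thesis .
qed

section \<open>The generators in matrix form\<close>

lemmas square_mult = assoc_mult_mat[of _ "2*r" "2*r" _ "2*r" _ "2*r"] mult_carrier_mat[of _ "2*r" "2*r"] for r

text \<open>Shifts the 0-based matrix positions to the labels in \<open>J\<close>, so that rows and
  columns carry the names of the basis vectors.\<close>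

definition mentry :: "'a mat \<Rightarrow> nat \<Rightarrow> nat \<Rightarrow> 'a" where
  "mentry g a b = g $$ (a - 1, b - 1)"

lemma mat_eqI_mentry:
  assumes "g \<in> carrier_mat n n" "h \<in> carrier_mat n n"
    and "\<And>a b. a \<in> {1..n} \<Longrightarrow> b \<in> {1..n} \<Longrightarrow> mentry g a b = mentry h a b"
  shows "g = h"
proof (rule eq_matI)
  fix i j assume "i < dim_row h" "j < dim_col h"
  then show "g $$ (i, j) = h $$ (i, j)" using assms(1,2) assms(3)[of "Suc i" "Suc j"]
    by (auto simp: mentry_def)
qed (use assms in auto)

lemma mentry_mult:
  assumes "g \<in> carrier_mat n n" "h \<in> carrier_mat n n" "a \<in> {1..n}" "b \<in> {1..n}"
  shows "mentry (g * h) a b = (\<Sum>c\<in>{1..n}. mentry g a c * mentry h c b)"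
proof -
  have "mentry (g * h) a b = (\<Sum>c\<in>{0..<n}. g $$ (a - 1, c) * h $$ (c, b - 1))"
    using assms by (auto simp: mentry_def scalar_prod_def intro!: sum.cong)
  also have "\<dots> = (\<Sum>c\<in>{1..n}. mentry g a c * mentry h c b)"
    by (rule sum.reindex_bij_witness[of _ "\<lambda>c. c - 1" Suc]) (auto simp: mentry_def)
  finally show ?thesis .
qed

lemma mentry_one: "a \<in> {1..n} \<Longrightarrow> b \<in> {1..n} \<Longrightarrow> mentry (1\<^sub>m n) a b = (if a = b then 1 else 0)"
  by (auto simp: mentry_def)

lemma mentry_transpose:
  "g \<in> carrier_mat n n \<Longrightarrow> a \<in> {1..n} \<Longrightarrow> b \<in> {1..n} \<Longrightarrow> mentry (transpose_mat g) a b = mentry g b a"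
  by (auto simp: mentry_def)

lemma mentry_add: "h \<in> carrier_mat n n \<Longrightarrow> a \<in> {1..n} \<Longrightarrow> b \<in> {1..n} \<Longrightarrow>
   mentry (g + h) a b = mentry g a b + mentry h a b"
  by (auto simp: mentry_def)

lemma mentry_smult: "h \<in> carrier_mat n n \<Longrightarrow> a \<in> {1..n} \<Longrightarrow> b \<in> {1..n} \<Longrightarrow>
   mentry (t \<cdot>\<^sub>m h) a b = t * mentry h a b"
  by (auto simp: mentry_def)

lemma mentry_E_unit: "a \<in> {1..2*r} \<Longrightarrow> b \<in> {1..2*r} \<Longrightarrow>
   mentry (E_unit r i j) a b = (if a = i \<and> b = j then 1 else 0)"
  by (auto simp: mentry_def E_unit_def)

text \<open>The simple root vector with index \<open>i\<close> connects \<open>a\<close> and \<open>a + 1\<close> exactly when \<open>step r i a\<close>;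
  for \<open>i = r\<close> the two alternatives coincide.\<close>

definition step :: "nat \<Rightarrow> nat \<Rightarrow> nat \<Rightarrow> bool" where
  "step r i a \<longleftrightarrow> a = i \<or> a = 2 * r - i"

lemma E_unit_carrier[simp]: "E_unit r a b \<in> carrier_mat (2 * r) (2 * r)"
  by (simp add: E_unit_def)

lemma chev_carrier[simp]: "chev_e r i \<in> carrier_mat (2 * r) (2 * r)"
  "chev_f r i \<in> carrier_mat (2 * r) (2 * r)"
  by (auto simp: chev_e_def chev_f_def)

lemma dim_row_chev[simp]: "dim_row (chev_e r i) = 2 * r"
  and dim_col_chev[simp]: "dim_col (chev_e r i) = 2 * r"
  using chev_carrier(1)[of r i] by (auto simp del: chev_carrier)

text \<open>Parity: \<open>i\<close> and \<open>2 * r - i\<close> differ by an even number, so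
  arrows of the same index are never consecutive. This is why the Chevalley generators square to
  zero and their exponentials are affine in the parameter.\<close>

lemma step_Suc: "i \<in> {1..r} \<Longrightarrow> step r i a \<Longrightarrow> \<not> step r i (Suc a)"
  unfolding step_def atLeastAtMost_iff by presburger

lemma mentry_chev_e:
  assumes "i \<in> {1..r}" "a \<in> {1..2*r}" "b \<in> {1..2*r}"
  shows "mentry (chev_e r i) a b = (if b = a + 1 \<and> step r i a then 1 else 0)"
proof (cases "i < r")
  case True
  then have "bar r (i + 1) = 2 * r - i" "bar r i = Suc (2 * r - i)" "i \<noteq> 2 * r - i" by (auto simp: bar_def)
  then show ?thesis using assms(2,3) True
    by (simp add: chev_e_def step_def mentry_add[of _ "2*r"] mentry_E_unit)
next
  case False
  then have "i = r" using assms(1) by simp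
  then show ?thesis using assms(2,3)
    by (simp add: chev_e_def step_def mentry_E_unit bar_def)
qed

lemma mentry_chev_f:
  assumes "i \<in> {1..r}" "a \<in> {1..2*r}" "b \<in> {1..2*r}"
  shows "mentry (chev_f r i) a b = (if a = b + 1 \<and> step r i b then 1 else 0)"
proof (cases "i < r")
  case True
  then have "bar r (i + 1) = 2 * r - i" "bar r i = Suc (2 * r - i)" "i \<noteq> 2 * r - i" by (auto simp: bar_def)
  then show ?thesis using assms(2,3) True
    by (simp add: chev_f_def step_def mentry_add[of _ "2*r"] mentry_E_unit)
next
  case False
  then have "i = r" using assms(1) by simp
  then show ?thesis using assms(2,3)
    by (simp add: chev_f_def step_def mentry_E_unit bar_def)
qed

lemma chev_f_transpose: "i \<in> {1..r} \<Longrightarrow> chev_f r i = transpose_mat (chev_e r i)"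
  by (rule mat_eqI_mentry[of _ "2*r"])
    (auto simp: mentry_transpose[of _ "2*r"] mentry_chev_e mentry_chev_f)

lemma mat_exp_square_zero:
  assumes A: "A \<in> carrier_mat n n" and sq: "A * A = 0\<^sub>m n n"
  shows "mat_exp A = 1\<^sub>m n + A"
proof (rule eq_matI)
  fix p q assume "p < dim_row (1\<^sub>m n + A)" "q < dim_col (1\<^sub>m n + A)"
  then have pq: "p < n" "q < n" using A by auto
  have pow: "A ^\<^sub>m (Suc (Suc k)) = 0\<^sub>m n n" for k
  proof (induction k)
    case 0
    then show ?case using A sq by simp
  next
    case (Suc k)
    then show ?case using A by (metis left_mult_zero_mat pow_mat.simps(2))
  qed
  have "(\<Sum>k. (A ^\<^sub>m k) $$ (p, q) / fact k) = (\<Sum>k\<in>{0, 1}. (A ^\<^sub>m k) $$ (p, q) / fact k)"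
  proof (rule suminf_finite)
    fix k :: nat assume "k \<notin> {0, 1}"
    then obtain k' where "k = Suc (Suc k')" by (metis One_nat_def insertI1 insertI2 not0_implies_Suc)
    then show "(A ^\<^sub>m k) $$ (p, q) / fact k = 0" using pow pq by simp
  qed simp
  also have "\<dots> = (1\<^sub>m n + A) $$ (p, q)" using A pq by simp
  finally show "mat_exp A $$ (p, q) = (1\<^sub>m n + A) $$ (p, q)"
    using A pq by (simp add: mat_exp_def)
qed (use A in \<open>auto simp: mat_exp_def\<close>)

lemma chev_e_square: assumes i: "i \<in> {1..r}" shows "chev_e r i * chev_e r i = 0\<^sub>m (2*r) (2*r)"
proof (rule mat_eqI_mentry[of _ "2*r"])
  fix a b assume ab: "a \<in> {1..2*r}" "b \<in> {1..2*r}"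
  have "mentry (chev_e r i * chev_e r i) a b
      = (\<Sum>c\<in>{1..2*r}. mentry (chev_e r i) a c * mentry (chev_e r i) c b)"
    using ab by (intro mentry_mult) auto
  also have "\<dots> = 0" using ab i by (intro sum.neutral ballI) (auto simp: mentry_chev_e step_Suc)
  finally show "mentry (chev_e r i * chev_e r i) a b = mentry (0\<^sub>m (2*r) (2*r)) a b"
    using ab by (auto simp: mentry_def)
qed (auto intro!: mult_carrier_mat[of _ "2*r" "2*r"])

lemma x_sub_eq: assumes "i \<in> {1..r}" shows "x_sub r i t = 1\<^sub>m (2*r) + t \<cdot>\<^sub>m chev_e r i"
proof -
  have c: "t \<cdot>\<^sub>m chev_e r i \<in> carrier_mat (2*r) (2*r)" by simp
  have "(t \<cdot>\<^sub>m chev_e r i) * (t \<cdot>\<^sub>m chev_e r i) = t \<cdot>\<^sub>m (t \<cdot>\<^sub>m (chev_e r i * chev_e r i))"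
    by (metis chev_carrier(1) mult_smult_assoc_mat mult_smult_distrib smult_carrier_mat)
  also have "\<dots> = 0\<^sub>m (2*r) (2*r)" by (simp add: chev_e_square[OF assms])
  finally show ?thesis unfolding x_sub_def using mat_exp_square_zero[OF c] by simp
qed

lemma x_sub_carrier: "x_sub r i t \<in> carrier_mat (2*r) (2*r)"
  and y_sub_carrier: "y_sub r i t \<in> carrier_mat (2*r) (2*r)"
  using chev_carrier[of r i] by (auto simp: x_sub_def y_sub_def mat_exp_def simp del: chev_carrier)

text \<open>With this, facts about upper triangular generators pass to the lower triangular ones by
  transposition, and conversely.\<close>

lemma y_sub_eq: assumes "i \<in> {1..r}" shows "y_sub r i t = transpose_mat (x_sub r i t)"
proof -
  have c: "t \<cdot>\<^sub>m chev_f r i \<in> carrier_mat (2*r) (2*r)" by simp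
  have "chev_f r i * chev_f r i = transpose_mat (chev_e r i * chev_e r i)"
    using assms by (subst transpose_mult[of _ "2*r" "2*r" _ "2*r"]) (auto simp: chev_f_transpose)
  then have sq: "chev_f r i * chev_f r i = 0\<^sub>m (2*r) (2*r)" by (simp add: chev_e_square[OF assms])
  have "(t \<cdot>\<^sub>m chev_f r i) * (t \<cdot>\<^sub>m chev_f r i) = t \<cdot>\<^sub>m (t \<cdot>\<^sub>m (chev_f r i * chev_f r i))"
    by (metis chev_carrier(2) mult_smult_assoc_mat mult_smult_distrib smult_carrier_mat)
  also have "\<dots> = 0\<^sub>m (2*r) (2*r)" by (simp add: sq)
  finally have "y_sub r i t = 1\<^sub>m (2*r) + t \<cdot>\<^sub>m chev_f r i"
    unfolding y_sub_def using mat_exp_square_zero[OF c] by simp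
  then show ?thesis unfolding x_sub_eq[OF assms] chev_f_transpose[OF assms]
    by (intro eq_matI) auto
qed

lemma mentry_x_sub:
  assumes "i \<in> {1..r}" "a \<in> {1..2*r}" "b \<in> {1..2*r}"
  shows "mentry (x_sub r i t) a b = (if a = b then 1 else if b = a + 1 \<and> step r i a then t else 0)"
  using assms by (auto simp: x_sub_eq mentry_add[of _ "2*r"] mentry_smult[of _ "2*r"] mentry_one mentry_chev_e)

lemma mentry_y_sub:
  assumes "i \<in> {1..r}" "a \<in> {1..2*r}" "b \<in> {1..2*r}"
  shows "mentry (y_sub r i t) a b = (if a = b then 1 else if a = b + 1 \<and> step r i b then t else 0)"
  using assms by (auto simp: y_sub_eq mentry_transpose[OF x_sub_carrier] mentry_x_sub)

lemma barred_iff: "a \<in> barred r \<longleftrightarrow> r < a \<and> a \<le> 2 * r"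
proof
  assume "r < a \<and> a \<le> 2 * r"
  then have "a = bar r (2 * r + 1 - a)" "2 * r + 1 - a \<in> {1..r}" by (auto simp: bar_def)
  then show "a \<in> barred r" unfolding barred_def by blast
qed (auto simp: barred_def bar_def)

text \<open>\<open>f_i\<close> leads from \<open>a\<close> to \<open>a + 1\<close>, so the
  \<open>h_i\<close>-weight is 1 at the source of an arrow, -1 at its target and 0
  elsewhere.\<close>

lemma wt_eq:
  assumes "i \<in> {1..r}" "a \<in> {1..2*r}"
  shows "wt r a i = (if step r i a then 1 else if step r i (a - 1) then -1 else 0)"
proof (cases "a \<le> r")
  case True
  then have "wt r a i = (if a = i then 1 else 0) - (if a - 1 = i then 1 else 0)"
    by (simp add: wt_def barred_iff absidx_def fund_weight_def)
  moreover have "step r i a \<longleftrightarrow> a = i" "step r i (a - 1) \<longleftrightarrow> a - 1 = i"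
    using True assms unfolding step_def atLeastAtMost_iff by linarith+
  ultimately show ?thesis using assms by auto
next
  case False
  then have "wt r a i = (if 2 * r - a = i then 1 else 0) - (if 2 * r + 1 - a = i then 1 else 0)"
    using assms by (simp add: wt_def barred_iff absidx_def fund_weight_def bar_def)
  moreover have "step r i a \<longleftrightarrow> 2 * r - a = i" "step r i (a - 1) \<longleftrightarrow> 2 * r + 1 - a = i"
    using False assms unfolding step_def atLeastAtMost_iff by linarith+
  ultimately show ?thesis using assms by auto
qed

lemma coroot_carrier: "coroot r i t \<in> carrier_mat (2*r) (2*r)"
  by (simp add: coroot_def)

lemma mentry_coroot:
  assumes "i \<in> {1..r}" "a \<in> {1..2*r}" "b \<in> {1..2*r}"
  shows "mentry (coroot r i t) a b =
    (if a = b then if step r i a then t else if step r i (a - 1) then inverse t else 1 else 0)"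
  using assms wt_eq[OF assms(1,2)] by (auto simp: mentry_def coroot_def)

lemma x_neg_carrier: "x_neg r i t \<in> carrier_mat (2*r) (2*r)"
  unfolding x_neg_def by (rule mult_carrier_mat[OF y_sub_carrier coroot_carrier])

text \<open>Below the diagonal the entry \<open>t\<close> of \<open>y_sub\<close> meets the factor
  \<open>inverse t\<close> of its column, so the parameter cancels and a plain 1 remains. Only the
  diagonal depends on \<open>t\<close>.\<close>

lemma mentry_x_neg:
  assumes "i \<in> {1..r}" "a \<in> {1..2*r}" "b \<in> {1..2*r}" "t \<noteq> 0"
  shows "mentry (x_neg r i t) a b =
    (if a = b then if step r i b then inverse t else if step r i (b - 1) then t else 1
     else if a = b + 1 \<and> step r i b then 1 else 0)"
proof -
  have "mentry (x_neg r i t) a b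
      = (\<Sum>c\<in>{1..2*r}. mentry (y_sub r i t) a c * mentry (coroot r i (inverse t)) c b)"
    unfolding x_neg_def using assms by (intro mentry_mult y_sub_carrier coroot_carrier)
  also have "\<dots> = (\<Sum>c\<in>{1..2*r}. if c = b then mentry (y_sub r i t) a b * mentry (coroot r i (inverse t)) b b else 0)"
    using assms by (intro sum.cong refl) (auto simp: mentry_coroot)
  also have "\<dots> = mentry (y_sub r i t) a b * mentry (coroot r i (inverse t)) b b"
    using assms by simp
  finally show ?thesis using assms by (simp add: mentry_coroot mentry_y_sub)
qed

section \<open>The matrix of a cycle\<close>

lemma Sp_simps[simp]: "mult (Sp r) = (*)" "one (Sp r) = 1\<^sub>m (2 * r)"
  by (simp_all add: Sp_def)

lemma gprod_Nil[simp]: "gprod G [] = \<one>\<^bsub>G\<^esub>"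
  and gprod_Cons[simp]: "gprod G (x # xs) = x \<otimes>\<^bsub>G\<^esub> gprod G xs"
  by (simp_all add: gprod_def)

lemma gprod_carrier_mat:
  "(\<And>x. x \<in> set xs \<Longrightarrow> x \<in> carrier_mat (2 * r) (2 * r)) \<Longrightarrow> gprod (Sp r) xs \<in> carrier_mat (2 * r) (2 * r)"
  by (induction xs) (auto intro!: mult_carrier_mat[of _ "2*r" "2*r"])

lemma gprod_append:
  assumes "\<And>x. x \<in> set xs \<union> set ys \<Longrightarrow> x \<in> carrier_mat (2 * r) (2 * r)"
  shows "gprod (Sp r) (xs @ ys) = gprod (Sp r) xs * gprod (Sp r) ys"
  using assms
proof (induction xs)
  case Nil
  then have "gprod (Sp r) ys \<in> carrier_mat (2 * r) (2 * r)" by (intro gprod_carrier_mat) auto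
  then show ?case by simp
next
  case (Cons x xs)
  have "gprod (Sp r) xs \<in> carrier_mat (2 * r) (2 * r)" "gprod (Sp r) ys \<in> carrier_mat (2 * r) (2 * r)"
    using Cons.prems by (auto intro!: gprod_carrier_mat)
  then show ?case using Cons by (simp add: assoc_mult_mat[of _ "2*r" "2*r" _ "2*r" _ "2*r"])
qed

definition cyc :: "nat \<Rightarrow> (nat \<Rightarrow> complex) \<Rightarrow> nat \<Rightarrow> complex mat" where
  "cyc r y j = gprod (Sp r) (map (\<lambda>l. x_neg r l (y l)) [1..<Suc j])"

lemma cyc_carrier: "cyc r y j \<in> carrier_mat (2 * r) (2 * r)"
  unfolding cyc_def by (rule gprod_carrier_mat) (auto intro: x_neg_carrier)

lemma cyc_0: "cyc r y 0 = 1\<^sub>m (2 * r)"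
  by (simp add: cyc_def)

lemma cyc_Suc: "cyc r y (Suc j) = cyc r y j * x_neg r (Suc j) (y (Suc j))"
proof -
  have "cyc r y (Suc j) = gprod (Sp r) (map (\<lambda>l. x_neg r l (y l)) [1..<Suc j] @ [x_neg r (Suc j) (y (Suc j))])"
    by (simp add: cyc_def)
  also have "\<dots> = cyc r y j * gprod (Sp r) [x_neg r (Suc j) (y (Suc j))]"
    unfolding cyc_def by (rule gprod_append) (auto intro: x_neg_carrier)
  finally show ?thesis by (simp add: right_mult_one_mat[OF x_neg_carrier])
qed

lemma mentry_mult_x_neg:
  assumes g: "g \<in> carrier_mat (2*r) (2*r)" and i: "i \<in> {1..r}" and ab: "a \<in> {1..2*r}" "b \<in> {1..2*r}"
    and t: "t \<noteq> 0"
  shows "mentry (g * x_neg r i t) a b =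
    mentry g a b * (if step r i b then inverse t else if step r i (b - 1) then t else 1)
    + (if step r i b then mentry g a (b + 1) else 0)"
proof -
  let ?D = "if step r i b then inverse t else if step r i (b - 1) then t else 1"
  have "mentry (g * x_neg r i t) a b = (\<Sum>c\<in>{1..2*r}. mentry g a c * mentry (x_neg r i t) c b)"
    using assms by (intro mentry_mult x_neg_carrier) auto
  also have "\<dots> = (\<Sum>c\<in>{1..2*r}. (if c = b then mentry g a b * ?D else 0)
      + (if c = b + 1 then if step r i b then mentry g a (b + 1) else 0 else 0))"
    using i ab t by (intro sum.cong refl) (auto simp: mentry_x_neg)
  also have "\<dots> = mentry g a b * ?D + (if step r i b then mentry g a (b + 1) else 0)"
    using i ab unfolding sum.distrib by (auto simp: step_def)
  finally show ?thesis .
qed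

text \<open>Column \<open>b\<close> is final once \<open>j \<ge> b\<close>; a column is still a multiple of the unit vector, or already a tail
  of a full column, while the factors that affect it are incomplete.\<close>

definition cyc_entry :: "nat \<Rightarrow> (nat \<Rightarrow> complex) \<Rightarrow> nat \<Rightarrow> nat \<Rightarrow> nat \<Rightarrow> complex" where
  "cyc_entry r y j a b = (let y0 = (\<lambda>l. if l = 0 then 1 else y l) in
     if b \<le> r then
       if b \<le> j then
         if b < r then if a = b then y0 (b - 1) / y b else if a = b + 1 then 1 else 0
         else if a = r then y0 (r - 1) / y r else if r < a then 1 / y0 (2 * r - a) else 0
       else if a = b then if b = j + 1 then y0 j else 1 else 0
     else if 2 * r + 1 - b \<le> j + 1 then
       if b \<le> a then (if 2 * r + 1 - b \<le> j then y (2 * r + 1 - b) else 1) / y0 (2 * r - a) else 0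
     else if a = b then 1 else 0)"

text \<open>A new factor with index \<open>Suc j\<close> touches only the columns at its two arrows:
  \<open>Suc j\<close>, its successor, and their two mirror images. In all other columns both sides
  are unchanged, which explains the cases.\<close>

lemma mentry_cyc:
  assumes "j \<le> r" "a \<in> {1..2*r}" "b \<in> {1..2*r}" "\<And>l. 1 \<le> l \<Longrightarrow> l \<le> j \<Longrightarrow> y l \<noteq> 0"
  shows "mentry (cyc r y j) a b = cyc_entry r y j a b"
  using assms
proof (induction j arbitrary: a b)
  case 0
  then show ?case by (auto simp: cyc_0 mentry_one cyc_entry_def Let_def)
next
  case (Suc j)
  let ?J = "Suc j"
  define y0 where "y0 = (\<lambda>l. if l = 0 then 1 else y l)"
  have IH: "mentry (cyc r y j) a b = cyc_entry r y j a b" if "a \<in> {1..2*r}" "b \<in> {1..2*r}" for a b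
    using Suc that by auto
  have yJ: "y ?J \<noteq> 0" and J: "?J \<in> {1..r}" using Suc.prems by auto
  have rec: "mentry (cyc r y ?J) a b =
      cyc_entry r y j a b * (if step r ?J b then inverse (y ?J) else if step r ?J (b - 1) then y ?J else 1)
    + (if step r ?J b then cyc_entry r y j a (b + 1) else 0)"
  proof -
    have "b + 1 \<in> {1..2*r}" if "step r ?J b" using that J Suc.prems by (auto simp: step_def)
    then show ?thesis unfolding cyc_Suc
      using mentry_mult_x_neg[OF cyc_carrier J Suc.prems(2,3) yJ] IH Suc.prems(2,3) by auto
  qed
  have y0: "y0 (Suc l) = y (Suc l)" "y0 0 = 1" "l \<noteq> 0 \<Longrightarrow> y0 l = y l" for l by (auto simp: y0_def)
  note ce = cyc_entry_def[of r y, folded y0_def, unfolded Let_def]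
  show ?case
  proof (cases "b \<le> r")
    case True
    consider "b < ?J" | "b = ?J" "b < r" | "b = ?J" "b = r" | "b = Suc ?J" | "Suc ?J < b" using True by linarith
    then show ?thesis
    proof cases
      case 1
      then have "\<not> step r ?J b" "\<not> step r ?J (b - 1)" using J True unfolding step_def by auto
      then show ?thesis unfolding rec using 1 True by (simp add: ce)
    next
      case 2
      then have "step r ?J b" by (simp add: step_def)
      then show ?thesis unfolding rec using 2 yJ by (auto simp: ce divide_simps)
    next
      case 3
      then have "step r ?J b" by (simp add: step_def)
      moreover have "cyc_entry r y j a b = (if a = b then y0 j else 0)"
        unfolding ce using 3 by simp
      moreover have "cyc_entry r y j a (b + 1) = (if b < a then 1 / y0 (2 * r - a) else 0)"
        unfolding ce using 3 by (simp add: less_eq_Suc_le)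
      moreover have "cyc_entry r y ?J a b = (if a = b then y0 j / y ?J else if b < a then 1 / y0 (2 * r - a) else 0)"
        unfolding ce using 3 by auto
      ultimately show ?thesis unfolding rec by (simp add: field_simps)
    next
      case 4
      then have "\<not> step r ?J b" "step r ?J (b - 1)" using J True unfolding step_def by auto
      then show ?thesis unfolding rec using 4 True by (auto simp: ce y0)
    next
      case 5
      then have "\<not> step r ?J b" "\<not> step r ?J (b - 1)" using J True unfolding step_def by auto
      then show ?thesis unfolding rec using 5 True by (auto simp: ce)
    qed
  next
    case False
    \<comment> \<open>\<open>k\<close> is the absolute value of the barred index \<open>b\<close>;
      the position of \<open>k\<close> relative to \<open>Suc j\<close> decides which arrow end, if
      any, lies at \<open>b\<close>.\<close>
    define k where "k = 2 * r + 1 - b"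
    have k: "1 \<le> k" "k \<le> r" "b = 2 * r + 1 - k" using False Suc.prems by (auto simp: k_def)
    consider "k < ?J" | "k = ?J" | "k = Suc ?J" | "Suc ?J < k" by linarith
    then show ?thesis
    proof cases
      case 1
      then have "\<not> step r ?J b" "\<not> step r ?J (b - 1)" using J k unfolding step_def by auto
      then show ?thesis unfolding rec using 1 False k by (simp add: ce)
    next
      case 2
      then have "\<not> step r ?J b" "step r ?J (b - 1)" using J k unfolding step_def by auto
      then show ?thesis unfolding rec using 2 False k by (auto simp: ce)
    next
      case 3
      \<comment> \<open>Column \<open>b + 1\<close> is already a tail with numerator 1. Adding it to
        the rescaled unit vector in column \<open>b\<close> prolongs the tail by row
        \<open>b\<close>, because \<open>2 * r - b\<close> is \<open>Suc j\<close>.\<close>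
      then have s: "step r ?J b" "b = 2 * r - ?J" "b + 1 = 2 * r + 1 - ?J" using J k unfolding step_def by auto
      then have "a \<le> 2 * r" "2 * r - b = ?J" using Suc.prems k 3 by auto
      moreover have "cyc_entry r y j a b = (if a = b then 1 else 0)"
        using 3 False k by (simp add: ce)
      moreover have "cyc_entry r y j a (b + 1) = (if b < a then 1 / y0 (2 * r - a) else 0)"
        using 3 False k s by (auto simp: ce)
      moreover have "cyc_entry r y ?J a b = (if b \<le> a then 1 / y0 (2 * r - a) else 0)"
        using 3 False k by (auto simp: ce)
      ultimately show ?thesis unfolding rec using s(1) by (auto simp: y0 divide_simps)
    next
      case 4
      then have "\<not> step r ?J b" "\<not> step r ?J (b - 1)" using J k unfolding step_def by auto
      then show ?thesis unfolding rec using 4 False k by (auto simp: ce)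
    qed
  qed
qed

text \<open>Row before column: the target of the edge comes first, then its source. The zero for
  non-edges lets sums over all vertex sequences replace sums over paths.\<close>

definition edge_entry :: "nat \<Rightarrow> (nat \<Rightarrow> nat \<Rightarrow> complex) \<Rightarrow> nat \<Rightarrow> nat \<Rightarrow> nat \<Rightarrow> complex" where
  "edge_entry r Y c b a = (if b \<in> succs r a then edge_label r Y c a b else 0)"

text \<open>In the encoding by \<open>{1..2*r}\<close> condition (iii) is nothing but the order
  relation from \<open>r\<close> onwards; below \<open>r\<close> only a unit step is
  possible.\<close>

lemma succs_iff:
  assumes "a \<in> {1..2*r}" "b \<in> {1..2*r}"
  shows "b \<in> succs r a \<longleftrightarrow> (if a < r then b = a \<or> b = a + 1 else a \<le> b)"
proof (cases "a \<le> r")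
  case True
  then show ?thesis using assms by (auto simp: succs_def barred_iff)
next
  case False
  then have "absidx r a = 2 * r + 1 - a" using assms by (simp add: absidx_def barred_iff bar_def)
  then have "b \<in> succs r a \<longleftrightarrow> b \<in> bar r ` {1..2 * r + 1 - a}" using False by (simp add: succs_def)
  also have "\<dots> \<longleftrightarrow> a \<le> b"
  proof
    assume "a \<le> b"
    then have "b = bar r (2 * r + 1 - b)" "2 * r + 1 - b \<in> {1..2 * r + 1 - a}"
      using assms by (auto simp: bar_def)
    then show "b \<in> bar r ` {1..2 * r + 1 - a}" by blast
  qed (use assms False in \<open>auto simp: bar_def\<close>)
  finally show ?thesis using False by simp
qed

text \<open>A column agrees with the edge labels once every factor acting on it is present. The
  alternative \<open>b \<le> j\<close> serves the last, incomplete cycle, of which only the first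
  columns are used.\<close>

lemma cyc_entry_eq_edge_entry:
  assumes "j \<le> r" "a \<in> {1..2*r}" "b \<in> {1..2*r}" "b \<le> j \<or> j = r"
    and "\<And>l. 1 \<le> l \<Longrightarrow> l \<le> j \<Longrightarrow> Y c l \<noteq> 0"
  shows "cyc_entry r (Y c) j a b = edge_entry r Y c a b"
proof (cases "b \<le> r")
  case True
  then have "b \<le> j" using assms by auto
  then have "Y c b \<noteq> 0" using assms by auto
  from True consider "b < r" | "b = r" by linarith
  then show ?thesis using assms \<open>b \<le> j\<close> \<open>Y c b \<noteq> 0\<close>
    by cases (auto simp: cyc_entry_def edge_entry_def succs_iff edge_label_def Y0_def barred_iff absidx_def bar_def Let_def)
next
  case False
  then show ?thesis using assms
    by (auto simp: cyc_entry_def edge_entry_def succs_iff edge_label_def Y0_def barred_iff absidx_def bar_def Let_def)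
qed

section \<open>Minors of a cycle\<close>

lemma minor_Nil[simp]: "minor g [] [] = 1"
  by (simp add: minor_def)

lemma minor_Cons_four_block:
  assumes "length A = length B"
  shows "minor g (b # B) (a # A) = det (four_block_mat (mat 1 1 (\<lambda>_. g b a))
    (mat 1 (length B) (\<lambda>(p, q). g b (A ! q))) (mat (length B) 1 (\<lambda>(p, q). g (B ! p) a))
    (mat (length B) (length B) (\<lambda>(p, q). g (B ! p) (A ! q))))"
  unfolding minor_def
  by (rule arg_cong[of _ _ det], rule eq_matI) (auto simp: nth_Cons' split: if_splits)

lemma minor_Cons_row:
  fixes g :: "nat \<Rightarrow> nat \<Rightarrow> 'a::idom"
  assumes "length A = length B" "\<And>x. x \<in> set A \<Longrightarrow> g b x = 0"
  shows "minor g (b # B) (a # A) = g b a * minor g B A"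
proof -
  have "mat 1 (length B) (\<lambda>(p, q). g b (A ! q)) = 0\<^sub>m 1 (length B)"
    using assms by (intro eq_matI) auto
  then show ?thesis unfolding minor_Cons_four_block[OF assms(1)]
    by (subst det_four_block_mat_upper_right_zero[of _ 1 _ "length B"])
      (auto simp: minor_def det_single)
qed

lemma minor_Cons_col:
  fixes g :: "nat \<Rightarrow> nat \<Rightarrow> 'a::idom"
  assumes "length A = length B" "\<And>x. x \<in> set B \<Longrightarrow> g x a = 0"
  shows "minor g (b # B) (a # A) = g b a * minor g B A"
proof -
  have "mat (length B) 1 (\<lambda>(p, q). g (B ! p) a) = 0\<^sub>m (length B) 1"
    using assms by (intro eq_matI) auto
  then show ?thesis unfolding minor_Cons_four_block[OF assms(1)]
    by (subst det_four_block_mat_lower_left_zero[of _ 1 _ "length B"])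
      (auto simp: minor_def det_single)
qed

text \<open>The coefficients of the linear relation, placed in the first two coordinates, form a
  nonzero kernel vector.\<close>

lemma minor_dependent_columns:
  fixes g :: "nat \<Rightarrow> nat \<Rightarrow> 'a::field"
  assumes "length B = Suc (Suc (length A))" "u \<noteq> 0 \<or> v \<noteq> 0"
    and "\<And>y. y \<in> set B \<Longrightarrow> u * g y a + v * g y a' = 0"
  shows "minor g B (a # a' # A) = 0"
proof -
  let ?n = "length B" and ?M = "mat (length B) (length B) (\<lambda>(p, q). g (B ! p) ((a # a' # A) ! q))"
  define w where "w = vec ?n (\<lambda>q. if q = 0 then u else if q = 1 then v else 0)"
  have "?M *\<^sub>v w = 0\<^sub>v ?n"
  proof (rule eq_vecI)
    fix p assume p: "p < dim_vec (0\<^sub>v ?n)"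
    have "(?M *\<^sub>v w) $ p = (\<Sum>q\<in>{0..<?n}. ?M $$ (p, q) * w $ q)"
      using p by (simp add: scalar_prod_def w_def)
    also have "\<dots> = (\<Sum>q\<in>{0, 1}. ?M $$ (p, q) * w $ q)"
      using assms(1) p by (intro sum.mono_neutral_right) (auto simp: w_def)
    also have "\<dots> = u * g (B ! p) a + v * g (B ! p) a'"
      using assms(1) p by (simp add: w_def)
    also have "\<dots> = 0" using assms(3) p by simp
    finally show "(?M *\<^sub>v w) $ p = 0\<^sub>v ?n $ p" using p by simp
  qed (simp add: w_def)
  moreover have "w \<noteq> 0\<^sub>v ?n"
  proof
    assume "w = 0\<^sub>v ?n"
    then have "w $ 0 = 0" "w $ 1 = 0" using assms(1) by simp_all
    then show False using assms(1,2) by (simp add: w_def)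
  qed
  moreover have "w \<in> carrier_vec ?n" by (simp add: w_def)
  ultimately show ?thesis unfolding minor_def
    by (subst det_0_iff_vec_prod_zero_field[of _ ?n]) auto
qed

lemma minor_cong:
  assumes "\<And>x y. x \<in> set B \<Longrightarrow> y \<in> set A \<Longrightarrow> g x y = h x y" "length A = length B"
  shows "minor g B A = minor h B A"
  unfolding minor_def using assms by (intro arg_cong[of _ _ det] eq_matI) auto

text \<open>Condition (v) for one step of a path, by simultaneous recursion on both vertices, so
  that it can be stripped together with the first row and column of a minor.\<close>

fun separated :: "nat \<Rightarrow> nat list \<Rightarrow> nat list \<Rightarrow> bool" where
  "separated r (b # B) (a # a' # A) \<longleftrightarrow> (b \<in> barred r \<longrightarrow> absidx r a' < absidx r b) \<and> separated r B (a' # A)"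
| "separated r _ _ \<longleftrightarrow> True"

lemma separated_iff:
  "length B = length A \<Longrightarrow> separated r B A \<longleftrightarrow>
    (\<forall>z. Suc z < length A \<longrightarrow> B ! z \<in> barred r \<longrightarrow> absidx r (A ! Suc z) < absidx r (B ! z))"
proof (induction r B A rule: separated.induct)
  case (1 r b B a a' A)
  show ?case (is "_ \<longleftrightarrow> (\<forall>z. ?P z)")
  proof -
    have "(\<forall>z. ?P z) \<longleftrightarrow> ?P 0 \<and> (\<forall>z. ?P (Suc z))" by (metis not0_implies_Suc)
    then show ?thesis using 1 by simp
  qed
qed auto

text \<open>Compare the first row index \<open>b\<close> with the second column index
  \<open>a'\<close>. If \<open>b < a'\<close>, the first row is zero past its first entry. If
  \<open>a' \<le> b\<close> and \<open>a < r\<close>, the first column is zero below its first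
  entry. In both situations the first row and column split off. Otherwise all rows lie at or below
  the diagonal of both leading columns, where these are proportional; the minor vanishes, and (v)
  fails at the first entry.\<close>

lemma minor_edge_entry:
  assumes "length B = length A" "sorted_wrt (<) B" "sorted_wrt (<) A" "set B \<subseteq> {1..2*r}" "set A \<subseteq> {1..2*r}"
    and "\<And>a. a \<in> set A \<Longrightarrow> r < a \<Longrightarrow> Y c (2 * r + 1 - a) \<noteq> 0"
  shows "minor (edge_entry r Y c) B A =
    (if separated r B A then \<Prod>z<length A. edge_entry r Y c (B ! z) (A ! z) else 0)"
  using assms
proof (induction A arbitrary: B)
  case Nil
  then show ?case by simp
next
  case (Cons a A)
  let ?g = "edge_entry r Y c"
  obtain b B' where B: "B = b # B'" using Cons.prems(1) by (cases B) auto
  have g0: "?g y x = 0" if "x \<in> {1..2*r}" "y \<in> {1..2*r}" "y < x \<or> x < r \<and> x + 1 < y" for x y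
    using that by (auto simp: edge_entry_def succs_iff split: if_splits)
  have IH: "minor ?g B' A = (if separated r B' A then \<Prod>z<length A. ?g (B' ! z) (A ! z) else 0)"
    using Cons.prems B by (intro Cons.IH) auto
  have len: "length A = length B'" using Cons.prems B by simp
  have prod: "(\<Prod>z<length (a # A). ?g (B ! z) ((a # A) ! z)) = ?g b a * (\<Prod>z<length A. ?g (B' ! z) (A ! z))"
    unfolding B length_Cons prod.lessThan_Suc_shift by simp
  have a: "a \<in> {1..2*r}" and b: "b \<in> {1..2*r}" using Cons.prems B by auto
  show ?case
  proof (cases A)
    case Nil
    then have "B' = []" using len by simp
    then show ?thesis using Nil B minor_Cons_row[of "[]" "[]" ?g b a] by simp
  next
    case (Cons a' A')
    have a': "a' \<in> {1..2*r}" "a < a'" using Cons.prems Cons by auto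
    \<comment> \<open>If the first entries violate (v), the second assumption says that the factor
      split off is zero, so both sides vanish; otherwise the induction hypothesis applies.\<close>
    have strip: ?thesis if "minor ?g (b # B') (a # A) = ?g b a * minor ?g B' A"
      and "?g b a = 0 \<or> (b \<in> barred r \<longrightarrow> absidx r a' < absidx r b)"
      using that IH prod B Cons by (auto simp del: prod.lessThan_Suc)
    show ?thesis
    proof (cases "b < a'")
      case True
      have "?g b x = 0" if "x \<in> set A" for x
        using that Cons Cons.prems True b by (intro g0) auto
      then have "minor ?g (b # B') (a # A) = ?g b a * minor ?g B' A"
        by (intro minor_Cons_row len)
      moreover have "b \<in> barred r \<longrightarrow> absidx r a' < absidx r b"
        using True a' b by (auto simp: absidx_def barred_iff bar_def)
      ultimately show ?thesis using strip by blast
    next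
      case False
      show ?thesis
      proof (cases "a < r")
        case True
        have "?g x a = 0" if "x \<in> set B'" for x
          using that B Cons.prems True False a a' by (intro g0) auto
        then have "minor ?g (b # B') (a # A) = ?g b a * minor ?g B' A"
          by (intro minor_Cons_col len)
        moreover have "?g b a = 0" if "b \<in> barred r"
          using that True a b False a' by (auto simp: edge_entry_def succs_iff barred_iff)
        ultimately show ?thesis using strip by blast
      next
        case ar: False
        have br: "b \<in> barred r" "a' \<in> barred r" using ar a' b False by (auto simp: barred_iff)
        \<comment> \<open>The entry of column \<open>a\<close> in row \<open>y\<close> is
          \<open>?u\<close> divided by the parameter with index \<open>2 * r - y\<close>, and that
          of column \<open>a'\<close> has \<open>?v\<close> in the numerator. At
          \<open>a = r\<close> the barred branch of the label has numerator 1.\<close>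
        let ?u = "if a = r then 1 else Y c (2 * r + 1 - a)" and ?v = "Y c (2 * r + 1 - a')"
        have ge: "b \<le> y" if "y \<in> set B" for y using that B Cons.prems by auto
        have "?v * ?g y a + (- ?u) * ?g y a' = 0" if y: "y \<in> set B" for y
        proof -
          have "y \<in> {1..2*r}" "a' \<le> y" using ge[OF y] False y Cons.prems by auto
          then show ?thesis using ar a a' br
            by (auto simp: edge_entry_def succs_iff edge_label_def barred_iff absidx_def bar_def Y0_def)
        qed
        moreover have "?v \<noteq> 0" using Cons.prems(6)[of a'] Cons br by (auto simp: barred_iff)
        ultimately have "minor ?g B (a # a' # A') = 0"
          using len B Cons by (intro minor_dependent_columns[of _ _ ?v "- ?u"]) auto
        moreover have "\<not> absidx r a' < absidx r b"
          using False br by (auto simp: absidx_def bar_def barred_iff)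
        ultimately show ?thesis using B Cons br by simp
      qed
    qed
  qed
qed

section \<open>Sums over paths\<close>

text \<open>No edge condition is imposed: a step that is not an edge, or violates (v), will have
  weight zero.\<close>

definition walks :: "'v set \<Rightarrow> 'v \<Rightarrow> nat \<Rightarrow> 'v \<Rightarrow> 'v list set" where
  "walks X x0 m x = {p. length p = Suc m \<and> set p \<subseteq> X \<and> p ! 0 = x0 \<and> p ! m = x}"

lemma finite_walks: "finite X \<Longrightarrow> finite (walks X x0 m x)"
  by (rule finite_subset[OF _ finite_lists_length_eq[of X "Suc m"]]) (auto simp: walks_def)

lemma walks_Suc:
  assumes "x \<in> X"
  shows "bij_betw (\<lambda>(y, q). q @ [x]) (SIGMA y:X. walks X x0 m y) (walks X x0 (Suc m) x)"
proof (rule bij_betwI')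
  fix u v assume "u \<in> (SIGMA y:X. walks X x0 m y)" "v \<in> (SIGMA y:X. walks X x0 m y)"
  then show "(case u of (y, q) \<Rightarrow> q @ [x]) = (case v of (y, q) \<Rightarrow> q @ [x]) \<longleftrightarrow> u = v"
    by (cases u; cases v) (simp add: walks_def, metis)
next
  fix u assume "u \<in> (SIGMA y:X. walks X x0 m y)"
  then obtain y q where u: "u = (y, q)" and "q \<in> walks X x0 m y" by blast
  then have "length q = Suc m" "set q \<subseteq> X" "q ! 0 = x0" by (simp_all add: walks_def)
  then show "(case u of (y, q) \<Rightarrow> q @ [x]) \<in> walks X x0 (Suc m) x"
    unfolding u using assms by (simp add: walks_def nth_append)
next
  fix p assume p: "p \<in> walks X x0 (Suc m) x"
  define q where "q = butlast p"
  have len: "length p = Suc (Suc m)" using p by (simp add: walks_def)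
  then have ne: "p \<noteq> []" by auto
  have "last p = x" using p len ne by (simp add: walks_def last_conv_nth)
  then have pq: "p = q @ [x]" unfolding q_def using ne append_butlast_last_id by metis
  have lenq: "length q = Suc m" unfolding q_def using len by simp
  moreover have "set q \<subseteq> X" "q ! 0 = x0"
    using p lenq unfolding pq walks_def by (simp_all add: nth_append)
  moreover have "q ! m \<in> set q" using lenq by simp
  ultimately have "q \<in> walks X x0 m (q ! m)" "q ! m \<in> X"
    by (auto simp: walks_def)
  then show "\<exists>u\<in>SIGMA y:X. walks X x0 m y. p = (case u of (y, q) \<Rightarrow> q @ [x])"
    using pq by (intro bexI[of _ "(q ! m, q)"]) auto
qed

text \<open>The transfer matrix method: unfolding the linear recursion to its initial delta function
  sums the products of weights over all vertex sequences.\<close>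

lemma sum_over_walks:
  fixes w :: "nat \<Rightarrow> 'v \<Rightarrow> 'v \<Rightarrow> 'a::comm_semiring_1"
  assumes X: "finite X" "x0 \<in> X"
    and W0: "\<And>x. x \<in> X \<Longrightarrow> W 0 x = (if x = x0 then 1 else 0)"
    and WS: "\<And>s x. s < m \<Longrightarrow> x \<in> X \<Longrightarrow> W (Suc s) x = (\<Sum>y\<in>X. w s y x * W s y)"
    and x: "x \<in> X"
  shows "W m x = (\<Sum>p\<in>walks X x0 m x. \<Prod>s<m. w s (p ! s) (p ! Suc s))"
  using WS x
proof (induction m arbitrary: x)
  case 0
  have "walks X x0 0 x = (if x = x0 then {[x0]} else {})"
    using X by (auto simp: walks_def length_Suc_conv)
  then show ?case using W0 0 by simp
next
  case (Suc m)
  have "W (Suc m) x = (\<Sum>y\<in>X. \<Sum>q\<in>walks X x0 m y. w m y x * (\<Prod>s<m. w s (q ! s) (q ! Suc s)))"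
    using Suc by (simp add: sum_distrib_left)
  also have "\<dots> = (\<Sum>(y, q)\<in>(SIGMA y:X. walks X x0 m y). w m y x * (\<Prod>s<m. w s (q ! s) (q ! Suc s)))"
    by (rule sum.Sigma[OF X(1)]) (simp add: finite_walks[OF X(1)])
  also have "\<dots> = (\<Sum>(y, q)\<in>(SIGMA y:X. walks X x0 m y). \<Prod>s<Suc m. w s ((q @ [x]) ! s) ((q @ [x]) ! Suc s))"
  proof (intro sum.cong refl, clarify)
    fix y q assume "q \<in> walks X x0 m y"
    then have q: "length q = Suc m" "q ! m = y" by (simp_all add: walks_def)
    then have "(\<Prod>s<m. w s ((q @ [x]) ! s) ((q @ [x]) ! Suc s)) = (\<Prod>s<m. w s (q ! s) (q ! Suc s))"
      by (intro prod.cong) (simp_all add: nth_append)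
    then show "w m y x * (\<Prod>s<m. w s (q ! s) (q ! Suc s))
        = (\<Prod>s<Suc m. w s ((q @ [x]) ! s) ((q @ [x]) ! Suc s))"
      using q by (simp add: nth_append mult.commute)
  qed
  also have "\<dots> = (\<Sum>p\<in>walks X x0 (Suc m) x. \<Prod>s<Suc m. w s (p ! s) (p ! Suc s))"
    by (subst sum.reindex_bij_betw[OF walks_Suc[OF Suc.prems(2)], symmetric])
      (simp add: case_prod_unfold del: prod.lessThan_Suc)
  finally show ?case .
qed

section \<open>Minors of the product of all cycles\<close>

lemma minor_mentry_mult:
  fixes g h :: "'a::comm_ring_1 mat"
  assumes g: "g \<in> carrier_mat n n" "h \<in> carrier_mat n n" and BA: "length B = d" "length A = d"
    "set B \<subseteq> {1..n}" "set A \<subseteq> {1..n}"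
  shows "minor (mentry (g * h)) B A = (\<Sum>K\<in>incl {1..n} d. minor (mentry g) B K * minor (mentry h) K A)"
proof -
  have "minor (mentry (g * h)) B A = minor (\<lambda>a b. \<Sum>c\<in>{1..n}. mentry g a c * mentry h c b) B A"
    using assms by (intro minor_cong mentry_mult[OF g]) auto
  also have "\<dots> = (\<Sum>K\<in>incl {1..n} d. minor (mentry g) B K * minor (mentry h) K A)"
    by (rule Cauchy_Binet) (use BA in auto)
  finally show ?thesis .
qed

text \<open>The product from cycle \<open>j\<close> on. Row indices of the product belong to its
  leftmost cycle, so adding cycles on the left prolongs a path at its end: step \<open>s\<close> of
  a path belongs to cycle \<open>m - s\<close>.\<close>

definition x_L_from :: "nat \<Rightarrow> nat \<Rightarrow> nat \<Rightarrow> (nat \<Rightarrow> nat \<Rightarrow> complex) \<Rightarrow> nat \<Rightarrow> complex mat" where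
  "x_L_from r m d Y j = gprod (Sp r)
     (concat (map (\<lambda>s. map (\<lambda>l. x_neg r l (Y s l)) [1..<Suc r]) [j..<m])
      @ map (\<lambda>l. x_neg r l (Y m l)) [1..<Suc d])"

lemma x_L_from_carrier: "x_L_from r m d Y j \<in> carrier_mat (2*r) (2*r)"
  unfolding x_L_from_def by (rule gprod_carrier_mat) (auto intro: x_neg_carrier)

lemma x_L_from_last: "x_L_from r m d Y m = cyc r (Y m) d"
  by (simp add: x_L_from_def cyc_def)

lemma x_L_from_step:
  assumes "j < m" shows "x_L_from r m d Y j = cyc r (Y j) r * x_L_from r m d Y (Suc j)"
proof -
  have "x_L_from r m d Y j = gprod (Sp r) (map (\<lambda>l. x_neg r l (Y j l)) [1..<Suc r] @
    (concat (map (\<lambda>s. map (\<lambda>l. x_neg r l (Y s l)) [1..<Suc r]) [Suc j..<m])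
      @ map (\<lambda>l. x_neg r l (Y m l)) [1..<Suc d]))"
    unfolding x_L_from_def using assms by (subst upt_conv_Cons) auto
  then show ?thesis unfolding cyc_def x_L_from_def
    by (subst (asm) gprod_append) (auto intro: x_neg_carrier)
qed

lemma minor_cyc:
  assumes "j \<le> r" "\<And>l. 1 \<le> l \<Longrightarrow> l \<le> j \<Longrightarrow> Y c l \<noteq> 0" "length A = length B"
    "set B \<subseteq> {1..2*r}" "set A \<subseteq> {1..2*r}" "set A \<subseteq> {1..j} \<or> j = r"
  shows "minor (mentry (cyc r (Y c) j)) B A = minor (edge_entry r Y c) B A"
proof (rule minor_cong[OF _ assms(3)])
  fix x y assume "x \<in> set B" "y \<in> set A"
  then have xy: "x \<in> {1..2*r}" "y \<in> {1..2*r}" "y \<le> j \<or> j = r" using assms(4-6) by auto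
  show "mentry (cyc r (Y c) j) x y = edge_entry r Y c x y"
    using mentry_cyc[OF assms(1) xy(1,2) assms(2)] cyc_entry_eq_edge_entry[of j r x y Y c, OF assms(1) xy assms(2)]
    by auto
qed

lemma path_start_incl: "d \<le> n \<Longrightarrow> path_start d \<in> incl {1..n} d"
  by (auto simp: path_start_def incl_def simp del: upt_Suc)

text \<open>The intermediate row sets of the Cauchy-Binet expansions are the vertices of the walk,
  which starts at the columns \<open>1, ..., d\<close> of the rightmost cycle.\<close>

lemma minor_x_L:
  assumes d: "1 \<le> d" "d \<le> r" and m: "1 \<le> m"
    and Y: "\<And>s l. 1 \<le> s \<Longrightarrow> s < m \<Longrightarrow> 1 \<le> l \<Longrightarrow> l \<le> r \<Longrightarrow> Y s l \<noteq> 0"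
      "\<And>l. 1 \<le> l \<Longrightarrow> l \<le> d \<Longrightarrow> Y m l \<noteq> 0"
    and B: "B \<in> incl {1..2*r} d"
  shows "minor (mentry (x_L r m d Y)) B (path_start d)
    = (\<Sum>p\<in>walks (incl {1..2*r} d) (path_start d) m B.
        \<Prod>s<m. minor (edge_entry r Y (m - s)) (p ! Suc s) (p ! s))"
proof -
  let ?X = "incl {1..2*r} d" and ?st = "path_start d"
  \<comment> \<open>\<open>s\<close> counts the cycles already multiplied, the leftmost of them
    being \<open>m + 1 - s\<close>. For \<open>s = 0\<close> the product is empty and the minor is a
    delta function.\<close>
  define W where "W s B = (if s = 0 then if B = ?st then 1 else 0
     else minor (mentry (x_L_from r m d Y (m + 1 - s))) B ?st)" for s B
  have st: "?st \<in> ?X" using d by (intro path_start_incl) auto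
  have finX: "finite ?X" by (intro finite_incl) auto
  have X: "length K = d" "set K \<subseteq> {1..2*r}" if "K \<in> ?X" for K using that by (auto simp: incl_def)
  have "W m B = (\<Sum>p\<in>walks ?X ?st m B. \<Prod>s<m. minor (edge_entry r Y (m - s)) (p ! Suc s) (p ! s))"
  proof (rule sum_over_walks[OF finX st _ _ B, where w = "\<lambda>s A B. minor (edge_entry r Y (m - s)) B A"])
    fix s K assume s: "s < m" and K: "K \<in> ?X"
    show "W (Suc s) K = (\<Sum>A\<in>?X. minor (edge_entry r Y (m - s)) K A * W s A)"
    proof (cases "s = 0")
      case True
      \<comment> \<open>Cycle \<open>m\<close> has only \<open>d\<close> factors, but these already
        complete the columns \<open>1, ..., d\<close> of the starting vertex.\<close>
      have "minor (mentry (cyc r (Y m) d)) K ?st = minor (edge_entry r Y m) K ?st"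
        using d Y X[OF K] X[OF st] by (intro minor_cyc) (auto simp: path_start_def)
      then have "W (Suc s) K = minor (edge_entry r Y m) K ?st"
        using True by (simp add: W_def x_L_from_last)
      also have "\<dots> = (\<Sum>A\<in>?X. if A = ?st then minor (edge_entry r Y m) K ?st else 0)"
        using finX st by simp
      finally show ?thesis using True by (auto simp: W_def intro!: sum.cong)
    next
      case False
      then have "x_L_from r m d Y (m + 1 - Suc s) = cyc r (Y (m - s)) r * x_L_from r m d Y (m + 1 - s)"
        using s x_L_from_step[of "m - s" m r d Y] by (simp add: Suc_diff_le)
      then have "W (Suc s) K = (\<Sum>A\<in>?X. minor (mentry (cyc r (Y (m - s)) r)) K A * minor (mentry (x_L_from r m d Y (m + 1 - s))) A ?st)"
        unfolding W_def using X[OF K] X[OF st] by (simp add: minor_mentry_mult[OF cyc_carrier x_L_from_carrier])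
      also have "\<dots> = (\<Sum>A\<in>?X. minor (edge_entry r Y (m - s)) K A * W s A)"
      proof (intro sum.cong refl)
        fix A assume A: "A \<in> ?X"
        have "minor (mentry (cyc r (Y (m - s)) r)) K A = minor (edge_entry r Y (m - s)) K A"
          using False s Y X[OF K] X[OF A] by (intro minor_cyc) auto
        then show "minor (mentry (cyc r (Y (m - s)) r)) K A * minor (mentry (x_L_from r m d Y (m + 1 - s))) A ?st
            = minor (edge_entry r Y (m - s)) K A * W s A" using False by (simp add: W_def)
      qed
      finally show ?thesis .
    qed
  qed (simp add: W_def)
  moreover have "x_L_from r m d Y 1 = x_L r m d Y" by (simp add: x_L_from_def x_L_def)
  ultimately show ?thesis using m by (simp add: W_def)
qed

lemma sorted_wrt_less_nth_Suc:
  "sorted_wrt (<) (xs :: nat list) \<longleftrightarrow> (\<forall>z\<in>{1..<length xs}. xs ! (z - 1) < xs ! z)"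
proof -
  have "sorted_wrt (<) xs \<longleftrightarrow> (\<forall>i. Suc i < length xs \<longrightarrow> xs ! i < xs ! Suc i)"
    by (rule sorted_wrt_iff_nth_Suc_transp) simp
  also have "\<dots> \<longleftrightarrow> (\<forall>z\<in>{1..<length xs}. xs ! (z - 1) < xs ! z)"
    by (metis One_nat_def Suc_diff_1 Suc_le_eq atLeastLessThan_iff diff_Suc_1 le_add1 plus_1_eq_Suc)
  finally show ?thesis .
qed

text \<open>Conditions (i), (ii) and (iv) are membership in \<open>walks\<close>; (iii) and (v) are
  the two conditions on each step.\<close>

lemma paths_eq:
  assumes d: "1 \<le> d" "d \<le> r"
  shows "paths r d m m' = {p \<in> walks (incl {1..2*r} d) (path_start d) m (path_end r d m').
    \<forall>s<m. separated r (p ! Suc s) (p ! s) \<and> (\<forall>z<d. p ! Suc s ! z \<in> succs r (p ! s ! z))}"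
    (is "_ = {p \<in> ?C. ?R p}")
proof -
  have range: "(\<forall>\<zeta>\<in>{1..d}. Q (\<zeta> - 1)) \<longleftrightarrow> (\<forall>z<d. Q z)" (is "?l \<longleftrightarrow> ?r") for Q :: "nat \<Rightarrow> bool"
  proof
    assume L: ?l
    show ?r
    proof (intro allI impI)
      fix z assume "z < d"
      then show "Q z" using bspec[OF L, of "Suc z"] by simp
    qed
  qed auto
  have range': "(\<forall>\<zeta>\<in>{1..<d}. Q (\<zeta> - 1) \<zeta>) \<longleftrightarrow> (\<forall>z. Suc z < d \<longrightarrow> Q z (Suc z))" (is "?l \<longleftrightarrow> ?r")
    for Q :: "nat \<Rightarrow> nat \<Rightarrow> bool"
  proof
    assume L: ?l
    show ?r
    proof (intro allI impI)
      fix z assume "Suc z < d"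
      then show "Q z (Suc z)" using bspec[OF L, of "Suc z"] by simp
    qed
  next
    assume ?r
    then show ?l by (metis One_nat_def Suc_pred atLeastLessThan_iff less_eq_Suc_le)
  qed
  have lenset: "set p \<subseteq> incl {1..2*r} d \<longleftrightarrow> (\<forall>s\<le>m. p ! s \<in> incl {1..2*r} d)"
    if "length p = Suc m" for p
    using that by (auto simp: set_conv_nth less_Suc_eq_le)
  have mem: "K \<in> incl {1..2*r} d \<longleftrightarrow> length K = d \<and> (\<forall>z<d. K ! z \<in> J r) \<and> (\<forall>\<zeta>\<in>{1..<d}. K ! (\<zeta> - 1) < K ! \<zeta>)"
    for K
    unfolding incl_def J_def mem_Collect_eq sorted_wrt_less_nth_Suc
    by (auto simp: set_conv_nth)
  show ?thesis
  proof (rule Set.set_eqI)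
    fix p
    show "p \<in> paths r d m m' \<longleftrightarrow> p \<in> {p \<in> ?C. ?R p}"
    proof (cases "length p = Suc m \<and> (\<forall>s\<le>m. length (p ! s) = d)")
      case True
      then have len: "length p = Suc m" "\<And>s. s \<le> m \<Longrightarrow> length (p ! s) = d" by auto
      have "p \<in> paths r d m m' \<longleftrightarrow> (\<forall>s\<le>m. p ! s \<in> incl {1..2*r} d) \<and>
        p ! 0 = path_start d \<and> p ! m = path_end r d m' \<and> ?R p"
      proof -
        have "separated r (p ! Suc s) (p ! s) \<longleftrightarrow> (\<forall>\<zeta>\<in>{1..<d}. p ! Suc s ! (\<zeta> - 1) \<in> barred r \<longrightarrow>
            absidx r (p ! s ! \<zeta>) < absidx r (p ! Suc s ! (\<zeta> - 1)))" if "s < m" for s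
        proof -
          have "length (p ! Suc s) = length (p ! s)" "length (p ! s) = d" using that len by auto
          then show ?thesis
            by (simp only: separated_iff range'[of "\<lambda>z z'. p ! Suc s ! z \<in> barred r \<longrightarrow>
              absidx r (p ! s ! z') < absidx r (p ! Suc s ! z)"])
        qed
        then have sep: "(\<forall>s<m. separated r (p ! Suc s) (p ! s)) \<longleftrightarrow> (\<forall>s<m. \<forall>\<zeta>\<in>{1..<d}.
            ent p (s + 1) \<zeta> \<in> barred r \<longrightarrow> absidx r (ent p (s + 1) \<zeta>) > absidx r (ent p s (\<zeta> + 1)))"
          unfolding ent_def Suc_eq_plus1 add_diff_cancel_right' by blast
        have suc: "(\<forall>s<m. \<forall>z<d. p ! Suc s ! z \<in> succs r (p ! s ! z)) \<longleftrightarrow>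
            (\<forall>s<m. \<forall>\<zeta>\<in>{1..d}. ent p (s + 1) \<zeta> \<in> succs r (ent p s \<zeta>))"
          unfolding ent_def Suc_eq_plus1 range[symmetric] ..
        have inc: "(\<forall>s\<le>m. p ! s \<in> incl {1..2*r} d) \<longleftrightarrow> (\<forall>s\<le>m. \<forall>\<zeta>\<in>{1..d}. ent p s \<zeta> \<in> J r) \<and>
            (\<forall>s\<le>m. \<forall>\<zeta>\<in>{1..<d}. ent p s \<zeta> < ent p s (\<zeta> + 1))"
          unfolding mem ent_def range[symmetric] using len(2) by auto
        have split: "?R p \<longleftrightarrow> (\<forall>s<m. separated r (p ! Suc s) (p ! s)) \<and> (\<forall>s<m. \<forall>z<d. p ! Suc s ! z \<in> succs r (p ! s ! z))"
          by blast
        have len': "length p = m + 1" "\<forall>s\<le>m. length (p ! s) = d" using len by simp_all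
        show ?thesis unfolding paths_def mem_Collect_eq split inc suc sep using len' by argo
      qed
      then show ?thesis using len lenset[OF len(1)] by (auto simp: walks_def)
    next
      case False
      moreover have "length p = Suc m \<and> (\<forall>s\<le>m. length (p ! s) = d)" if "p \<in> ?C"
        using that lenset[of p] by (auto simp: walks_def incl_def)
      moreover have "length p = Suc m \<and> (\<forall>s\<le>m. length (p ! s) = d)" if "p \<in> paths r d m m'"
        using that unfolding paths_def mem_Collect_eq by simp
      ultimately show ?thesis by blast
    qed
  qed
qed

text \<open>A walk violating (iii) or (v) at some step has a zero factor there, so the sum over all
  walks collapses to the paths.\<close>

lemma minor_x_L_paths:
  assumes d: "1 \<le> d" "d \<le> r" and m: "1 \<le> m"
    and Y: "\<And>s l. 1 \<le> s \<Longrightarrow> s < m \<Longrightarrow> 1 \<le> l \<Longrightarrow> l \<le> r \<Longrightarrow> Y s l \<noteq> 0"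
      "\<And>l. 1 \<le> l \<Longrightarrow> l \<le> d \<Longrightarrow> Y m l \<noteq> 0"
    and B: "path_end r d m' \<in> incl {1..2*r} d"
  shows "minor (mentry (x_L r m d Y)) (path_end r d m') (path_start d)
    = (\<Sum>p\<in>paths r d m m'. path_label r d m Y p)"
proof -
  let ?C = "walks (incl {1..2*r} d) (path_start d) m (path_end r d m')"
  let ?w = "\<lambda>p s. minor (edge_entry r Y (m - s)) (p ! Suc s) (p ! s)"
  have w: "?w p s = (if separated r (p ! Suc s) (p ! s) then
      \<Prod>z<d. edge_entry r Y (m - s) (p ! Suc s ! z) (p ! s ! z) else 0)"
    if p: "p \<in> ?C" and s: "s < m" for p s
  proof -
    have in_incl: "p ! s \<in> incl {1..2*r} d" "p ! Suc s \<in> incl {1..2*r} d"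
      using p s by (auto simp: walks_def)
    \<comment> \<open>For \<open>s = 0\<close> the vertex is \<open>1, ..., d\<close> with
      \<open>d \<le> r\<close>, so no entry exceeds \<open>r\<close> and the parameters absent from
      the incomplete cycle are never asked for.\<close>
    have "Y (m - s) (2 * r + 1 - a) \<noteq> 0" if a: "a \<in> set (p ! s)" "r < a" for a
    proof (cases "s = 0")
      case True
      then show ?thesis using a p d by (auto simp: walks_def path_start_def)
    next
      case False
      have "a \<le> 2 * r" using a in_incl by (auto simp: incl_def)
      then show ?thesis using a False s by (intro Y(1)) auto
    qed
    then show ?thesis using in_incl
      by (subst minor_edge_entry) (auto simp: incl_def)
  qed
  have "(\<Sum>p\<in>paths r d m m'. path_label r d m Y p) = (\<Sum>p\<in>?C. \<Prod>s<m. ?w p s)"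
  proof (rule sum.mono_neutral_cong_left)
    show "finite ?C" by (intro finite_walks finite_incl) simp
    show "paths r d m m' \<subseteq> ?C" unfolding paths_eq[OF d] by blast
    show "\<forall>p\<in>?C - paths r d m m'. (\<Prod>s<m. ?w p s) = 0"
    proof
      fix p assume p: "p \<in> ?C - paths r d m m'"
      then obtain s where s: "s < m"
        "\<not> separated r (p ! Suc s) (p ! s) \<or> (\<exists>z<d. p ! Suc s ! z \<notin> succs r (p ! s ! z))"
        unfolding paths_eq[OF d] by blast
      then have "?w p s = 0" using w[of p s] p by (auto simp: edge_entry_def)
      then show "(\<Prod>s<m. ?w p s) = 0" using s(1) by (meson finite_lessThan lessThan_iff prod_zero)
    qed
    fix p assume p: "p \<in> paths r d m m'"
    show "path_label r d m Y p = (\<Prod>s<m. ?w p s)"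
      unfolding path_label_def
    proof (intro prod.cong refl)
      fix s assume "s \<in> {..<m}"
      then have s: "s < m" by simp
      have "?w p s = (\<Prod>z<d. edge_label r Y (m - s) (p ! s ! z) (p ! Suc s ! z))"
        using w[of p s] p s unfolding paths_eq[OF d] by (auto simp: edge_entry_def)
      also have "\<dots> = (\<Prod>\<zeta> = 1..d. edge_label r Y (m - s) (ent p s \<zeta>) (ent p (s + 1) \<zeta>))"
        by (rule prod.reindex_bij_witness[of _ "\<lambda>z. z - 1" Suc]) (auto simp: ent_def)
      finally show "(\<Prod>\<zeta> = 1..d. edge_label r Y (m - s) (ent p s \<zeta>) (ent p (s + 1) \<zeta>)) = ?w p s" by simp
    qed
  qed
  moreover have "minor (mentry (x_L r m d Y)) (path_end r d m') (path_start d) = (\<Sum>p\<in>?C. \<Prod>s<m. ?w p s)"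
    by (rule minor_x_L[OF d m _ _ B]) (use Y in auto)
  ultimately show ?thesis by simp
qed

section \<open>The symplectic group\<close>

lemma sp_form_carrier: "sp_form r \<in> carrier_mat (2 * r) (2 * r)"
  by (simp add: sp_form_def)

text \<open>Mirror indices have opposite parity, so both sign rules of the form merge into one power
  of -1.\<close>

lemma mentry_sp_form:
  assumes "a \<in> {1..2*r}" "b \<in> {1..2*r}"
  shows "mentry (sp_form r) a b = (if a + b = 2 * r + 1 then (-1) ^ (a + 1) else 0)"
proof -
  have par: "- ((-1) ^ (b - 1)) = ((-1) ^ (a + 1) :: complex)" if "a + b = 2 * r + 1"
  proof -
    have "even (b - 1) \<longleftrightarrow> odd (a + 1)" using that assms unfolding atLeastAtMost_iff by presburger
    then show ?thesis by (cases "even (b - 1)") (simp_all add: uminus_power_if)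
  qed
  obtain a0 where a0: "a = Suc a0" using assms(1) by (cases a) auto
  obtain b0 where b0: "b = Suc b0" using assms(2) by (cases b) auto
  show ?thesis using par assms unfolding a0 b0 mentry_def sp_form_def bar_def by auto
qed

definition sp_pair :: "nat \<Rightarrow> (nat \<Rightarrow> complex) \<Rightarrow> (nat \<Rightarrow> complex) \<Rightarrow> complex" where
  "sp_pair r u v = (\<Sum>c\<in>{1..2*r}. (-1) ^ (c + 1) * u c * v (2 * r + 1 - c))"

lemma mentry_form_mult:
  assumes "g \<in> carrier_mat (2*r) (2*r)" "a \<in> {1..2*r}" "b \<in> {1..2*r}"
  shows "mentry (sp_form r * g) a b = (-1) ^ (a + 1) * mentry g (2 * r + 1 - a) b"
    and "mentry (g * sp_form r) a b = - ((-1) ^ (b + 1)) * mentry g a (2 * r + 1 - b)"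
proof -
  have "mentry (sp_form r * g) a b = (\<Sum>c\<in>{1..2*r}. mentry (sp_form r) a c * mentry g c b)"
    using assms by (intro mentry_mult sp_form_carrier)
  also have "\<dots> = (\<Sum>c\<in>{1..2*r}. if c = 2 * r + 1 - a then (-1) ^ (a + 1) * mentry g c b else 0)"
    using assms by (intro sum.cong refl) (auto simp: mentry_sp_form)
  finally show "mentry (sp_form r * g) a b = (-1) ^ (a + 1) * mentry g (2 * r + 1 - a) b"
    using assms by auto
  have "(-1) ^ (2 * r + 1 - b + 1) = (- ((-1) ^ (b + 1)) :: complex)"
  proof -
    have "even (2 * r + 1 - b + 1) \<longleftrightarrow> odd (b + 1)" using assms(3) by auto
    then show ?thesis by (cases "even (b + 1)") (simp_all add: uminus_power_if)
  qed
  then have s: "mentry g a c * mentry (sp_form r) c b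
      = (if c = 2 * r + 1 - b then - ((-1) ^ (b + 1)) * mentry g a c else 0)" if "c \<in> {1..2*r}" for c
    using assms that mentry_sp_form[OF that assms(3)] by auto
  have "mentry (g * sp_form r) a b = (\<Sum>c\<in>{1..2*r}. mentry g a c * mentry (sp_form r) c b)"
    using assms by (intro mentry_mult sp_form_carrier)
  also have "\<dots> = (\<Sum>c\<in>{1..2*r}. if c = 2 * r + 1 - b then - ((-1) ^ (b + 1)) * mentry g a c else 0)"
    by (intro sum.cong refl s)
  finally show "mentry (g * sp_form r) a b = - ((-1) ^ (b + 1)) * mentry g a (2 * r + 1 - b)"
    using assms by auto
qed

lemma mentry_congruence:
  assumes "g \<in> carrier_mat (2*r) (2*r)" "a \<in> {1..2*r}" "b \<in> {1..2*r}"
  shows "mentry (transpose_mat g * sp_form r * g) a b = sp_pair r (\<lambda>c. mentry g c a) (\<lambda>c. mentry g c b)"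
proof -
  have "transpose_mat g * sp_form r * g = transpose_mat g * (sp_form r * g)"
    using assms sp_form_carrier by (intro assoc_mult_mat) auto
  then have "mentry (transpose_mat g * sp_form r * g) a b
      = (\<Sum>c\<in>{1..2*r}. mentry (transpose_mat g) a c * mentry (sp_form r * g) c b)"
    using assms sp_form_carrier[of r] by (simp add: mentry_mult[of _ "2*r"] mult_carrier_mat[of _ "2*r" "2*r"])
  also have "\<dots> = sp_pair r (\<lambda>c. mentry g c a) (\<lambda>c. mentry g c b)"
    unfolding sp_pair_def using assms
    by (intro sum.cong refl) (simp add: mentry_transpose mentry_form_mult(1))
  finally show ?thesis .
qed

lemma Sp_iff:
  "g \<in> carrier (Sp r) \<longleftrightarrow> g \<in> carrier_mat (2*r) (2*r) \<and> (\<forall>a\<in>{1..2*r}. \<forall>b\<in>{1..2*r}.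
     sp_pair r (\<lambda>c. mentry g c a) (\<lambda>c. mentry g c b) = (if a + b = 2 * r + 1 then (-1) ^ (a + 1) else 0))"
    (is "_ \<longleftrightarrow> _ \<and> ?R")
proof -
  have "transpose_mat g * sp_form r * g = sp_form r \<longleftrightarrow> ?R" if g: "g \<in> carrier_mat (2*r) (2*r)"
  proof
    assume "transpose_mat g * sp_form r * g = sp_form r"
    then show ?R using mentry_congruence[OF g] mentry_sp_form by auto
  next
    assume ?R
    then show "transpose_mat g * sp_form r * g = sp_form r"
      using g sp_form_carrier
      by (intro mat_eqI_mentry[of _ "2*r"]) (auto simp: mentry_congruence[OF g] mentry_sp_form)
  qed
  then show ?thesis by (auto simp: Sp_def)
qed

lemma Sp_carrier_mat: "g \<in> carrier (Sp r) \<Longrightarrow> g \<in> carrier_mat (2*r) (2*r)"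
  by (simp add: Sp_def)

lemma Sp_pair: "g \<in> carrier (Sp r) \<Longrightarrow> a \<in> {1..2*r} \<Longrightarrow> b \<in> {1..2*r} \<Longrightarrow>
   sp_pair r (\<lambda>c. mentry g c a) (\<lambda>c. mentry g c b) = (if a + b = 2 * r + 1 then (-1) ^ (a + 1) else 0)"
  by (simp add: Sp_iff)

lemma sp_form_square: "sp_form r * sp_form r = - 1\<^sub>m (2*r)"
proof (rule mat_eqI_mentry[of _ "2*r"])
  fix a b assume ab: "a \<in> {1..2*r}" "b \<in> {1..2*r}"
  have "(-1) ^ (2 * r + 1 - a + 1) = (- ((-1) ^ (a + 1)) :: complex)"
  proof -
    have "even (2 * r + 1 - a + 1) \<longleftrightarrow> odd (a + 1)" using ab by auto
    then show ?thesis by (cases "even (a + 1)") (simp_all add: uminus_power_if)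
  qed
  moreover have "2 * r + 1 - a + b = 2 * r + 1 \<longleftrightarrow> a = b" "2 * r + 1 - a \<in> {1..2*r}" using ab by auto
  ultimately have "mentry (sp_form r * sp_form r) a b = (-1) ^ (a + 1) * (if a = b then - ((-1) ^ (a + 1)) else 0)"
    using ab by (simp only: mentry_form_mult(1)[OF sp_form_carrier] mentry_sp_form)
  also have "\<dots> = (if a = b then -1 else 0)" by (simp add: power_mult_distrib[symmetric])
  also have "\<dots> = mentry (- 1\<^sub>m (2*r)) a b" using ab by (auto simp: mentry_def)
  finally show "mentry (sp_form r * sp_form r) a b = mentry (- 1\<^sub>m (2*r)) a b" .
qed (use sp_form_carrier in \<open>auto intro!: mult_carrier_mat[of _ "2*r" "2*r"]\<close>)

text \<open>Solves \<open>transpose_mat g * sp_form r * g = sp_form r\<close> for the inverse, using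
  that \<open>sp_form r\<close> squares to -1. Up to signs the entries are reflected in the
  antidiagonal, which preserves triangular shapes.\<close>

definition sp_inv :: "nat \<Rightarrow> complex mat \<Rightarrow> complex mat" where
  "sp_inv r g = - (sp_form r * transpose_mat g * sp_form r)"

lemma sp_inv_carrier: "g \<in> carrier_mat (2*r) (2*r) \<Longrightarrow> sp_inv r g \<in> carrier_mat (2*r) (2*r)"
  using sp_form_carrier[of r] by (auto simp: sp_inv_def intro!: mult_carrier_mat[of _ "2*r" "2*r"])

lemma mentry_sp_inv:
  assumes g: "g \<in> carrier_mat (2*r) (2*r)" and ab: "a \<in> {1..2*r}" "b \<in> {1..2*r}"
  shows "mentry (sp_inv r g) a b = (-1) ^ (a + b) * mentry g (2 * r + 1 - b) (2 * r + 1 - a)"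
proof -
  have c: "sp_form r * transpose_mat g \<in> carrier_mat (2*r) (2*r)"
    using g sp_form_carrier[of r] by (auto intro!: mult_carrier_mat[of _ "2*r" "2*r"])
  have neg: "mentry (- h) a b = - mentry h a b" if "h \<in> carrier_mat (2*r) (2*r)" for h :: "complex mat"
    using that ab by (auto simp: mentry_def)
  have "mentry (sp_inv r g) a b = (-1) ^ (b + 1) * mentry (sp_form r * transpose_mat g) a (2 * r + 1 - b)"
    unfolding sp_inv_def
    using neg[OF mult_carrier_mat[OF c sp_form_carrier]] mentry_form_mult(2)[OF c ab] by simp
  also have "\<dots> = (-1) ^ (b + 1) * ((-1) ^ (a + 1) * mentry (transpose_mat g) (2 * r + 1 - a) (2 * r + 1 - b))"
    using ab g by (subst mentry_form_mult(1)) auto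
  also have "\<dots> = (-1) ^ (a + b) * mentry g (2 * r + 1 - b) (2 * r + 1 - a)"
    using ab g by (subst mentry_transpose[OF g]) (auto simp: power_add)
  finally show ?thesis .
qed

lemma sp_inv_left: assumes "g \<in> carrier (Sp r)" shows "sp_inv r g * g = 1\<^sub>m (2*r)"
proof -
  note g = Sp_carrier_mat[OF assms]
  have eq: "transpose_mat g * sp_form r * g = sp_form r" using assms by (simp add: Sp_def)
  have "sp_inv r g * g = - (sp_form r * (transpose_mat g * sp_form r * g))"
    unfolding sp_inv_def using g sp_form_carrier[of r]
    by (simp add: square_mult)
  then show ?thesis unfolding eq sp_form_square by simp
qed

lemma sp_inv_right: assumes "g \<in> carrier (Sp r)" shows "g * sp_inv r g = 1\<^sub>m (2*r)"
  using mat_mult_left_right_inverse[OF sp_inv_carrier Sp_carrier_mat sp_inv_left] assms Sp_carrier_mat by blast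

lemma Sp_mult_closed:
  assumes "g \<in> carrier (Sp r)" "h \<in> carrier (Sp r)" shows "g * h \<in> carrier (Sp r)"
proof -
  note c = Sp_carrier_mat[OF assms(1)] Sp_carrier_mat[OF assms(2)]
  have "transpose_mat (g * h) * sp_form r * (g * h) = transpose_mat h * (transpose_mat g * sp_form r * g) * h"
    using c sp_form_carrier[of r]
    by (simp add: transpose_mult[of _ "2*r" "2*r" _ "2*r"] square_mult)
  then show ?thesis using assms c by (simp add: Sp_def)
qed

lemma one_Sp: "1\<^sub>m (2*r) \<in> carrier (Sp r)"
  using sp_form_carrier[of r] by (simp add: Sp_def)

lemma sp_inv_Sp: assumes "g \<in> carrier (Sp r)" shows "sp_inv r g \<in> carrier (Sp r)"
proof -
  let ?h = "sp_inv r g"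
  note g = Sp_carrier_mat[OF assms]
  note c = g sp_inv_carrier[OF g] sp_form_carrier[of r]
  have eq: "transpose_mat g * sp_form r * g = sp_form r" using assms by (simp add: Sp_def)
  have "transpose_mat ?h * sp_form r * ?h = transpose_mat ?h * (transpose_mat g * sp_form r * g) * ?h"
    by (simp add: eq)
  also have "\<dots> = (transpose_mat ?h * transpose_mat g) * sp_form r * (g * ?h)"
    using c by (simp add: square_mult)
  also have "transpose_mat ?h * transpose_mat g = 1\<^sub>m (2*r)"
    using c sp_inv_right[OF assms] by (metis transpose_mult transpose_one)
  finally show ?thesis using c sp_inv_right[OF assms] by (simp add: Sp_def)
qed

lemma group_Sp: "group (Sp r)"
proof (rule groupI)
  fix x y z assume "x \<in> carrier (Sp r)" "y \<in> carrier (Sp r)" "z \<in> carrier (Sp r)"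
  then show "x \<otimes>\<^bsub>Sp r\<^esub> y \<otimes>\<^bsub>Sp r\<^esub> z = x \<otimes>\<^bsub>Sp r\<^esub> (y \<otimes>\<^bsub>Sp r\<^esub> z)"
    by (auto intro!: assoc_mult_mat[of _ "2*r" "2*r" _ "2*r" _ "2*r"] Sp_carrier_mat)
next
  fix x assume "x \<in> carrier (Sp r)"
  then show "\<exists>y\<in>carrier (Sp r). y \<otimes>\<^bsub>Sp r\<^esub> x = \<one>\<^bsub>Sp r\<^esub>"
    by (intro bexI[of _ "sp_inv r x"]) (simp_all add: sp_inv_left sp_inv_Sp)
qed (auto intro: Sp_mult_closed one_Sp dest: Sp_carrier_mat)

lemma inv_Sp: "g \<in> carrier (Sp r) \<Longrightarrow> inv\<^bsub>Sp r\<^esub> g = sp_inv r g"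
  by (rule group.inv_equality[OF group_Sp]) (simp_all add: sp_inv_left sp_inv_Sp)

text \<open>Rewrites the relation \<open>g * sp_inv r g = 1\<close> as invariance of the form under
  the transpose, cancelling one form by multiplying with its square.\<close>

lemma transpose_Sp: assumes "g \<in> carrier (Sp r)" shows "transpose_mat g \<in> carrier (Sp r)"
proof -
  note g = Sp_carrier_mat[OF assms]
  note c = g sp_form_carrier[of r]
  have "g * sp_form r * transpose_mat g * (sp_form r * sp_form r) = - (g * sp_inv r g) * sp_form r"
    unfolding sp_inv_def using c
    by (simp add: square_mult)
  then have "- (g * sp_form r * transpose_mat g) = - sp_form r"
    unfolding sp_inv_right[OF assms] sp_form_square using c by (simp add: mult_carrier_mat[of _ "2*r" "2*r"])
  then have "g * sp_form r * transpose_mat g = sp_form r"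
    by (metis uminus_uminus_mat)
  then show ?thesis using g by (simp add: Sp_def)
qed

text \<open>Infinitesimal invariance cancels the terms linear in \<open>t\<close>; it also turns the
  quadratic term into a multiple of \<open>X * X\<close>, which is zero.\<close>

lemma one_plus_nilpotent_Sp:
  assumes X: "X \<in> carrier_mat (2*r) (2*r)" and sq: "X * X = 0\<^sub>m (2*r) (2*r)"
    and inf: "transpose_mat X * sp_form r = - (sp_form r * X)"
  shows "1\<^sub>m (2*r) + t \<cdot>\<^sub>m X \<in> carrier (Sp r)"
proof -
  define J where "J = sp_form r"
  have c: "J \<in> carrier_mat (2*r) (2*r)" "J * X \<in> carrier_mat (2*r) (2*r)"
      "transpose_mat X \<in> carrier_mat (2*r) (2*r)"
    using X sp_form_carrier unfolding J_def by (auto intro!: mult_carrier_mat[of _ "2*r" "2*r"])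
  let ?u = "1\<^sub>m (2*r) + t \<cdot>\<^sub>m X"
  have u: "?u \<in> carrier_mat (2*r) (2*r)" using X by simp
  have Ju: "J * ?u = J + t \<cdot>\<^sub>m (J * X)"
    using X c by (simp add: mult_add_distrib_mat[of _ "2*r" "2*r" _ "2*r"] mult_smult_distrib[of _ "2*r" "2*r" _ "2*r"])
  have "transpose_mat X * (J * X) = transpose_mat X * J * X"
    using X c by (simp add: assoc_mult_mat[of _ "2*r" "2*r" _ "2*r" _ "2*r"])
  also have "\<dots> = - (J * X * X)"
    using X c inf by (simp add: J_def)
  also have "\<dots> = - 0\<^sub>m (2*r) (2*r)"
    using X c sq by (simp add: assoc_mult_mat[of _ "2*r" "2*r" _ "2*r" _ "2*r"])
  also have "- 0\<^sub>m (2*r) (2*r) = (0\<^sub>m (2*r) (2*r) :: complex mat)" by (intro eq_matI) auto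
  finally have XJX: "transpose_mat X * (J * X) = 0\<^sub>m (2*r) (2*r)" .
  have tu: "transpose_mat ?u = 1\<^sub>m (2*r) + t \<cdot>\<^sub>m transpose_mat X"
    using X by (intro eq_matI) auto
  have "transpose_mat ?u * (J * ?u) = (J + t \<cdot>\<^sub>m (J * X)) + t \<cdot>\<^sub>m (transpose_mat X * (J + t \<cdot>\<^sub>m (J * X)))"
    unfolding tu Ju using X c
    by (subst add_mult_distrib_mat[of _ "2*r" "2*r" _ _ "2*r"]) (auto simp: mult_smult_assoc_mat[of _ "2*r" "2*r" _ "2*r"])
  also have "transpose_mat X * (J + t \<cdot>\<^sub>m (J * X)) = - (J * X)"
    using X c XJX inf
    by (simp add: mult_add_distrib_mat[of _ "2*r" "2*r" _ "2*r"] mult_smult_distrib[of _ "2*r" "2*r" _ "2*r"] J_def)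
  also have "(J + t \<cdot>\<^sub>m (J * X)) + t \<cdot>\<^sub>m (- (J * X)) = J"
    using c by (intro eq_matI) auto
  finally have "transpose_mat ?u * J * ?u = J"
    using u c by (simp add: assoc_mult_mat[of _ "2*r" "2*r" _ "2*r" _ "2*r"])
  then show ?thesis using u by (simp add: Sp_def J_def)
qed

lemma step_reflect: "i \<in> {1..r} \<Longrightarrow> a + b = 2 * r \<Longrightarrow> step r i a \<longleftrightarrow> step r i b"
  by (auto simp: step_def)

lemma x_sub_Sp: assumes i: "i \<in> {1..r}" shows "x_sub r i t \<in> carrier (Sp r)"
  unfolding x_sub_eq[OF i]
proof (rule one_plus_nilpotent_Sp[OF chev_carrier(1) chev_e_square[OF i]])
  show "transpose_mat (chev_e r i) * sp_form r = - (sp_form r * chev_e r i)" (is "?L = - ?R")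
  proof (rule mat_eqI_mentry[of _ "2*r"])
    fix a b assume ab: "a \<in> {1..2*r}" "b \<in> {1..2*r}"
    have R: "?R \<in> carrier_mat (2*r) (2*r)"
      using sp_form_carrier by (auto intro!: mult_carrier_mat[of _ "2*r" "2*r"])
    have b': "2 * r + 1 - b \<in> {1..2*r}" "2 * r + 1 - a \<in> {1..2*r}" using ab by auto
    have "mentry ?L a b = - ((-1) ^ (b + 1)) * mentry (chev_e r i) (2 * r + 1 - b) a"
      using ab b' by (simp add: mentry_form_mult(2) mentry_transpose[of _ "2*r"])
    also have "\<dots> = - ((-1) ^ (b + 1)) * (if a + b = 2 * r + 2 \<and> step r i (2 * r + 1 - b) then 1 else 0)"
      using ab by (subst mentry_chev_e[OF i b'(1) ab(1)]) auto
    also have "\<dots> = - ((-1) ^ (a + 1)) * (if a + b = 2 * r + 2 \<and> step r i (2 * r + 1 - a) then 1 else 0)"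
    proof (cases "a + b = 2 * r + 2")
      case True
      then have "step r i (2 * r + 1 - b) \<longleftrightarrow> step r i (2 * r + 1 - a)" "even a \<longleftrightarrow> even b"
      proof -
        have "2 * r + 1 - b = a - 1" "2 * r + 1 - a = b - 1" "a - 1 + (b - 1) = 2 * r" using True ab by auto
        then show "step r i (2 * r + 1 - b) \<longleftrightarrow> step r i (2 * r + 1 - a)"
          using step_reflect[OF i] by simp
        show "even a \<longleftrightarrow> even b" using True by presburger
      qed
      moreover from this(2) have "(-1 :: complex) ^ (a + 1) = (-1) ^ (b + 1)"
        by (cases "even a") (auto simp: uminus_power_if)
      ultimately show ?thesis by simp
    qed simp
    also have "\<dots> = - ((-1) ^ (a + 1) * mentry (chev_e r i) (2 * r + 1 - a) b)"
      using ab by (subst mentry_chev_e[OF i b'(2) ab(2)]) auto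
    also have "\<dots> = - mentry ?R a b"
      using ab by (simp add: mentry_form_mult(1))
    also have "\<dots> = mentry (- ?R) a b" using ab R by (auto simp: mentry_def)
    finally show "mentry ?L a b = mentry (- ?R) a b" .
  qed (use sp_form_carrier in \<open>auto intro!: mult_carrier_mat[of _ "2*r" "2*r"]\<close>)
qed

lemma y_sub_Sp: "i \<in> {1..r} \<Longrightarrow> y_sub r i t \<in> carrier (Sp r)"
  by (simp add: y_sub_eq transpose_Sp x_sub_Sp)

lemma diagonal_Sp:
  assumes h: "h \<in> carrier_mat (2*r) (2*r)"
    and D: "\<And>a b. a \<in> {1..2*r} \<Longrightarrow> b \<in> {1..2*r} \<Longrightarrow> mentry h a b = (if a = b then D a else 0)"
  shows "h \<in> carrier (Sp r) \<longleftrightarrow> (\<forall>a\<in>{1..2*r}. D a * D (2 * r + 1 - a) = 1)"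
proof -
  have sp: "sp_pair r (\<lambda>c. mentry h c a) (\<lambda>c. mentry h c b)
      = (if a + b = 2 * r + 1 then (-1) ^ (a + 1) * (D a * D b) else 0)"
    if ab: "a \<in> {1..2*r}" "b \<in> {1..2*r}" for a b
  proof -
    have "sp_pair r (\<lambda>c. mentry h c a) (\<lambda>c. mentry h c b)
        = (\<Sum>c\<in>{1..2*r}. if c = a then if a + b = 2 * r + 1 then (-1) ^ (a + 1) * (D a * D b) else 0 else 0)"
      unfolding sp_pair_def
    proof (rule sum.cong[OF refl])
      fix c assume c: "c \<in> {1..2*r}"
      then have "2 * r + 1 - c \<in> {1..2*r}" by auto
      then show "(-1) ^ (c + 1) * mentry h c a * mentry h (2 * r + 1 - c) b =
          (if c = a then if a + b = 2 * r + 1 then (-1) ^ (a + 1) * (D a * D b) else 0 else 0)"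
        using D[OF c ab(1)] D[of "2 * r + 1 - c" b] ab by auto
    qed
    then show ?thesis using ab by simp
  qed
  show ?thesis
  proof
    assume "h \<in> carrier (Sp r)"
    show "\<forall>a\<in>{1..2*r}. D a * D (2 * r + 1 - a) = 1"
    proof
      fix a assume a: "a \<in> {1..2*r}"
      then have a': "2 * r + 1 - a \<in> {1..2*r}" by auto
      from Sp_pair[OF \<open>h \<in> carrier (Sp r)\<close> a a'] sp[OF a a'] a
      show "D a * D (2 * r + 1 - a) = 1" by simp
    qed
  next
    assume R: "\<forall>a\<in>{1..2*r}. D a * D (2 * r + 1 - a) = 1"
    show "h \<in> carrier (Sp r)" unfolding Sp_iff
    proof (intro conjI ballI h)
      fix a b assume ab: "a \<in> {1..2*r}" "b \<in> {1..2*r}"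
      have "D a * D b = 1" if "a + b = 2 * r + 1"
      proof -
        have "b = 2 * r + 1 - a" using that by simp
        then show ?thesis using R ab by simp
      qed
      then show "sp_pair r (\<lambda>c. mentry h c a) (\<lambda>c. mentry h c b)
          = (if a + b = 2 * r + 1 then (-1) ^ (a + 1) else 0)"
        using sp[OF ab] by simp
    qed
  qed
qed

lemma coroot_Sp: assumes i: "i \<in> {1..r}" and t: "t \<noteq> 0" shows "coroot r i t \<in> carrier (Sp r)"
proof -
  let ?D = "\<lambda>a. if step r i a then t else if step r i (a - 1) then inverse t else 1"
  have "?D a * ?D (2 * r + 1 - a) = 1" if a: "a \<in> {1..2*r}" for a
  proof -
    have "step r i (2 * r + 1 - a) \<longleftrightarrow> step r i (a - 1)" "step r i (2 * r + 1 - a - 1) \<longleftrightarrow> step r i a"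
      using a by (auto intro!: step_reflect[OF i])
    moreover have "\<not> (step r i a \<and> step r i (a - 1))"
      using step_Suc[OF i, of "a - 1"] a by auto
    ultimately show ?thesis using t by auto
  qed
  then show ?thesis
    by (subst diagonal_Sp[OF coroot_carrier, of r i t ?D]) (use i in \<open>auto simp: mentry_coroot\<close>)
qed

lemma x_neg_Sp: "i \<in> {1..r} \<Longrightarrow> t \<noteq> 0 \<Longrightarrow> x_neg r i t \<in> carrier (Sp r)"
  unfolding x_neg_def by (intro Sp_mult_closed y_sub_Sp coroot_Sp) auto

lemma gprod_Sp: "(\<And>x. x \<in> set xs \<Longrightarrow> x \<in> carrier (Sp r)) \<Longrightarrow> gprod (Sp r) xs \<in> carrier (Sp r)"
  by (induction xs) (auto intro: one_Sp Sp_mult_closed)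

lemma mentry_x_sub_mult:
  assumes "i \<in> {1..r}" "g \<in> carrier_mat (2*r) (2*r)" "a \<in> {1..2*r}" "b \<in> {1..2*r}"
  shows "mentry (x_sub r i t * g) a b = mentry g a b + (if step r i a then t * mentry g (a + 1) b else 0)"
proof -
  have "mentry (x_sub r i t * g) a b = (\<Sum>c\<in>{1..2*r}. mentry (x_sub r i t) a c * mentry g c b)"
    using assms by (intro mentry_mult x_sub_carrier)
  also have "\<dots> = (\<Sum>c\<in>{1..2*r}. (if c = a then mentry g a b else 0)
      + (if c = a + 1 then if step r i a then t * mentry g (a + 1) b else 0 else 0))"
    using assms by (intro sum.cong refl) (auto simp: mentry_x_sub)
  finally show ?thesis using assms by (auto simp: sum.distrib step_def)
qed

lemma mentry_y_sub_mult:
  assumes "i \<in> {1..r}" "g \<in> carrier_mat (2*r) (2*r)" "a \<in> {1..2*r}" "b \<in> {1..2*r}"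
  shows "mentry (y_sub r i t * g) a b = mentry g a b + (if step r i (a - 1) then t * mentry g (a - 1) b else 0)"
proof -
  have "mentry (y_sub r i t * g) a b = (\<Sum>c\<in>{1..2*r}. mentry (y_sub r i t) a c * mentry g c b)"
    using assms by (intro mentry_mult y_sub_carrier)
  also have "\<dots> = (\<Sum>c\<in>{1..2*r}. (if c = a then mentry g a b else 0)
      + (if c = a - 1 then if step r i (a - 1) then t * mentry g (a - 1) b else 0 else 0))"
    using assms by (intro sum.cong refl) (auto simp: mentry_y_sub)
  finally show ?thesis using assms by (auto simp: sum.distrib step_def)
qed

text \<open>A root element of the symplectic group: position \<open>(q, p)\<close> forces a signed
  entry at the mirror position. The two positions coincide when \<open>p + q = 2 * r + 1\<close>,
  the long roots, and then the entry must be counted once.\<close>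

definition root_elt :: "nat \<Rightarrow> nat \<Rightarrow> nat \<Rightarrow> complex \<Rightarrow> complex mat" where
  "root_elt r q p t = 1\<^sub>m (2*r) + t \<cdot>\<^sub>m E_unit r q p
     + (if p + q = 2 * r + 1 then 0 else (-1) ^ (p + q + 1) * t) \<cdot>\<^sub>m E_unit r (2 * r + 1 - p) (2 * r + 1 - q)"

lemma root_elt_carrier: "root_elt r q p t \<in> carrier_mat (2*r) (2*r)"
  by (simp add: root_elt_def)

lemma mentry_E_unit_mult:
  assumes "g \<in> carrier_mat (2*r) (2*r)" "a \<in> {1..2*r}" "b \<in> {1..2*r}" "y \<in> {1..2*r}"
  shows "mentry (E_unit r x y * g) a b = (if a = x then mentry g y b else 0)"
proof -
  have "mentry (E_unit r x y * g) a b = (\<Sum>c\<in>{1..2*r}. mentry (E_unit r x y) a c * mentry g c b)"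
    using assms by (intro mentry_mult E_unit_carrier) auto
  also have "\<dots> = (\<Sum>c\<in>{1..2*r}. if c = y then if a = x then mentry g y b else 0 else 0)"
    using assms(2) by (intro sum.cong refl) (simp add: mentry_E_unit)
  finally show ?thesis using assms(4) by simp
qed

lemma mentry_root_elt_mult:
  assumes "p \<in> {1..2*r}" "q \<in> {1..2*r}" "g \<in> carrier_mat (2*r) (2*r)" "a \<in> {1..2*r}" "b \<in> {1..2*r}"
  shows "mentry (root_elt r q p t * g) a b = mentry g a b + (if a = q then t * mentry g p b else 0)
    + (if a = 2 * r + 1 - p \<and> p + q \<noteq> 2 * r + 1 then (-1) ^ (p + q + 1) * t * mentry g (2 * r + 1 - q) b else 0)"
proof -
  have q': "2 * r + 1 - q \<in> {1..2*r}" using assms(2) by auto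
  let ?u = "if p + q = 2 * r + 1 then 0 else (-1) ^ (p + q + 1) * t"
  let ?E1 = "E_unit r q p" and ?E2 = "E_unit r (2 * r + 1 - p) (2 * r + 1 - q)"
  have c: "?E1 * g \<in> carrier_mat (2*r) (2*r)" "?E2 * g \<in> carrier_mat (2*r) (2*r)"
    by (rule mult_carrier_mat[OF E_unit_carrier assms(3)])+
  have "root_elt r q p t * g = g + t \<cdot>\<^sub>m (?E1 * g) + ?u \<cdot>\<^sub>m (?E2 * g)"
    unfolding root_elt_def using assms(3)
    by (simp add: add_mult_distrib_mat[of _ "2*r" "2*r" _ _ "2*r"] mult_smult_assoc_mat[of _ "2*r" "2*r" _ "2*r"])
  then have "mentry (root_elt r q p t * g) a b = mentry g a b + t * mentry (?E1 * g) a b + ?u * mentry (?E2 * g) a b"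
    using c assms(4,5) by (simp add: mentry_add[of _ "2*r"] mentry_smult[of _ "2*r"])
  also have "\<dots> = mentry g a b + t * (if a = q then mentry g p b else 0)
      + ?u * (if a = 2 * r + 1 - p then mentry g (2 * r + 1 - q) b else 0)"
    unfolding mentry_E_unit_mult[OF assms(3-5,1)] mentry_E_unit_mult[OF assms(3-5) q'] ..
  finally show ?thesis by (simp only: if_distrib[of "\<lambda>x. _ * x"] mult_zero_right) (simp split: if_split)
qed

section \<open>Triangular and unipotent symplectic matrices\<close>

text \<open>One Boolean covers both shapes, lower for \<open>True\<close> and upper for
  \<open>False\<close>, so that closure properties need only one proof.\<close>

definition tri :: "bool \<Rightarrow> nat \<Rightarrow> complex mat \<Rightarrow> bool" where
  "tri lo r g \<longleftrightarrow> (\<forall>a\<in>{1..2*r}. \<forall>b\<in>{1..2*r}. (if lo then a < b else b < a) \<longrightarrow> mentry g a b = 0)"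

lemma triD: "tri lo r g \<Longrightarrow> a \<in> {1..2*r} \<Longrightarrow> b \<in> {1..2*r} \<Longrightarrow> if lo then a < b else b < a \<Longrightarrow> mentry g a b = 0"
  unfolding tri_def by blast

lemma tri_mult:
  assumes c: "g \<in> carrier_mat (2*r) (2*r)" "h \<in> carrier_mat (2*r) (2*r)" and t: "tri lo r g" "tri lo r h"
  shows "tri lo r (g * h)"
    and "a \<in> {1..2*r} \<Longrightarrow> mentry (g * h) a a = mentry g a a * mentry h a a"
proof -
  have z: "mentry g a c * mentry h c b = 0"
    if "a \<in> {1..2*r}" "b \<in> {1..2*r}" "c \<in> {1..2*r}" "if lo then a < c \<or> c < b else c < a \<or> b < c" for a b c
    using that triD[OF t(1), of a c] triD[OF t(2), of c b] by (cases lo) auto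
  show "tri lo r (g * h)" unfolding tri_def
  proof (intro ballI impI)
    fix a b assume ab: "a \<in> {1..2*r}" "b \<in> {1..2*r}" "if lo then a < b else b < a"
    have "mentry (g * h) a b = (\<Sum>c\<in>{1..2*r}. mentry g a c * mentry h c b)"
      using c ab by (intro mentry_mult)
    also have "\<dots> = 0" using ab by (intro sum.neutral ballI z) (auto split: if_splits)
    finally show "mentry (g * h) a b = 0" .
  qed
  assume a: "a \<in> {1..2*r}"
  have "mentry (g * h) a a = (\<Sum>c\<in>{1..2*r}. mentry g a c * mentry h c a)"
    using c a by (intro mentry_mult)
  also have "\<dots> = (\<Sum>c\<in>{1..2*r}. if c = a then mentry g a a * mentry h a a else 0)"
  proof (rule sum.cong[OF refl])
    fix c assume c: "c \<in> {1..2*r}"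
    show "mentry g a c * mentry h c a = (if c = a then mentry g a a * mentry h a a else 0)"
    proof (cases "c = a")
      case False
      then have "if lo then a < c \<or> c < a else c < a \<or> a < c" by auto
      from z[OF a a c this] show ?thesis using False by simp
    qed simp
  qed
  finally show "mentry (g * h) a a = mentry g a a * mentry h a a" using a by simp
qed

lemma tri_one: "tri lo r (1\<^sub>m (2*r))"
  by (auto simp: tri_def mentry_one)

lemma tri_sp_inv:
  assumes "g \<in> carrier_mat (2*r) (2*r)" "tri lo r g"
  shows "tri lo r (sp_inv r g)"
  unfolding tri_def
proof (intro ballI impI)
  fix a b assume ab: "a \<in> {1..2*r}" "b \<in> {1..2*r}" "if lo then a < b else b < a"
  then have f: "2 * r + 1 - b \<in> {1..2*r}" "2 * r + 1 - a \<in> {1..2*r}"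
    "if lo then 2 * r + 1 - b < 2 * r + 1 - a else 2 * r + 1 - a < 2 * r + 1 - b" by auto
  then show "mentry (sp_inv r g) a b = 0"
    using triD[OF assms(2) f] mentry_sp_inv[OF assms(1) ab(1,2)] by simp
qed

definition unip :: "bool \<Rightarrow> nat \<Rightarrow> complex mat set" where
  "unip lo r = {g \<in> carrier (Sp r). tri lo r g \<and> (\<forall>a\<in>{1..2*r}. mentry g a a = 1)}"

lemma unipD:
  assumes "g \<in> unip lo r"
  shows "g \<in> carrier (Sp r)" "g \<in> carrier_mat (2*r) (2*r)" "tri lo r g" "a \<in> {1..2*r} \<Longrightarrow> mentry g a a = 1"
  using assms Sp_carrier_mat by (auto simp: unip_def)

text \<open>Diagonal entries of triangular matrices multiply, so those of \<open>x\<close> and of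
  its inverse cancel. This gives normality in the Borel subgroup.\<close>

lemma tri_conjugate_unip:
  assumes x: "x \<in> carrier (Sp r)" "tri lo r x" and u: "u \<in> unip lo r"
  shows "x * u * sp_inv r x \<in> unip lo r"
proof -
  note c = Sp_carrier_mat[OF x(1)] unipD(2)[OF u]
  note ci = sp_inv_carrier[OF c(1)]
  have xu: "tri lo r (x * u)" "x * u \<in> carrier_mat (2*r) (2*r)"
    using tri_mult(1)[OF c x(2) unipD(3)[OF u]] mult_carrier_mat[OF c] by auto
  have "mentry (x * u * sp_inv r x) a a = 1" if a: "a \<in> {1..2*r}" for a
  proof -
    have "mentry (x * u * sp_inv r x) a a = mentry x a a * mentry (sp_inv r x) a a"
      using tri_mult(2)[OF xu(2) ci xu(1) tri_sp_inv[OF c(1) x(2)] a] tri_mult(2)[OF c x(2) unipD(3)[OF u] a] unipD(4)[OF u a]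
      by simp
    also have "\<dots> = mentry (x * sp_inv r x) a a"
      using tri_mult(2)[OF c(1) ci x(2) tri_sp_inv[OF c(1) x(2)] a] by simp
    also have "\<dots> = 1" using a by (simp add: sp_inv_right[OF x(1)] mentry_one)
    finally show ?thesis .
  qed
  moreover have "tri lo r (x * u * sp_inv r x)"
    by (rule tri_mult(1)[OF xu(2) ci xu(1) tri_sp_inv[OF c(1) x(2)]])
  moreover have "x * u * sp_inv r x \<in> carrier (Sp r)"
    using x u unipD(1) by (intro Sp_mult_closed sp_inv_Sp) auto
  ultimately show ?thesis by (simp add: unip_def)
qed

lemma unip_mult: "g \<in> unip lo r \<Longrightarrow> h \<in> unip lo r \<Longrightarrow> g * h \<in> unip lo r"
  using tri_mult[of g r h lo] Sp_mult_closed[of g r h] Sp_carrier_mat by (auto simp: unip_def)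

lemma one_unip: "1\<^sub>m (2*r) \<in> unip lo r"
  by (simp add: unip_def one_Sp tri_one mentry_one)

lemma sp_inv_unip: assumes "g \<in> unip lo r" shows "sp_inv r g \<in> unip lo r"
proof -
  note g = unipD[OF assms]
  have "mentry (sp_inv r g) a a = 1" if a: "a \<in> {1..2*r}" for a
    using a tri_mult(2)[OF g(2) sp_inv_carrier[OF g(2)] g(3) tri_sp_inv[OF g(2,3)] a] g(4)[OF a]
    by (simp add: sp_inv_right[OF g(1)] mentry_one)
  then show ?thesis using g tri_sp_inv[OF g(2,3)] sp_inv_Sp[OF g(1)] by (simp add: unip_def)
qed

lemma tri_transpose: "g \<in> carrier_mat (2*r) (2*r) \<Longrightarrow> tri lo r (transpose_mat g) \<longleftrightarrow> tri (\<not> lo) r g"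
  by (auto simp: tri_def mentry_transpose[of _ "2*r"])

lemma unip_transpose: assumes "g \<in> unip lo r" shows "transpose_mat g \<in> unip (\<not> lo) r"
  using unipD[OF assms] by (simp add: unip_def transpose_Sp tri_transpose mentry_transpose[of _ "2*r"])

section \<open>Root elements and the group generated by the \<open>y\<^sub>i\<close>\<close>

definition y_group :: "nat \<Rightarrow> complex mat set" where
  "y_group r = generate (Sp r) {y_sub r i t | i t. i \<in> {1..r}}"

lemma y_group_mult: "g \<in> y_group r \<Longrightarrow> h \<in> y_group r \<Longrightarrow> g * h \<in> y_group r"
  unfolding y_group_def using generate.eng[of g "Sp r" _ h] by simp

lemma y_sub_in_y_group: "i \<in> {1..r} \<Longrightarrow> y_sub r i t \<in> y_group r"
  unfolding y_group_def by (rule generate.incl) blast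

lemma one_in_y_group: "1\<^sub>m (2*r) \<in> y_group r"
  unfolding y_group_def using generate.one[of "Sp r"] by simp

lemma y_group_Sp: "y_group r \<subseteq> carrier (Sp r)"
  unfolding y_group_def
  by (rule group.generate_incl[OF group_Sp]) (auto intro: y_sub_Sp)

lemma root_elt_adjacent:
  assumes "p \<in> {1..r}"
  shows "root_elt r (Suc p) p t = y_sub r p t"
proof (rule mat_eqI_mentry[OF root_elt_carrier y_sub_carrier])
  fix a b assume ab: "a \<in> {1..2*r}" "b \<in> {1..2*r}"
  have "mentry (root_elt r (Suc p) p t * 1\<^sub>m (2*r)) a b = mentry (y_sub r p t * 1\<^sub>m (2*r)) a b"
    using assms ab
    by (subst mentry_root_elt_mult; (subst mentry_y_sub_mult)?) (auto simp: step_def)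
  then show "mentry (root_elt r (Suc p) p t) a b = mentry (y_sub r p t) a b"
    by (simp add: right_mult_one_mat[OF root_elt_carrier] right_mult_one_mat[OF y_sub_carrier])
qed

text \<open>Here \<open>q'\<close> stands for \<open>2 r + 1 - q\<close>. The commutator of the root elements for \<open>(q, p)\<close> and
  \<open>(q + 1, q)\<close> is the one for \<open>(q + 1, p)\<close>, except that a long root element at \<open>(p', p)\<close> intervenes
  when \<open>q = r\<close>; it cancels in the product of two commutators with opposite parameters.\<close>

lemma commutator_generic:
  assumes p: "1 \<le> p" "p < q" "p + q + 1 < 2 * r + 1" "q \<noteq> r" and g: "g \<in> carrier_mat (2*r) (2*r)"
    and i: "i \<in> {1..r}" "i = q \<or> i = 2 * r - q"
  shows "y_sub r i 1 * (root_elt r q p t * (y_sub r i (-1) * (root_elt r q p (-t) * g)))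
    = root_elt r (Suc q) p t * g" (is "?y1 * (?e1 * (?y2 * (?e2 * g))) = ?R")
proof (rule mat_eqI_mentry[of _ "2*r"])
  note mc = mult_carrier_mat[OF y_sub_carrier] mult_carrier_mat[OF root_elt_carrier]
  show "?y1 * (?e1 * (?y2 * (?e2 * g))) \<in> carrier_mat (2*r) (2*r)" "?R \<in> carrier_mat (2*r) (2*r)"
    by (intro mc g)+
  fix a b assume ab: "a \<in> {1..2*r}" "b \<in> {1..2*r}"
  define p' q' s' where prime: "p' = 2 * r + 1 - p" "q' = 2 * r + 1 - q" "s' = 2 * r - q"
  then have prime': "2 * r + 1 - p = p'" "2 * r + 1 - q = q'" "2 * r + 1 - Suc q = s'" by simp_all
  have sums: "p + p' = 2 * r + 1" "q + q' = 2 * r + 1" "q + s' = 2 * r" "q' = Suc s'" using p prime by auto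
  \<comment> \<open>\<open>v\<close> to \<open>v3\<close> follow one column through the row
    operations of the factors, read from right to left.\<close>
  define v where "v a = mentry g a b" for a
  define v1 where "v1 a = mentry (?e2 * g) a b" for a
  define v2 where "v2 a = mentry (?y2 * (?e2 * g)) a b" for a
  define v3 where "v3 a = mentry (?e1 * (?y2 * (?e2 * g))) a b" for a
  have pq: "p \<in> {1..2*r}" "q \<in> {1..2*r}" "Suc q \<in> {1..2*r}" using p by auto
  define e where "e = ((-1) ^ (p + q + 1) :: complex)"
  have st: "step r i (a - 1) \<longleftrightarrow> a = Suc q \<or> a = q'" if "a \<in> {1..2*r}" for a
  proof (cases "i = q")
    case True
    then show ?thesis using that i p sums unfolding step_def by auto
  next
    case False
    then have "i = s'" using i prime by simp
    then show ?thesis using that i p sums unfolding step_def by auto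
  qed
  have v1: "v1 a = v a + (if a = q then - t * v p else 0) + (if a = p' then e * - t * v q' else 0)"
    if "a \<in> {1..2*r}" for a
    using mentry_root_elt_mult[OF pq(1,2) g that ab(2), of "-t"] p unfolding v1_def v_def e_def prime' by simp
  have v2: "v2 a = v1 a - (if a = Suc q \<or> a = q' then v1 (a - 1) else 0)"
    if "a \<in> {1..2*r}" for a
    using mentry_y_sub_mult[OF i(1) mc(2)[OF g] that ab(2), of "-1"] st[OF that] unfolding v1_def v2_def by simp
  have v3: "v3 a = v2 a + (if a = q then t * v2 p else 0) + (if a = p' then e * t * v2 q' else 0)"
    if "a \<in> {1..2*r}" for a
    using mentry_root_elt_mult[OF pq(1,2) mc(1)[OF mc(2)[OF g]] that ab(2)] p unfolding v2_def v3_def e_def prime' by simp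
  have L: "mentry (?y1 * (?e1 * (?y2 * (?e2 * g)))) a b = v3 a + (if a = Suc q \<or> a = q' then v3 (a - 1) else 0)"
    using mentry_y_sub_mult[OF i(1) mc(2)[OF mc(1)[OF mc(2)[OF g]]] ab] st[OF ab(1)] unfolding v3_def by simp
  have R: "mentry ?R a b = v a + (if a = Suc q then t * v p else 0) + (if a = p' then - e * t * v s' else 0)"
    using mentry_root_elt_mult[OF pq(1,3) g ab] p unfolding v_def e_def prime' by simp
  have in_range: "p' \<in> {1..2*r}" "q' \<in> {1..2*r}" "s' \<in> {1..2*r}" using p sums by auto
  have d: "p \<noteq> q" "p \<noteq> Suc q" "p \<noteq> q'" "p \<noteq> p'" "p \<noteq> s'" "q \<noteq> q'" "q \<noteq> s'" "q \<noteq> p'" "Suc q \<noteq> q'"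
    "Suc q \<noteq> p'" "Suc q \<noteq> s'" "q' \<noteq> p'" "s' \<noteq> p'" "q' \<noteq> s'" "q' - Suc 0 = s'"
    using p sums by (linarith | presburger)+
  note d' = d d(1-14)[symmetric]
  have w1: "v1 p = v p" "v1 q = v q - t * v p" "v1 (Suc q) = v (Suc q)" "v1 q' = v q'" "v1 s' = v s'"
     "v1 p' = v p' - e * t * v q'"
    by (simp_all add: v1[OF pq(1)] v1[OF pq(2)] v1[OF pq(3)] v1[OF in_range(1)] v1[OF in_range(2)] v1[OF in_range(3)] d')
  have w2: "v2 p = v p" "v2 q = v q - t * v p" "v2 (Suc q) = v (Suc q) - v q + t * v p" "v2 q' = v q' - v s'" "v2 s' = v s'"
     "v2 p' = v p' - e * t * v q'"
    by (simp_all add: v2[OF pq(1)] v2[OF pq(2)] v2[OF pq(3)] v2[OF in_range(1)] v2[OF in_range(2)] v2[OF in_range(3)] d' w1)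
  have w3: "v3 p = v p" "v3 q = v q" "v3 (Suc q) = v (Suc q) - v q + t * v p" "v3 q' = v q' - v s'" "v3 s' = v s'"
     "v3 p' = v p' - e * t * v s'"
    by (simp_all add: v3[OF pq(1)] v3[OF pq(2)] v3[OF pq(3)] v3[OF in_range(1)] v3[OF in_range(2)] v3[OF in_range(3)] d' w2 algebra_simps)
  consider "a = p" | "a = q" | "a = Suc q" | "a = q'" | "a = s'" | "a = p'"
    | "a \<noteq> p" "a \<noteq> q" "a \<noteq> Suc q" "a \<noteq> q'" "a \<noteq> s'" "a \<noteq> p'" by blast
  then show "mentry (?y1 * (?e1 * (?y2 * (?e2 * g)))) a b = mentry ?R a b"
    unfolding L R
  proof cases
    case 7
    have "v3 a = v a" by (simp add: 7 v1[OF ab(1)] v2[OF ab(1)] v3[OF ab(1)])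
    then show "v3 a + (if a = Suc q \<or> a = q' then v3 (a - 1) else 0)
      = v a + (if a = Suc q then t * v p else 0) + (if a = p' then - e * t * v s' else 0)" by (simp add: 7)
  qed (simp_all add: w3 d')
qed

text \<open>Here \<open>Suc q\<close> is the mirror of \<open>p\<close>, so the two contributions of
  the commutator land in one position and add up; hence the factor 2.\<close>

lemma commutator_long:
  assumes p: "1 \<le> p" "p < q" "p + q + 1 = 2 * r + 1" and g: "g \<in> carrier_mat (2*r) (2*r)"
  shows "y_sub r p 1 * (root_elt r q p t * (y_sub r p (-1) * (root_elt r q p (-t) * g)))
    = root_elt r (Suc q) p (2 * t) * g" (is "?y1 * (?e1 * (?y2 * (?e2 * g))) = ?R")
proof (rule mat_eqI_mentry[of _ "2*r"])
  note mc = mult_carrier_mat[OF y_sub_carrier] mult_carrier_mat[OF root_elt_carrier]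
  show "?y1 * (?e1 * (?y2 * (?e2 * g))) \<in> carrier_mat (2*r) (2*r)" "?R \<in> carrier_mat (2*r) (2*r)"
    by (intro mc g)+
  fix a b assume ab: "a \<in> {1..2*r}" "b \<in> {1..2*r}"
  define v where "v a = mentry g a b" for a
  define v1 where "v1 a = mentry (?e2 * g) a b" for a
  define v2 where "v2 a = mentry (?y2 * (?e2 * g)) a b" for a
  define v3 where "v3 a = mentry (?e1 * (?y2 * (?e2 * g))) a b" for a
  have pq: "p \<in> {1..2*r}" "q \<in> {1..2*r}" "Suc q \<in> {1..2*r}" "Suc p \<in> {1..2*r}" and i: "p \<in> {1..r}" using p by auto
  have prime: "2 * r + 1 - p = Suc q" "2 * r + 1 - q = Suc p" using p by auto
  have sgn: "(-1) ^ (p + q + 1) = (-1 :: complex)" unfolding p(3) by simp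
  have st: "step r p (a - 1) \<longleftrightarrow> a = Suc p \<or> a = Suc q" if "a \<in> {1..2*r}" for a
    using that p unfolding step_def by auto
  have v1: "v1 a = v a + (if a = q then - t * v p else 0) + (if a = Suc q then t * v (Suc p) else 0)"
    if "a \<in> {1..2*r}" for a
    using mentry_root_elt_mult[OF pq(1,2) g that ab(2), of "-t"] p unfolding v1_def v_def sgn prime by simp
  have v2: "v2 a = v1 a - (if a = Suc p \<or> a = Suc q then v1 (a - 1) else 0)"
    if "a \<in> {1..2*r}" for a
    using mentry_y_sub_mult[OF i mc(2)[OF g] that ab(2)] st[OF that] unfolding v1_def v2_def by simp
  have v3: "v3 a = v2 a + (if a = q then t * v2 p else 0) + (if a = Suc q then - t * v2 (Suc p) else 0)"
    if "a \<in> {1..2*r}" for a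
    using mentry_root_elt_mult[OF pq(1,2) mc(1)[OF mc(2)[OF g]] that ab(2)] p unfolding v2_def v3_def sgn prime by simp
  have L: "mentry (?y1 * (?e1 * (?y2 * (?e2 * g)))) a b = v3 a + (if a = Suc p \<or> a = Suc q then v3 (a - 1) else 0)"
    using mentry_y_sub_mult[OF i mc(2)[OF mc(1)[OF mc(2)[OF g]]] ab] st[OF ab(1)] unfolding v3_def by simp
  have R: "mentry ?R a b = v a + (if a = Suc q then 2 * t * v p else 0)"
    using mentry_root_elt_mult[OF pq(1,3) g ab] p unfolding v_def by simp
  have d: "p \<noteq> q" "p \<noteq> Suc q" "p \<noteq> Suc p" "q \<noteq> Suc p" "q \<noteq> Suc q" "Suc p \<noteq> Suc q" using p by (linarith | presburger)+
  note d' = d d[symmetric]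
  have w1: "v1 p = v p" "v1 q = v q - t * v p" "v1 (Suc q) = v (Suc q) + t * v (Suc p)" "v1 (Suc p) = v (Suc p)"
    by (simp_all add: v1[OF pq(1)] v1[OF pq(2)] v1[OF pq(3)] v1[OF pq(4)] d')
  have w2: "v2 p = v p" "v2 q = v q - t * v p" "v2 (Suc q) = v (Suc q) + t * v (Suc p) - v q + t * v p"
     "v2 (Suc p) = v (Suc p) - v p"
    by (simp_all add: v2[OF pq(1)] v2[OF pq(2)] v2[OF pq(3)] v2[OF pq(4)] d' w1)
  have w3: "v3 p = v p" "v3 q = v q" "v3 (Suc q) = v (Suc q) - v q + 2 * t * v p" "v3 (Suc p) = v (Suc p) - v p"
    by (simp_all add: v3[OF pq(1)] v3[OF pq(2)] v3[OF pq(3)] v3[OF pq(4)] d' w2 algebra_simps)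
  consider "a = p" | "a = q" | "a = Suc q" | "a = Suc p"
    | "a \<noteq> p" "a \<noteq> q" "a \<noteq> Suc q" "a \<noteq> Suc p" by blast
  then show "mentry (?y1 * (?e1 * (?y2 * (?e2 * g)))) a b = mentry ?R a b"
    unfolding L R
  proof cases
    case 5
    have "v3 a = v a" by (simp add: 5 v1[OF ab(1)] v2[OF ab(1)] v3[OF ab(1)])
    then show "v3 a + (if a = Suc p \<or> a = Suc q then v3 (a - 1) else 0)
      = v a + (if a = Suc q then 2 * t * v p else 0)" by (simp add: 5)
  qed (simp_all add: w3 d')
qed

text \<open>The short root element has parameter \<open>s * t\<close>, the long one
  \<open>s * t * t\<close>. Changing the sign of both \<open>s\<close> and \<open>t\<close>
  preserves the first and negates the second.\<close>

lemma commutator_middle: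
  assumes p: "1 \<le> p" "p < r" and g: "g \<in> carrier_mat (2*r) (2*r)" and a: "a \<in> {1..2*r}" and b: "b \<in> {1..2*r}"
  shows "mentry (y_sub r r s * (root_elt r r p t * (y_sub r r (-s) * (root_elt r r p (-t) * g)))) a b
    = mentry g a b + (if a = Suc r then s * t * mentry g p b else 0)
      + (if a = 2 * r + 1 - p then (-1) ^ (p + r + 1) * (s * t * t * mentry g p b - s * t * mentry g r b) else 0)"
    (is "mentry (?y1 * (?e1 * (?y2 * (?e2 * g)))) a b = _")
proof -
  note mc = mult_carrier_mat[OF y_sub_carrier] mult_carrier_mat[OF root_elt_carrier]
  define p' where "p' = 2 * r + 1 - p"
  then have p': "2 * r + 1 - p = p'" "p + p' = 2 * r + 1" using p by simp_all
  define v where "v a = mentry g a b" for a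
  define v1 where "v1 a = mentry (?e2 * g) a b" for a
  define v2 where "v2 a = mentry (?y2 * (?e2 * g)) a b" for a
  define v3 where "v3 a = mentry (?e1 * (?y2 * (?e2 * g))) a b" for a
  have pq: "p \<in> {1..2*r}" "r \<in> {1..2*r}" "Suc r \<in> {1..2*r}" "p' \<in> {1..2*r}" and i: "r \<in> {1..r}" using p p' by auto
  have prime: "2 * r + 1 - r = Suc r" by simp
  define e where "e = ((-1) ^ (p + r + 1) :: complex)"
  have st: "step r r (a - 1) \<longleftrightarrow> a = Suc r" if "a \<in> {1..2*r}" for a
    using that p unfolding step_def by auto
  have v1: "v1 a = v a + (if a = r then - t * v p else 0) + (if a = p' then e * - t * v (Suc r) else 0)"
    if "a \<in> {1..2*r}" for a
    using mentry_root_elt_mult[OF pq(1,2) g that b, of "-t"] p unfolding v1_def v_def e_def prime p'(1) by simp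
  have v2: "v2 a = v1 a - (if a = Suc r then s * v1 r else 0)"
    if "a \<in> {1..2*r}" for a
    using mentry_y_sub_mult[OF i mc(2)[OF g] that b] st[OF that] unfolding v1_def v2_def by simp
  have v3: "v3 a = v2 a + (if a = r then t * v2 p else 0) + (if a = p' then e * t * v2 (Suc r) else 0)"
    if "a \<in> {1..2*r}" for a
    using mentry_root_elt_mult[OF pq(1,2) mc(1)[OF mc(2)[OF g]] that b] p unfolding v2_def v3_def e_def prime p'(1) by simp
  have L: "mentry (?y1 * (?e1 * (?y2 * (?e2 * g)))) a b = v3 a + (if a = Suc r then s * v3 r else 0)"
    using mentry_y_sub_mult[OF i mc(2)[OF mc(1)[OF mc(2)[OF g]]] a b] st[OF a] unfolding v3_def by simp
  have d: "p \<noteq> r" "p \<noteq> Suc r" "p \<noteq> p'" "r \<noteq> p'" "Suc r \<noteq> p'" "r \<noteq> Suc r" using p p' by (linarith | presburger)+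
  note d' = d d[symmetric]
  have w1: "v1 p = v p" "v1 r = v r - t * v p" "v1 (Suc r) = v (Suc r)" "v1 p' = v p' - e * t * v (Suc r)"
    by (simp_all add: v1[OF pq(1)] v1[OF pq(2)] v1[OF pq(3)] v1[OF pq(4)] d')
  have w2: "v2 p = v p" "v2 r = v r - t * v p" "v2 (Suc r) = v (Suc r) - s * v r + s * t * v p"
     "v2 p' = v p' - e * t * v (Suc r)"
    by (simp_all add: v2[OF pq(1)] v2[OF pq(2)] v2[OF pq(3)] v2[OF pq(4)] d' w1 algebra_simps)
  have w3: "v3 p = v p" "v3 r = v r" "v3 (Suc r) = v (Suc r) - s * v r + s * t * v p"
     "v3 p' = v p' + e * (s * t * t * v p - s * t * v r)"
    by (simp_all add: v3[OF pq(1)] v3[OF pq(2)] v3[OF pq(3)] v3[OF pq(4)] d' w2 algebra_simps)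
  consider "a = r" | "a = Suc r" | "a = p'" | "a \<noteq> r" "a \<noteq> Suc r" "a \<noteq> p'" by blast
  then have "v3 a + (if a = Suc r then s * v3 r else 0) = v a + (if a = Suc r then s * t * v p else 0)
      + (if a = p' then e * (s * t * t * v p - s * t * v r) else 0)"
  proof cases
    case 4
    have "v3 a = v a" by (simp add: 4 v1[OF a] v2[OF a] v3[OF a])
    then show ?thesis by (simp add: 4)
  qed (simp_all add: w3 d')
  then show ?thesis unfolding L p' unfolding v_def e_def .
qed

text \<open>Induction on \<open>q\<close> from the simple generator at \<open>Suc p\<close>: each
  commutator with a simple \<open>y_sub\<close> lowers the row by one.\<close>

lemma root_elt_in_y_group:
  assumes "1 \<le> p" "p < q" "p + q \<le> 2 * r + 1"
  shows "root_elt r q p t \<in> y_group r"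
proof -
  have "Suc p \<le> q" using assms by simp
  then show ?thesis using assms(3)
  proof (induction q arbitrary: t rule: dec_induct)
    case base
    then have "p \<in> {1..r}" using assms(1) by auto
    then show ?case by (simp add: root_elt_adjacent y_sub_in_y_group)
  next
    case (step q)
    have IH: "root_elt r q p t \<in> y_group r" for t using step by simp
    have pq: "p < q" using step by simp
    note one = right_mult_one_mat[OF root_elt_carrier]
    consider "q = r" | "q \<noteq> r" "p + q + 1 = 2 * r + 1" | "q \<noteq> r" "p + q + 1 < 2 * r + 1"
      using step.prems by linarith
    then show ?case
    proof cases
      case 1
      define C where "C s u g = y_sub r r s * (root_elt r r p u * (y_sub r r (-s) * (root_elt r r p (-u) * g)))" for s u g
      note mc = mult_carrier_mat[OF y_sub_carrier] mult_carrier_mat[OF root_elt_carrier]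
      have Cc: "C s u g \<in> carrier_mat (2*r) (2*r)" if "g \<in> carrier_mat (2*r) (2*r)" for s u g
        unfolding C_def by (intro mc that)
      have CY: "C s u g \<in> y_group r" if "g \<in> y_group r" for s u g
        unfolding C_def using that IH y_sub_in_y_group[of r r] pq 1 assms(1) by (intro y_group_mult) auto
      have C: "mentry (C s u g) a b = mentry g a b + (if a = Suc r then s * u * mentry g p b else 0)
          + (if a = 2 * r + 1 - p then (-1) ^ (p + r + 1) * (s * u * u * mentry g p b - s * u * mentry g r b) else 0)"
        if "g \<in> carrier_mat (2*r) (2*r)" "a \<in> {1..2*r}" "b \<in> {1..2*r}" for s u g a b
        unfolding C_def using commutator_middle[OF assms(1) _ that] pq 1 by simp
      \<comment> \<open>Each of the two commutators contributes \<open>t / 2\<close> to the short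
        root, while their long root terms are opposite and cancel.\<close>
      have "C 1 (t/2) (C (-1) (-(t/2)) (1\<^sub>m (2*r))) = root_elt r (Suc r) p t"
      proof (rule mat_eqI_mentry[OF Cc[OF Cc] root_elt_carrier])
        fix a b assume ab: "a \<in> {1..2*r}" "b \<in> {1..2*r}"
        have in_range: "p \<in> {1..2*r}" "Suc r \<in> {1..2*r}" "r \<in> {1..2*r}" using assms(1) pq 1 by auto
        define p' where "p' = 2 * r + 1 - p"
        have d: "p \<noteq> Suc r" "p \<noteq> p'" "r \<noteq> p'" "p + Suc r \<noteq> 2 * r + 1"
          using pq 1 assms(1) by (auto simp: p'_def)
        have sgn: "(-1) ^ (p + Suc r + 1) = - ((-1) ^ (p + r + 1) :: complex)" by simp
        have r': "2 * r + 1 - Suc r = r" by simp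
        define e where "e = ((-1) ^ (p + r + 1) :: complex)"
        define h where "h = C (-1) (-(t/2)) (1\<^sub>m (2*r))"
        have h: "mentry h a b = mentry (1\<^sub>m (2*r)) a b + (if a = Suc r then t / 2 * mentry (1\<^sub>m (2*r)) p b else 0)
          + (if a = p' then e * (- (t/2 * (t/2)) * mentry (1\<^sub>m (2*r)) p b - t / 2 * mentry (1\<^sub>m (2*r)) r b) else 0)"
          if "a \<in> {1..2*r}" for a
          using C[OF one_carrier_mat that ab(2), of "-1" "-(t/2)"] unfolding h_def p'_def e_def by simp
        have "mentry (C 1 (t/2) h) a b = mentry h a b + (if a = Suc r then t / 2 * mentry h p b else 0)
          + (if a = p' then e * (t/2 * (t/2) * mentry h p b - t / 2 * mentry h r b) else 0)"
          using C[OF Cc[OF one_carrier_mat] ab, of 1 "t/2"] unfolding h_def p'_def e_def by simp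
        also have "\<dots> = mentry (1\<^sub>m (2*r)) a b + (if a = Suc r then t * mentry (1\<^sub>m (2*r)) p b else 0)
          + (if a = p' then - e * t * mentry (1\<^sub>m (2*r)) r b else 0)"
          unfolding h[OF ab(1)] h[OF in_range(1)] h[OF in_range(3)] using d by (auto simp: algebra_simps)
        also have "\<dots> = mentry (root_elt r (Suc r) p t * 1\<^sub>m (2*r)) a b"
          unfolding mentry_root_elt_mult[OF in_range(1,2) one_carrier_mat ab] sgn r'
          using d by (simp add: e_def p'_def)
        finally show "mentry (C 1 (t/2) (C (-1) (-(t/2)) (1\<^sub>m (2*r)))) a b = mentry (root_elt r (Suc r) p t) a b"
          unfolding one h_def .
      qed simp
      then show ?thesis using CY[OF CY[OF one_in_y_group]] 1 by metis
    next
      case 2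
      have "p \<in> {1..r}" using assms(1) pq 2 by auto
      \<comment> \<open>The parameter is halved because the commutator doubles it.\<close>
      then have "y_sub r p 1 * (root_elt r q p (t/2) * (y_sub r p (-1) * (root_elt r q p (-(t/2)) * 1\<^sub>m (2*r)))) \<in> y_group r"
        by (intro y_group_mult IH one_in_y_group y_sub_in_y_group)
      then show ?thesis
        unfolding commutator_long[OF assms(1) pq 2(2) one_carrier_mat] unfolding one by simp
    next
      case 3
      \<comment> \<open>The index of the simple root whose arrow leads from \<open>q\<close> to
        \<open>q + 1\<close>.\<close>
      define i where "i = (if q \<le> r then q else 2 * r - q)"
      have i: "i \<in> {1..r}" "i = q \<or> i = 2 * r - q" using assms(1) pq 3 by (auto simp: i_def)
      from i(1) have "y_sub r i 1 * (root_elt r q p t * (y_sub r i (-1) * (root_elt r q p (-t) * 1\<^sub>m (2*r)))) \<in> y_group r"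
        by (intro y_group_mult IH one_in_y_group y_sub_in_y_group)
      then show ?thesis
        unfolding commutator_generic[OF assms(1) pq 3(2,1) one_carrier_mat i] unfolding one .
    qed
  qed
qed

section \<open>Gaussian elimination by root elements\<close>

definition cols_upper :: "nat \<Rightarrow> complex mat \<Rightarrow> nat \<Rightarrow> bool" where
  "cols_upper r g k \<longleftrightarrow> (\<forall>a b. b \<in> {1..k} \<longrightarrow> a \<in> {1..2*r} \<longrightarrow> b < a \<longrightarrow> mentry g a b = 0)"

text \<open>In the symplectic pairing of columns \<open>a\<close> and \<open>b\<close> only the term with the entry at row \<open>2 r + 1 - a\<close>
  survives.\<close>

lemma symplectic_zero_entries:
  assumes g: "g \<in> carrier (Sp r)" "cols_upper r g k" "\<And>a. a \<in> {1..k} \<Longrightarrow> mentry g a a \<noteq> 0" "k \<le> 2 * r"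
  shows "a \<in> {1..k} \<Longrightarrow> b \<in> {1..2*r} \<Longrightarrow> a + b < 2 * r + 1 \<Longrightarrow> mentry g (2 * r + 1 - a) b = 0"
proof (induction a rule: less_induct)
  case (less a)
  have a: "a \<in> {1..2*r}" using less.prems g(4) by auto
  have z: "(-1) ^ (c + 1) * mentry g c a * mentry g (2 * r + 1 - c) b = 0" if c: "c \<in> {1..2*r} - {a}" for c
  proof (cases "c < a")
    case True
    then show ?thesis using less c by auto
  next
    case False
    then have "a < c" using c by auto
    then have "mentry g c a = 0" using g(2) c less.prems unfolding cols_upper_def by blast
    then show ?thesis by simp
  qed
  have z0: "(\<Sum>c\<in>{1..2*r} - {a}. (-1) ^ (c + 1) * mentry g c a * mentry g (2 * r + 1 - c) b) = 0"
    by (rule sum.neutral) (use z in blast)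
  have "0 = sp_pair r (\<lambda>c. mentry g c a) (\<lambda>c. mentry g c b)"
    using Sp_pair[OF g(1) a less.prems(2)] less.prems(3) by simp
  also have "\<dots> = (-1) ^ (a + 1) * mentry g a a * mentry g (2 * r + 1 - a) b"
    unfolding sp_pair_def by (subst sum.remove[OF _ a]) (simp_all only: z0 finite_atLeastAtMost add_0_right)
  finally show ?case using g(3)[OF less.prems(1)] by simp
qed

text \<open>Rows \<open>p + 1\<close> to \<open>2 * r + 1 - p\<close> are cleared from top to bottom
  with multiples of row \<open>p\<close>. The mirror part of each root element spoils only row
  \<open>2 * r + 1 - p\<close>, which comes last and whose own root element is long, hence without
  mirror part. Earlier columns survive because all rows that are added vanish there; rows still
  further down are zero by the symplectic relations.\<close>

lemma clear_column:
  assumes g: "g \<in> carrier (Sp r)" and p: "p \<in> {1..r}" and up: "cols_upper r g (p - 1)"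
    and diag: "\<And>a. a \<in> {1..p} \<Longrightarrow> mentry g a a \<noteq> 0"
  shows "\<exists>\<gamma>\<in>y_group r. cols_upper r (\<gamma> * g) p \<and> (\<forall>a\<in>{1..p}. mentry (\<gamma> * g) a a = mentry g a a)"
proof -
  note gc = Sp_carrier_mat[OF g]
  have step: "\<exists>\<gamma>\<in>y_group r. cols_upper r (\<gamma> * g) (p - 1) \<and> (\<forall>a\<in>{1..p}. mentry (\<gamma> * g) a a = mentry g a a)
      \<and> (\<forall>a\<in>{p<..q}. mentry (\<gamma> * g) a p = 0)" if "p \<le> q" "q \<le> 2 * r + 1 - p" for q
    using that
  proof (induction q rule: dec_induct)
    case base
    have "1\<^sub>m (2*r) * g = g" using gc by simp
    then show ?case using one_in_y_group up by (intro bexI[of _ "1\<^sub>m (2*r)"]) auto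
  next
    case (step q)
    then obtain \<gamma> where \<gamma>: "\<gamma> \<in> y_group r" "cols_upper r (\<gamma> * g) (p - 1)"
      "\<And>a. a \<in> {1..p} \<Longrightarrow> mentry (\<gamma> * g) a a = mentry g a a" "\<And>a. a \<in> {p<..q} \<Longrightarrow> mentry (\<gamma> * g) a p = 0"
      by auto
    define h where "h = \<gamma> * g"
    define s where "s = Suc q"
    define u where "u = - mentry h s p / mentry h p p"
    define e where "e = (if p + s = 2 * r + 1 then 0 else (-1) ^ (p + s + 1) * u)"
    have \<gamma>c: "\<gamma> \<in> carrier_mat (2*r) (2*r)" using \<gamma>(1) y_group_Sp Sp_carrier_mat by blast
    then have hc: "h \<in> carrier_mat (2*r) (2*r)" unfolding h_def using gc by (rule mult_carrier_mat)
    have s: "p < s" "s + p \<le> 2 * r + 1" using step p by (auto simp: s_def)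
    have hpp: "mentry h p p \<noteq> 0" unfolding h_def using \<gamma>(3) diag p by simp
    have low: "mentry h a b = 0" if "a \<in> {1..2*r}" "b \<in> {1..p - 1}" "b < a" for a b
      using \<gamma>(2) that unfolding cols_upper_def h_def by blast
    have ps: "p \<in> {1..2*r}" "s \<in> {1..2*r}" using p s by auto
    define s' where "s' = 2 * r + 1 - s"
    have s': "p \<le> s'" "s' \<in> {1..2*r}" using s p by (auto simp: s'_def)
    have E: "mentry (root_elt r s p u * h) a b = mentry h a b + (if a = s then u * mentry h p b else 0)
        + (if a = 2 * r + 1 - p then e * mentry h s' b else 0)"
      if "a \<in> {1..2*r}" "b \<in> {1..2*r}" for a b
      using mentry_root_elt_mult[OF ps hc that, of u] unfolding e_def s'_def by simp
    have "root_elt r s p u * \<gamma> \<in> y_group r"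
      using s p \<gamma>(1) by (intro y_group_mult root_elt_in_y_group) auto
    moreover have eq: "root_elt r s p u * \<gamma> * g = root_elt r s p u * h"
      unfolding h_def by (rule assoc_mult_mat[OF root_elt_carrier \<gamma>c gc])
    have "cols_upper r (root_elt r s p u * h) (p - 1)"
      unfolding cols_upper_def
    proof (intro allI impI)
      fix a b assume ab: "b \<in> {1..p - 1}" "a \<in> {1..2*r}" "b < a"
      then have b: "b \<in> {1..2*r}" "b < p" "b < s'" using p s' by auto
      show "mentry (root_elt r s p u * h) a b = 0"
        unfolding E[OF ab(2) b(1)] using low[OF ab(2,1,3)] low[OF ps(1) ab(1) b(2)] low[OF s'(2) ab(1) b(3)] by simp
    qed
    moreover have "mentry (root_elt r s p u * h) a a = mentry g a a" if a: "a \<in> {1..p}" for a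
    proof -
      have "a \<in> {1..2*r}" "a \<noteq> s" "a \<noteq> 2 * r + 1 - p" using a p s by auto
      then show ?thesis using E[of a a] \<gamma>(3)[OF a] by (simp add: h_def)
    qed
    moreover have "mentry (root_elt r s p u * h) a p = 0" if a: "a \<in> {p<..s}" for a
    proof (cases "a = s")
      case True
      \<comment> \<open>Row \<open>s\<close> is the mirror row only at the last elimination, which
        uses a long root, so the second summand does not interfere.\<close>
      then have "e = 0" if "a = 2 * r + 1 - p" using that s p by (auto simp: e_def)
      then show ?thesis using True E[OF ps(2,1)] hpp by (auto simp: u_def)
    next
      case False
      then have "a \<in> {p<..q}" "a \<in> {1..2*r}" "a \<noteq> 2 * r + 1 - p" using a s p by (auto simp: s_def)
      then show ?thesis using E[of a p] ps False \<gamma>(4) by (simp add: h_def)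
    qed
    ultimately show ?case unfolding eq[symmetric] unfolding s_def by blast
  qed
  have le: "p \<le> 2 * r + 1 - p" using p by auto
  obtain \<gamma> where \<gamma>: "\<gamma> \<in> y_group r" "cols_upper r (\<gamma> * g) (p - 1)"
      "\<And>a. a \<in> {1..p} \<Longrightarrow> mentry (\<gamma> * g) a a = mentry g a a"
      "\<And>a. a \<in> {p<..2 * r + 1 - p} \<Longrightarrow> mentry (\<gamma> * g) a p = 0"
    using step[OF le order.refl] by blast
  have "\<gamma> * g \<in> carrier (Sp r)" using \<gamma>(1) y_group_Sp g by (intro Sp_mult_closed) auto
  have "mentry (\<gamma> * g) a p = 0" if a: "p < a" "a \<in> {1..2*r}" for a
  proof (cases "a \<le> 2 * r + 1 - p")
    case True
    then show ?thesis using \<gamma>(4) a by simp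
  next
    case False
    then have "2 * r + 1 - a \<in> {1..p - 1}" "2 * r + 1 - a + p < 2 * r + 1" "2 * r + 1 - (2 * r + 1 - a) = a"
      using a p by auto
    moreover have "mentry (\<gamma> * g) x x \<noteq> 0" if "x \<in> {1..p - 1}" for x
    proof -
      have "x \<in> {1..p}" using that by auto
      then show ?thesis using \<gamma>(3) diag by simp
    qed
    ultimately show ?thesis
      using symplectic_zero_entries[OF \<open>\<gamma> * g \<in> carrier (Sp r)\<close> \<gamma>(2), of "2 * r + 1 - a" p] p
      by auto
  qed
  then have "cols_upper r (\<gamma> * g) p"
    using \<gamma>(2) unfolding cols_upper_def
    by (metis Suc_pred' atLeastAtMost_iff le_SucE less_eq_Suc_le One_nat_def p)
  then show ?thesis using \<gamma>(1,3) by blast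
qed

text \<open>A position below the diagonal in the right half lies in the mirror row of one of the
  first \<open>r\<close> columns; pairing with that column makes it zero.\<close>

lemma cols_upper_complete:
  assumes "g \<in> carrier (Sp r)" "cols_upper r g r" "\<And>a. a \<in> {1..r} \<Longrightarrow> mentry g a a \<noteq> 0"
  shows "cols_upper r g (2 * r)"
  unfolding cols_upper_def
proof (intro allI impI)
  fix a b assume ab: "b \<in> {1..2*r}" "a \<in> {1..2*r}" "b < a"
  show "mentry g a b = 0"
  proof (cases "b \<le> r")
    case True
    then show ?thesis using assms(2) ab unfolding cols_upper_def by auto
  next
    case False
    then have "2 * r + 1 - a \<in> {1..r}" "2 * r + 1 - a + b < 2 * r + 1" "2 * r + 1 - (2 * r + 1 - a) = a" using ab by auto
    then show ?thesis using symplectic_zero_entries[OF assms(1-3), of "2 * r + 1 - a" b] ab by auto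
  qed
qed

lemma y_group_unip: "y_group r \<subseteq> unip True r"
proof
  fix \<gamma> assume "\<gamma> \<in> y_group r"
  moreover have y: "y_sub r i t \<in> unip True r" if "i \<in> {1..r}" for i t
    using that by (auto simp: unip_def tri_def y_sub_Sp mentry_y_sub)
  ultimately show "\<gamma> \<in> unip True r"
    unfolding y_group_def
  proof (induction \<gamma> rule: generate.induct)
    case (inv h)
    then show ?case using sp_inv_unip[OF y] by (auto simp: inv_Sp y_sub_Sp)
  next
    case (eng g h)
    then show ?case by (simp add: unip_mult)
  qed (auto simp: one_unip)
qed

section \<open>Leading minors under elimination\<close>

definition lead :: "complex mat \<Rightarrow> nat \<Rightarrow> complex" where
  "lead g d = minor (mentry g) (path_start d) (path_start d)"

lemma path_start_simps: "length (path_start d) = d" "i < d \<Longrightarrow> path_start d ! i = Suc i" "set (path_start d) = {1..d}"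
  by (auto simp: path_start_def simp del: upt_Suc)

lemma incl_initial: "incl {1..d} d = {path_start d}"
proof -
  have "K = path_start d" if "K \<in> incl {1..d} d" for K
  proof (rule incl_eqI[OF that path_start_incl[OF order.refl]])
    have "distinct K" "length K = d" "set K \<subseteq> {1..d}" using that by (auto simp: incl_def strict_sorted_iff)
    then have "set K = {1..d}" by (intro card_subset_eq) (auto simp: distinct_card)
    then show "set K = set (path_start d)" by (simp add: path_start_simps)
  qed
  then show ?thesis using path_start_incl[OF order.refl] by auto
qed

lemma minor_lower_triangular:
  fixes g :: "nat \<Rightarrow> nat \<Rightarrow> 'a::idom"
  assumes "\<And>a b. a \<in> {1..d} \<Longrightarrow> b \<in> {1..d} \<Longrightarrow> a < b \<Longrightarrow> g a b = 0"
  shows "minor g (path_start d) (path_start d) = (\<Prod>a\<in>{1..d}. g a a)"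
proof -
  have "minor g (path_start d) (path_start d) = (\<Prod>i\<in>{0..<d}. g (Suc i) (Suc i))"
    unfolding minor_def using assms
    by (subst det_lower_triangular[of d]) (auto simp: path_start_simps prod_list_diag_prod)
  also have "\<dots> = (\<Prod>a\<in>{1..d}. g a a)"
    by (rule prod.reindex_bij_witness[of _ "\<lambda>a. a - 1" Suc]) auto
  finally show ?thesis .
qed

lemma minor_swap: "length A = length B \<Longrightarrow> minor g B A = minor (\<lambda>a b. g b a) A B"
  unfolding minor_def by (subst det_transpose[symmetric, of _ "length B"]) (auto intro!: arg_cong[of _ _ det] eq_matI)

lemma minor_upper_triangular:
  fixes g :: "nat \<Rightarrow> nat \<Rightarrow> 'a::idom"
  assumes "\<And>a b. a \<in> {1..d} \<Longrightarrow> b \<in> {1..d} \<Longrightarrow> b < a \<Longrightarrow> g a b = 0"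
  shows "minor g (path_start d) (path_start d) = (\<Prod>a\<in>{1..d}. g a a)"
  using minor_lower_triangular[of d "\<lambda>a b. g b a"] assms minor_swap[of "path_start d" "path_start d" g] by simp

lemma lead_unip: assumes u: "u \<in> unip True r" and d: "d \<le> 2 * r" shows "lead u d = 1"
proof -
  have "lead u d = (\<Prod>a\<in>{1..d}. mentry u a a)"
    unfolding lead_def using triD[OF unipD(3)[OF u]] d by (intro minor_lower_triangular) auto
  also have "\<dots> = 1" using unipD(4)[OF u] d by (intro prod.neutral) auto
  finally show ?thesis .
qed

text \<open>The first \<open>d\<close> rows of a lower triangular matrix vanish beyond column
  \<open>d\<close>, so Cauchy-Binet leaves a single term, and its other factor is 1.\<close>

lemma lead_lower_mult:
  assumes \<gamma>: "\<gamma> \<in> unip True r" and g: "g \<in> carrier_mat (2*r) (2*r)" and d: "d \<le> 2 * r"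
  shows "lead (\<gamma> * g) d = lead g d"
proof -
  note \<gamma>D = unipD[OF \<gamma>]
  have "lead (\<gamma> * g) d = minor (\<lambda>a b. \<Sum>c\<in>{1..d}. mentry \<gamma> a c * mentry g c b) (path_start d) (path_start d)"
    unfolding lead_def
  proof (rule minor_cong)
    fix a b assume "a \<in> set (path_start d)" "b \<in> set (path_start d)"
    then have ab: "a \<in> {1..2*r}" "b \<in> {1..2*r}" "a \<le> d" using d by (auto simp: path_start_simps)
    have "mentry (\<gamma> * g) a b = (\<Sum>c\<in>{1..2*r}. mentry \<gamma> a c * mentry g c b)"
      using \<gamma>D(2) g ab by (intro mentry_mult)
    also have "\<dots> = (\<Sum>c\<in>{1..d}. mentry \<gamma> a c * mentry g c b)"
      using ab d triD[OF \<gamma>D(3)] by (intro sum.mono_neutral_right) auto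
    finally show "mentry (\<gamma> * g) a b = (\<Sum>c\<in>{1..d}. mentry \<gamma> a c * mentry g c b)" .
  qed simp
  also have "\<dots> = lead \<gamma> d * lead g d"
    by (subst Cauchy_Binet[of _ _ d], simp_all only: finite_atLeastAtMost path_start_simps incl_initial)
      (simp add: lead_def)
  also have "lead \<gamma> d = 1"
    by (rule lead_unip[OF \<gamma> d])
  finally show ?thesis by simp
qed

text \<open>Elimination preserves leading minors. After \<open>k\<close> cleared columns the next
  one is the product of the diagonal entries, so the next pivot is nonzero.\<close>

lemma y_group_eliminate:
  assumes g: "g \<in> carrier (Sp r)" and lead: "\<And>d. d \<in> {1..r} \<Longrightarrow> lead g d \<noteq> 0"
  shows "\<exists>\<gamma>\<in>y_group r. cols_upper r (\<gamma> * g) (2 * r)"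
proof -
  note gc = Sp_carrier_mat[OF g]
  have "\<exists>\<gamma>\<in>y_group r. cols_upper r (\<gamma> * g) k \<and> (\<forall>a\<in>{1..k}. mentry (\<gamma> * g) a a \<noteq> 0)" if "k \<le> r" for k
    using that
  proof (induction k)
    case 0
    then show ?case using one_in_y_group by (intro bexI[of _ "1\<^sub>m (2*r)"]) (auto simp: cols_upper_def)
  next
    case (Suc k)
    then obtain \<gamma> where \<gamma>: "\<gamma> \<in> y_group r" "cols_upper r (\<gamma> * g) k" "\<And>a. a \<in> {1..k} \<Longrightarrow> mentry (\<gamma> * g) a a \<noteq> 0"
      by auto
    have \<gamma>S: "\<gamma> \<in> carrier (Sp r)" using \<gamma>(1) y_group_Sp by blast
    note \<gamma>c = Sp_carrier_mat[OF \<gamma>S]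
    have hS: "\<gamma> * g \<in> carrier (Sp r)" by (rule Sp_mult_closed[OF \<gamma>S g])
    have "lead g (Suc k) = lead (\<gamma> * g) (Suc k)"
      using lead_lower_mult[OF subsetD[OF y_group_unip \<gamma>(1)] gc, of "Suc k"] Suc.prems by simp
    also have "\<dots> = (\<Prod>a\<in>{1..Suc k}. mentry (\<gamma> * g) a a)"
      unfolding lead_def
    proof (rule minor_upper_triangular)
      fix a b assume "a \<in> {1..Suc k}" "b \<in> {1..Suc k}" "b < a"
      then show "mentry (\<gamma> * g) a b = 0" using \<gamma>(2) Suc.prems unfolding cols_upper_def by auto
    qed
    finally have "(\<Prod>a\<in>{1..Suc k}. mentry (\<gamma> * g) a a) \<noteq> 0"
      using lead[of "Suc k"] Suc.prems by simp
    then have diag: "mentry (\<gamma> * g) a a \<noteq> 0" if "a \<in> {1..Suc k}" for a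
      using that unfolding prod_zero_iff[OF finite_atLeastAtMost] by blast
    obtain \<delta> where \<delta>: "\<delta> \<in> y_group r" "cols_upper r (\<delta> * (\<gamma> * g)) (Suc k)"
        "\<And>a. a \<in> {1..Suc k} \<Longrightarrow> mentry (\<delta> * (\<gamma> * g)) a a = mentry (\<gamma> * g) a a"
      using clear_column[OF hS, of "Suc k"] Suc.prems \<gamma>(2) diag by auto
    have "\<delta> \<in> carrier_mat (2*r) (2*r)" using \<delta>(1) y_group_Sp Sp_carrier_mat by blast
    then have eq: "\<delta> * (\<gamma> * g) = \<delta> * \<gamma> * g" using \<gamma>c gc by simp
    show ?case using \<delta> diag y_group_mult[OF \<delta>(1) \<gamma>(1)] unfolding eq by (intro bexI[of _ "\<delta> * \<gamma>"]) auto
  qed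
  from this[OF order.refl] obtain \<gamma> where \<gamma>: "\<gamma> \<in> y_group r" "cols_upper r (\<gamma> * g) r"
     "\<And>a. a \<in> {1..r} \<Longrightarrow> mentry (\<gamma> * g) a a \<noteq> 0" by auto
  moreover have "\<gamma> * g \<in> carrier (Sp r)" using \<gamma>(1) y_group_Sp g by (intro Sp_mult_closed) auto
  ultimately show ?thesis using cols_upper_complete by blast
qed

section \<open>Regular functions and unipotent subgroups\<close>

lemma poly_fun_mentry: "a \<in> {1..n} \<Longrightarrow> b \<in> {1..n} \<Longrightarrow> (\<lambda>x. mentry x a b) \<in> poly_fun n"
  unfolding mentry_def by (rule poly_fun.entry) auto

lemma poly_fun_minus: "f \<in> poly_fun n \<Longrightarrow> g \<in> poly_fun n \<Longrightarrow> (\<lambda>x. f x - g x) \<in> poly_fun n"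
  using poly_fun.add[OF _ poly_fun.mult[OF poly_fun.const[of "-1"]], of f n g] by simp

lemma poly_fun_sum: "(\<And>i. i \<in> I \<Longrightarrow> f i \<in> poly_fun n) \<Longrightarrow> (\<lambda>x. \<Sum>i\<in>I. f i x) \<in> poly_fun n"
  by (induction I rule: infinite_finite_induct) (auto intro: poly_fun.intros)

lemma poly_fun_prod: "(\<And>i. i \<in> I \<Longrightarrow> f i \<in> poly_fun n) \<Longrightarrow> (\<lambda>x. \<Prod>i\<in>I. f i x) \<in> poly_fun n"
  by (induction I rule: infinite_finite_induct) (auto intro: poly_fun.intros)

lemma poly_fun_compose:
  assumes "f \<in> poly_fun n" "\<And>i j. i < n \<Longrightarrow> j < n \<Longrightarrow> (\<lambda>x. \<phi> x $$ (i, j)) \<in> poly_fun n"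
  shows "(\<lambda>x. f (\<phi> x)) \<in> poly_fun n"
  using assms(1) by induction (auto intro: poly_fun.intros assms(2))

lemma poly_fun_minor:
  assumes "length A = length B" "set B \<subseteq> {1..n}" "set A \<subseteq> {1..n}"
  shows "(\<lambda>x. minor (mentry x) B A) \<in> poly_fun n"
proof -
  let ?d = "length B"
  have eq: "minor (mentry x) B A = (\<Sum>p\<in>{p. p permutes {0..<?d}}. signof p * (\<Prod>i = 0..<?d. mentry x (B ! i) (A ! p i)))"
    for x :: "complex mat"
    unfolding minor_def by (subst det_def') (auto intro!: sum.cong prod.cong simp: permutes_in_image)
  have "p i < ?d" if "p permutes {0..<?d}" "i < ?d" for p i
    using permutes_in_image[OF that(1), of i] that(2) by simp
  then show ?thesis unfolding eq using assms
    by (intro poly_fun_sum poly_fun.mult poly_fun_prod poly_fun.const poly_fun_mentry) (auto simp: subset_iff)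
qed

text \<open>Irreducibility arguments only use polynomial curves, on which a regular function is a polynomial.\<close>

definition poly_curve :: "nat \<Rightarrow> (complex \<Rightarrow> complex mat) \<Rightarrow> bool" where
  "poly_curve n c \<longleftrightarrow> (\<forall>t. c t \<in> carrier_mat n n) \<and> (\<forall>i<n. \<forall>j<n. \<exists>P. \<forall>t. c t $$ (i, j) = poly P t)"

lemma poly_fun_on_curve:
  assumes "f \<in> poly_fun n" "poly_curve n c"
  shows "\<exists>P. \<forall>t. f (c t) = poly P t"
  using assms(1)
proof induction
  case (const a)
  show ?case by (rule exI[of _ "[:a:]"]) simp
next
  case (entry i j)
  then show ?case using assms(2) by (simp add: poly_curve_def)
next
  case (add f g)
  then obtain P Q where "\<forall>t. f (c t) = poly P t" "\<forall>t. g (c t) = poly Q t" by blast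
  then show ?case by (intro exI[of _ "P + Q"]) simp
next
  case (mult f g)
  then obtain P Q where "\<forall>t. f (c t) = poly P t" "\<forall>t. g (c t) = poly Q t" by blast
  then show ?case by (intro exI[of _ "P * Q"]) simp
qed

lemma poly_fun_zero_on_curve:
  assumes "f \<in> poly_fun n" "poly_curve n c" "infinite {t. f (c t) = 0}"
  shows "f (c t) = 0"
proof -
  obtain P where P: "\<And>t. f (c t) = poly P t" using poly_fun_on_curve[OF assms(1,2)] by blast
  then have "P = 0" using assms(3) poly_roots_finite[of P] by auto
  then show ?thesis using P by simp
qed

text \<open>A single defining polynomial that is not identically zero on the curve has only finitely
  many roots.\<close>

lemma closed_on_curve:
  assumes "zariski_closed n C" "poly_curve n c"
  shows "finite {t. c t \<in> C} \<or> (\<forall>t. c t \<in> C)"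
proof -
  obtain F where F: "F \<subseteq> poly_fun n" "C = {x \<in> carrier_mat n n. \<forall>f\<in>F. f x = 0}"
    using assms(1) unfolding zariski_closed_def by blast
  have cc: "c t \<in> carrier_mat n n" for t using assms(2) by (simp add: poly_curve_def)
  show ?thesis
  proof (cases "\<forall>f\<in>F. infinite {t. f (c t) = 0}")
    case True
    then have "\<forall>t. c t \<in> C" using F cc poly_fun_zero_on_curve[OF _ assms(2)] by blast
    then show ?thesis by blast
  next
    case False
    then obtain f where f: "f \<in> F" "finite {t. f (c t) = 0}" by blast
    then have "{t. c t \<in> C} \<subseteq> {t. f (c t) = 0}" using F by blast
    then show ?thesis using f finite_subset by blast
  qed
qed

text \<open>Of two closed sets covering a polynomial curve one contains infinitely many parameters,
  hence the whole curve. A separation of \<open>U\<close> would therefore split a curve joining two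
  points that it separates.\<close>

lemma connected_by_curves:
  assumes base: "b \<in> U"
    and curves: "\<And>u. u \<in> U \<Longrightarrow> \<exists>c. poly_curve n c \<and> (\<forall>t. c t \<in> U) \<and> c 0 = b \<and> c 1 = u"
  shows "zariski_connected n U"
proof -
  have no: "False" if cl: "zariski_closed n C" "zariski_closed n D" and cov: "U \<subseteq> C \<union> D" "C \<inter> D \<inter> U = {}"
    and bC: "b \<in> C" and u: "u \<in> D" "u \<in> U" for C D u
  proof -
    obtain c where c: "poly_curve n c" "\<And>t. c t \<in> U" "c 0 = b" "c 1 = u" using curves[OF u(2)] by blast
    have "UNIV = {t. c t \<in> C} \<union> {t. c t \<in> D}" using c(2) cov(1) by blast
    then have "\<not> (finite {t. c t \<in> C} \<and> finite {t. c t \<in> D})"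
      by (metis finite_UnI infinite_UNIV_char_0)
    then have "(\<forall>t. c t \<in> C) \<or> (\<forall>t. c t \<in> D)"
      using closed_on_curve[OF cl(1) c(1)] closed_on_curve[OF cl(2) c(1)] by blast
    then show False using c(2-4) cov(2) bC u by blast
  qed
  show ?thesis unfolding zariski_connected_def
  proof
    assume "\<exists>C D. zariski_closed n C \<and> zariski_closed n D \<and> U \<subseteq> C \<union> D \<and> C \<inter> D \<inter> U = {} \<and>
          C \<inter> U \<noteq> {} \<and> D \<inter> U \<noteq> {}"
    then obtain C D u v where CD: "zariski_closed n C" "zariski_closed n D" "U \<subseteq> C \<union> D" "C \<inter> D \<inter> U = {}"
      "u \<in> C" "u \<in> U" "v \<in> D" "v \<in> U" by blast
    show False
    proof (cases "b \<in> C")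
      case True
      then show False using no[OF CD(1-4) True CD(7,8)] by simp
    next
      case False
      then have "b \<in> D" using base CD(3) by blast
      then show False using no[OF CD(2,1) _ _ _ CD(5,6)] CD(3,4) by blast
    qed
  qed
qed

lemma unip_closed: "zariski_closed (2*r) (unip lo r)"
proof -
  let ?R = "{1..2*r}"
  define eqs :: "(complex mat \<Rightarrow> complex) set" where
    "eqs = (\<Union>a\<in>?R. \<Union>b\<in>?R. {\<lambda>x. sp_pair r (\<lambda>c. mentry x c a) (\<lambda>c. mentry x c b)
      - (if a + b = 2 * r + 1 then (-1) ^ (a + 1) else 0)})"
  define teqs :: "(complex mat \<Rightarrow> complex) set" where
    "teqs = (\<Union>a\<in>?R. \<Union>b\<in>{b \<in> ?R. if lo then a < b else b < a}. {\<lambda>x. mentry x a b})"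
  define deqs :: "(complex mat \<Rightarrow> complex) set" where "deqs = (\<Union>a\<in>?R. {\<lambda>x. mentry x a a - 1})"
  have pair: "(\<lambda>x. sp_pair r (\<lambda>c. mentry x c a) (\<lambda>c. mentry x c b)) \<in> poly_fun (2*r)"
    if "a \<in> ?R" "b \<in> ?R" for a b
    unfolding sp_pair_def
  proof (rule poly_fun_sum)
    fix c assume c: "c \<in> ?R"
    then have "2 * r + 1 - c \<in> ?R" by auto
    then show "(\<lambda>x. (-1) ^ (c + 1) * mentry x c a * mentry x (2 * r + 1 - c) b) \<in> poly_fun (2*r)"
      using c that by (intro poly_fun.mult poly_fun.const poly_fun_mentry)
  qed
  have "\<forall>f\<in>eqs. f \<in> poly_fun (2*r)"
    unfolding eqs_def ball_UN by (simp only: ball_simps) (intro ballI conjI TrueI poly_fun_minus pair poly_fun.const)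
  moreover have "\<forall>f\<in>teqs. f \<in> poly_fun (2*r)"
    unfolding teqs_def ball_UN by (simp only: ball_simps) (auto intro: poly_fun_mentry)
  moreover have "\<forall>f\<in>deqs. f \<in> poly_fun (2*r)"
    unfolding deqs_def ball_UN by (simp only: ball_simps) (intro ballI conjI TrueI poly_fun_minus poly_fun.const poly_fun_mentry)
  moreover have "unip lo r = {x \<in> carrier_mat (2*r) (2*r). \<forall>f\<in>eqs \<union> teqs \<union> deqs. f x = 0}"
  proof -
    have e: "(\<forall>f\<in>eqs. f x = 0) \<longleftrightarrow> (\<forall>a\<in>?R. \<forall>b\<in>?R. sp_pair r (\<lambda>c. mentry x c a) (\<lambda>c. mentry x c b)
        = (if a + b = 2 * r + 1 then (-1) ^ (a + 1) else 0))"
      "(\<forall>f\<in>teqs. f x = 0) \<longleftrightarrow> (\<forall>a\<in>?R. \<forall>b\<in>?R. (if lo then a < b else b < a) \<longrightarrow> mentry x a b = 0)"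
      "(\<forall>f\<in>deqs. f x = 0) \<longleftrightarrow> (\<forall>a\<in>?R. mentry x a a = 1)" for x
      unfolding eqs_def teqs_def deqs_def ball_UN
      by (simp_all only: ball_simps right_minus_eq) blast+
    have "x \<in> unip lo r \<longleftrightarrow> x \<in> carrier_mat (2*r) (2*r) \<and> (\<forall>f\<in>eqs. f x = 0) \<and> (\<forall>f\<in>teqs. f x = 0) \<and> (\<forall>f\<in>deqs. f x = 0)"
      for x
      unfolding unip_def Sp_iff tri_def mem_Collect_eq e by blast
    then show ?thesis by (auto simp only: ball_Un)
  qed
  ultimately show ?thesis unfolding zariski_closed_def by (intro exI[of _ "eqs \<union> teqs \<union> deqs"]) blast
qed

text \<open>Scaling entry \<open>(a, b)\<close> by the power \<open>|a - b|\<close> of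
  \<open>t\<close> is, for \<open>t \<noteq> 0\<close>, conjugation by a diagonal matrix of powers
  of \<open>t\<close>; it extends to \<open>t = 0\<close>, where \<open>u\<close> contracts to the
  identity.\<close>

lemma unip_connected: "zariski_connected (2*r) (unip lo r)"
proof (rule connected_by_curves[OF one_unip])
  fix u assume u: "u \<in> unip lo r"
  note uD = unipD[OF u]
  \<comment> \<open>The absolute difference: one of the two truncated subtractions is zero.\<close>
  define ex where "ex a b = (a - b) + (b - a)" for a b :: nat
  define c where "c t = mat (2*r) (2*r) (\<lambda>(i, j). t ^ ex (Suc i) (Suc j) * u $$ (i, j))" for t :: complex
  have cm: "c t \<in> carrier_mat (2*r) (2*r)" for t by (simp add: c_def)
  have ce: "mentry (c t) a b = t ^ ex a b * mentry u a b" if "a \<in> {1..2*r}" "b \<in> {1..2*r}" for t a b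
    using that by (auto simp: c_def mentry_def)
  have tri: "tri lo r (c t)" for t using uD(3) by (auto simp: tri_def ce)
  have "c t \<in> carrier (Sp r)" for t
    unfolding Sp_iff
  proof (intro conjI ballI cm)
    fix a b assume ab: "a \<in> {1..2*r}" "b \<in> {1..2*r}"
    let ?K = "ex (a + b) (2 * r + 1)"
    have "sp_pair r (\<lambda>d. mentry (c t) d a) (\<lambda>d. mentry (c t) d b) = t ^ ?K * sp_pair r (\<lambda>d. mentry u d a) (\<lambda>d. mentry u d b)"
      unfolding sp_pair_def sum_distrib_left
    proof (rule sum.cong[OF refl])
      fix d assume d: "d \<in> {1..2*r}"
      then have d': "2 * r + 1 - d \<in> {1..2*r}" by auto
      show "(-1) ^ (d + 1) * mentry (c t) d a * mentry (c t) (2 * r + 1 - d) b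
          = t ^ ?K * ((-1) ^ (d + 1) * mentry u d a * mentry u (2 * r + 1 - d) b)"
      proof (cases "mentry u d a = 0 \<or> mentry u (2 * r + 1 - d) b = 0")
        case True
        then show ?thesis using ce d d' ab by auto
      next
        case False
        \<comment> \<open>On nonzero terms of the pairing both index differences have the same sign,
          so the exponents add up to one that does not depend on \<open>d\<close>.\<close>
        then have "\<not> (if lo then d < a else a < d)" "\<not> (if lo then 2 * r + 1 - d < b else b < 2 * r + 1 - d)"
          using triD[OF uD(3)] d d' ab by blast+
        then have "ex d a + ex (2 * r + 1 - d) b = ?K" using d by (cases lo) (auto simp: ex_def)
        then show ?thesis using ce[OF d ab(1)] ce[OF d' ab(2)] by (simp add: power_add[symmetric] mult_ac)
      qed
    qed
    also have "\<dots> = (if a + b = 2 * r + 1 then (-1) ^ (a + 1) else 0)"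
      unfolding Sp_pair[OF uD(1) ab] by (simp add: ex_def)
    finally show "sp_pair r (\<lambda>d. mentry (c t) d a) (\<lambda>d. mentry (c t) d b) = (if a + b = 2 * r + 1 then (-1) ^ (a + 1) else 0)" .
  qed
  then have cU: "c t \<in> unip lo r" for t
    using tri uD(4) by (simp add: unip_def ce ex_def)
  have "poly_curve (2*r) c" unfolding poly_curve_def
  proof (intro conjI allI impI cm)
    fix i j assume "i < 2 * r" "j < 2 * r"
    then have "\<forall>t. c t $$ (i, j) = poly (monom (u $$ (i, j)) (ex (Suc i) (Suc j))) t"
      by (simp add: c_def poly_monom mult.commute)
    then show "\<exists>P. \<forall>t. c t $$ (i, j) = poly P t" by blast
  qed
  moreover have "c 0 = 1\<^sub>m (2*r)"
  proof (rule mat_eqI_mentry[OF cm])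
    fix a b assume ab: "a \<in> {1..2*r}" "b \<in> {1..2*r}"
    then show "mentry (c 0) a b = mentry (1\<^sub>m (2*r)) a b"
      using uD(4) by (auto simp: ce mentry_one ex_def)
  qed simp
  moreover have "c 1 = u"
    by (rule mat_eqI_mentry[OF cm uD(2)]) (simp add: ce)
  ultimately show "\<exists>c. poly_curve (2*r) c \<and> (\<forall>t. c t \<in> unip lo r) \<and> c 0 = 1\<^sub>m (2*r) \<and> c 1 = u"
    using cU by blast
qed

section \<open>Borel subgroups and their unipotent radicals\<close>

lemma y_group_subgroup: "subgroup (y_group r) (Sp r)"
  unfolding y_group_def by (rule group.generate_is_subgroup[OF group_Sp]) (auto intro: y_sub_Sp)

text \<open>Elimination leaves a matrix that is lower unitriangular and upper triangular at once,
  hence the identity, so \<open>u\<close> is the inverse of the eliminating element.\<close>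

lemma unip_lower_in_y_group: assumes u: "u \<in> unip True r" shows "u \<in> y_group r"
proof -
  note uD = unipD[OF u]
  have "lead u d \<noteq> 0" if "d \<in> {1..r}" for d using lead_unip[OF u, of d] that by simp
  then obtain \<gamma> where \<gamma>: "\<gamma> \<in> y_group r" "cols_upper r (\<gamma> * u) (2 * r)"
    using y_group_eliminate[OF uD(1)] by blast
  have \<gamma>S: "\<gamma> \<in> carrier (Sp r)" using \<gamma>(1) y_group_Sp by blast
  have \<gamma>u: "\<gamma> * u \<in> carrier_mat (2*r) (2*r)" using mult_carrier_mat[OF Sp_carrier_mat[OF \<gamma>S] uD(2)] .
  have \<gamma>uU: "\<gamma> * u \<in> unip True r" using unip_mult[OF subsetD[OF y_group_unip \<gamma>(1)] u] .
  have "\<gamma> * u = 1\<^sub>m (2*r)"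
  proof (rule mat_eqI_mentry[OF \<gamma>u])
    fix a b assume ab: "a \<in> {1..2*r}" "b \<in> {1..2*r}"
    show "mentry (\<gamma> * u) a b = mentry (1\<^sub>m (2*r)) a b"
    proof (cases a b rule: linorder_cases)
      case less
      then show ?thesis using triD[OF unipD(3)[OF \<gamma>uU] ab] ab by (simp add: mentry_one)
    next
      case equal
      then show ?thesis using unipD(4)[OF \<gamma>uU ab(1)] ab by (simp add: mentry_one)
    next
      case greater
      then show ?thesis using \<gamma>(2) ab unfolding cols_upper_def by (simp add: mentry_one)
    qed
  qed simp
  moreover have "sp_inv r \<gamma> * (\<gamma> * u) = u"
    using sp_inv_left[OF \<gamma>S] Sp_carrier_mat[OF \<gamma>S] sp_inv_carrier[OF Sp_carrier_mat[OF \<gamma>S]] uD(2)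
    by (simp add: assoc_mult_mat[of _ "2*r" "2*r" _ "2*r" _ "2*r", symmetric])
  ultimately have "u = sp_inv r \<gamma>" using sp_inv_carrier[OF Sp_carrier_mat[OF \<gamma>S]] by simp
  then show ?thesis
    using subgroup.m_inv_closed[OF y_group_subgroup \<gamma>(1)] inv_Sp[OF \<gamma>S] by simp
qed

lemma transpose_inv_Sp:
  assumes "g \<in> carrier (Sp r)"
  shows "transpose_mat (inv\<^bsub>Sp r\<^esub> g) = inv\<^bsub>Sp r\<^esub> (transpose_mat g)"
proof -
  have "transpose_mat (sp_inv r g) * transpose_mat g = transpose_mat (g * sp_inv r g)"
    by (rule transpose_mult[symmetric, OF Sp_carrier_mat sp_inv_carrier]) (use assms Sp_carrier_mat in auto)
  then have "inv\<^bsub>Sp r\<^esub> (transpose_mat g) = transpose_mat (sp_inv r g)"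
    using assms by (intro group.inv_equality[OF group_Sp]) (auto simp: sp_inv_right transpose_Sp sp_inv_Sp)
  then show ?thesis using inv_Sp[OF assms] by simp
qed

text \<open>Transposition reverses products but preserves generated subgroups; this carries the
  generation result from the lower to the upper unitriangular group.\<close>

lemma transpose_generate:
  assumes H: "H \<subseteq> carrier (Sp r)" and g: "g \<in> generate (Sp r) H"
  shows "transpose_mat g \<in> generate (Sp r) (transpose_mat ` H)"
  using g
proof induction
  case one
  then show ?case using generate.one[of "Sp r"] by simp
next
  case (incl h)
  then show ?case by (intro generate.incl) blast
next
  case (inv h)
  then show ?case using transpose_inv_Sp[of h r] H generate.inv[of "transpose_mat h" "transpose_mat ` H" "Sp r"] by auto
next
  case (eng g h)
  have "g \<in> carrier (Sp r)" "h \<in> carrier (Sp r)"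
    using eng group.generate_in_carrier[OF group_Sp H] by auto
  then have "transpose_mat (g * h) = transpose_mat h * transpose_mat g"
    by (intro transpose_mult[of _ "2*r" "2*r" _ "2*r"] Sp_carrier_mat)
  then show ?case using generate.eng[OF eng.IH(2,1)] by simp
qed

lemma torus_Sp: "torus r \<subseteq> carrier (Sp r)"
  by (auto simp: torus_def)

lemma torus_offdiag: "h \<in> torus r \<Longrightarrow> a \<in> {1..2*r} \<Longrightarrow> b \<in> {1..2*r} \<Longrightarrow> a \<noteq> b \<Longrightarrow> mentry h a b = 0"
  using Sp_carrier_mat[of h r] by (auto simp: torus_def diagonal_mat_def mentry_def)

lemma torusI:
  assumes "h \<in> carrier (Sp r)" "\<And>a b. a \<in> {1..2*r} \<Longrightarrow> b \<in> {1..2*r} \<Longrightarrow> a \<noteq> b \<Longrightarrow> mentry h a b = 0"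
  shows "h \<in> torus r"
proof -
  have "h $$ (i, j) = 0" if "i < 2 * r" "j < 2 * r" "i \<noteq> j" for i j
    using assms(2)[of "Suc i" "Suc j"] that by (simp add: mentry_def)
  then show ?thesis using assms(1) Sp_carrier_mat[OF assms(1)] by (auto simp: torus_def diagonal_mat_def)
qed

lemma torus_tri: "h \<in> torus r \<Longrightarrow> tri lo r h"
  unfolding tri_def using torus_offdiag by (metis less_irrefl)

definition borel :: "bool \<Rightarrow> nat \<Rightarrow> complex mat set" where
  "borel lo r = (if lo then borel_neg r else borel_pos r)"

lemma x_sub_eq_transpose: "i \<in> {1..r} \<Longrightarrow> x_sub r i t = transpose_mat (y_sub r i t)"
  by (simp add: y_sub_eq)

lemma borel_subgroup: "subgroup (borel lo r) (Sp r)"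
  unfolding borel_def borel_neg_def borel_pos_def using torus_Sp[of r]
  by (auto intro!: group.generate_is_subgroup[OF group_Sp] x_sub_Sp y_sub_Sp)

lemma unip_in_borel: "unip lo r \<subseteq> borel lo r"
proof (cases lo)
  case True
  have "y_group r \<subseteq> borel_neg r"
    unfolding y_group_def borel_neg_def by (rule group.mono_generate[OF group_Sp]) blast
  then show ?thesis using True unip_lower_in_y_group by (auto simp: borel_def)
next
  case False
  show ?thesis
  proof
    fix u assume u: "u \<in> unip lo r"
    then have "transpose_mat u \<in> y_group r" using unip_transpose[OF u] False unip_lower_in_y_group by simp
    then have "transpose_mat (transpose_mat u) \<in> generate (Sp r) (transpose_mat ` {y_sub r i t | i t. i \<in> {1..r}})"
      unfolding y_group_def by (intro transpose_generate) (auto intro: y_sub_Sp)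
    moreover have sub: "transpose_mat ` {y_sub r i t | i t. i \<in> {1..r}} \<subseteq> torus r \<union> {x_sub r i t | i t. i \<in> {1..r}}"
    proof
      fix h assume "h \<in> transpose_mat ` {y_sub r i t | i t. i \<in> {1..r}}"
      then obtain i t where "i \<in> {1..r}" "h = transpose_mat (y_sub r i t)" by blast
      then have "h = x_sub r i t" using x_sub_eq_transpose by simp
      then show "h \<in> torus r \<union> {x_sub r i t | i t. i \<in> {1..r}}" using \<open>i \<in> {1..r}\<close> by blast
    qed
    ultimately have "transpose_mat (transpose_mat u) \<in> borel_pos r"
      unfolding borel_pos_def using group.mono_generate[OF group_Sp sub] by blast
    then show "u \<in> borel lo r" using False by (simp add: borel_def)
  qed
qed

lemma borel_tri: "g \<in> borel lo r \<Longrightarrow> tri lo r g"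
proof -
  have xy: "i \<in> {1..r} \<Longrightarrow> tri False r (x_sub r i t)" "i \<in> {1..r} \<Longrightarrow> tri True r (y_sub r i t)" for i t
    by (auto simp: tri_def mentry_x_sub mentry_y_sub)
  define H where "H = (if lo then torus r \<union> {y_sub r i t | i t. i \<in> {1..r}} else torus r \<union> {x_sub r i t | i t. i \<in> {1..r}})"
  have H: "H \<subseteq> carrier (Sp r)" using torus_Sp[of r] by (auto simp: H_def intro: x_sub_Sp y_sub_Sp)
  have tH: "tri lo r h" if "h \<in> H" for h
    using that xy torus_tri by (auto simp: H_def split: if_splits)
  have eq: "borel lo r = generate (Sp r) H"
    by (simp add: H_def borel_def borel_neg_def borel_pos_def)
  assume "g \<in> borel lo r"
  then show ?thesis unfolding eq
  proof induction
    case (inv h)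
    then have "h \<in> carrier (Sp r)" using H by blast
    then show ?case using inv tH tri_sp_inv[OF Sp_carrier_mat] inv_Sp by simp
  next
    case (eng g h)
    then have "g \<in> carrier (Sp r)" "h \<in> carrier (Sp r)"
      using group.generate_in_carrier[OF group_Sp H] by auto
    then show ?case using tri_mult(1)[OF Sp_carrier_mat Sp_carrier_mat] eng by simp
  qed (use tH tri_one in auto)
qed

lemma pow_strictly_triangular:
  assumes A: "A \<in> carrier_mat (2*r) (2*r)"
    and z: "\<And>a b. a \<in> {1..2*r} \<Longrightarrow> b \<in> {1..2*r} \<Longrightarrow> if lo then a < b + 1 else b < a + 1 \<Longrightarrow> mentry A a b = 0"
  shows "a \<in> {1..2*r} \<Longrightarrow> b \<in> {1..2*r} \<Longrightarrow> if lo then a < b + k else b < a + k \<Longrightarrow> mentry (A ^\<^sub>m k) a b = 0"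
proof (induction k arbitrary: a b)
  case 0
  then show ?case using A by (auto simp: mentry_one split: if_splits)
next
  case (Suc k)
  have Ak: "A ^\<^sub>m k \<in> carrier_mat (2*r) (2*r)" using A by simp
  have "mentry (A ^\<^sub>m Suc k) a b = (\<Sum>c\<in>{1..2*r}. mentry (A ^\<^sub>m k) a c * mentry A c b)"
    using mentry_mult[OF Ak A Suc.prems(1,2)] by simp
  also have "\<dots> = 0"
  proof (intro sum.neutral ballI)
    fix c assume c: "c \<in> {1..2*r}"
    have "(if lo then a < c + k else c < a + k) \<or> (if lo then c < b + 1 else b < c + 1)"
      using Suc.prems(3) by (cases lo) auto
    then show "mentry (A ^\<^sub>m k) a c * mentry A c b = 0"
      using Suc.IH[OF Suc.prems(1) c] z[OF c Suc.prems(2)] by (elim disjE) simp_all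
  qed
  finally show ?case .
qed

lemma unip_unipotent:
  assumes u: "u \<in> unip lo r" shows "unipotent_mat (2*r) u"
proof -
  note uD = unipD[OF u]
  let ?A = "u - 1\<^sub>m (2*r)"
  have A: "?A \<in> carrier_mat (2*r) (2*r)" by (rule minus_carrier_mat) simp
  have "mentry ?A a b = 0" if "a \<in> {1..2*r}" "b \<in> {1..2*r}" "if lo then a < b + 1 else b < a + 1" for a b
  proof -
    have "mentry ?A a b = mentry u a b - mentry (1\<^sub>m (2*r)) a b"
      using that uD(2) by (auto simp: mentry_def)
    then show ?thesis using that uD(4) triD[OF uD(3) that(1,2)]
      by (cases "a = b") (auto simp: mentry_one split: if_splits)
  qed
  note z = pow_strictly_triangular[OF A, of lo, OF this]
  have "?A ^\<^sub>m (2*r) = 0\<^sub>m (2*r) (2*r)"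
  proof (rule mat_eqI_mentry[of _ "2*r"])
    fix a b assume ab: "a \<in> {1..2*r}" "b \<in> {1..2*r}"
    show "mentry (?A ^\<^sub>m (2*r)) a b = mentry (0\<^sub>m (2*r) (2*r)) a b"
      using z[OF _ _ _ ab, of "2*r"] ab by (cases lo) (auto simp: mentry_def)
  qed (use A in auto)
  then show ?thesis unfolding unipotent_mat_def by blast
qed

text \<open>The diagonal of a power of the triangular matrix \<open>x - 1\<close> consists of powers
  of \<open>mentry x a a - 1\<close>, so nilpotency annihilates it.\<close>

lemma tri_unipotent_diag:
  assumes x: "x \<in> carrier_mat (2*r) (2*r)" "tri lo r x" "unipotent_mat (2*r) x" and a: "a \<in> {1..2*r}"
  shows "mentry x a a = 1"
proof -
  let ?A = "x - 1\<^sub>m (2*r)"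
  have A: "?A \<in> carrier_mat (2*r) (2*r)" by (rule minus_carrier_mat) simp
  have eA: "mentry ?A a b = mentry x a b - mentry (1\<^sub>m (2*r)) a b" if "a \<in> {1..2*r}" "b \<in> {1..2*r}" for a b
    using that x(1) by (auto simp: mentry_def)
  have tA: "tri lo r ?A" using x(2) by (auto simp: tri_def eA mentry_one)
  have "tri lo r (?A ^\<^sub>m k) \<and> mentry (?A ^\<^sub>m k) a a = (mentry x a a - 1) ^ k" for k
  proof (induction k)
    case 0
    then show ?case using a x(1) tri_one[of lo r] by (simp add: mentry_one)
  next
    case (Suc k)
    have "?A ^\<^sub>m k \<in> carrier_mat (2*r) (2*r)" using A by simp
    from tri_mult[OF this A _ tA] Suc a eA[OF a a] show ?case by (simp add: mentry_one)
  qed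
  moreover obtain k where "?A ^\<^sub>m k = 0\<^sub>m (2*r) (2*r)" using x(3) by (auto simp: unipotent_mat_def)
  moreover have "mentry (0\<^sub>m (2*r) (2*r)) a a = (0 :: complex)" using a by (auto simp: mentry_def)
  ultimately have "(mentry x a a - 1) ^ k = 0" by metis
  then show ?thesis by simp
qed

lemma unip_normal: "unip lo r \<lhd> (Sp r)\<lparr>carrier := borel lo r\<rparr>"
proof -
  let ?B = "(Sp r)\<lparr>carrier := borel lo r\<rparr>"
  have gB: "group ?B" by (rule group.subgroup_imp_group[OF group_Sp borel_subgroup])
  have BS: "x \<in> carrier (Sp r)" if "x \<in> borel lo r" for x
    using subgroup.subset[OF borel_subgroup] that by blast
  have invB: "inv\<^bsub>?B\<^esub> x = sp_inv r x" if "x \<in> borel lo r" for x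
    using group.m_inv_consistent[OF group_Sp borel_subgroup that] inv_Sp[OF BS[OF that]] by simp
  have "subgroup (unip lo r) ?B"
    using one_unip[of r lo] unip_in_borel[of lo r] invB
    by (intro group.subgroupI[OF gB]) (auto intro!: unip_mult sp_inv_unip simp: subset_iff)
  moreover have "x * u * sp_inv r x \<in> unip lo r" if "x \<in> borel lo r" "u \<in> unip lo r" for x u
    by (rule tri_conjugate_unip[OF BS[OF that(1)] borel_tri[OF that(1)] that(2)])
  ultimately show ?thesis
    using invB by (subst group.normal_inv_iff[OF gB]) auto
qed

text \<open>The unitriangular group is one of the subgroups in the union, and any member of the
  union lies inside it, since a unipotent triangular matrix has unit diagonal.\<close>

lemma unipotent_radical_borel: "unipotent_radical r (borel lo r) = unip lo r"
proof
  show "unip lo r \<subseteq> unipotent_radical r (borel lo r)"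
    unfolding unipotent_radical_def
    using unip_normal unip_closed unip_connected unip_unipotent by blast
  show "unipotent_radical r (borel lo r) \<subseteq> unip lo r"
  proof
    fix u assume "u \<in> unipotent_radical r (borel lo r)"
    then obtain U where U: "U \<lhd> (Sp r)\<lparr>carrier := borel lo r\<rparr>" "\<forall>u\<in>U. unipotent_mat (2*r) u" "u \<in> U"
      unfolding unipotent_radical_def by blast
    then have "u \<in> borel lo r" using normal_imp_subgroup[THEN subgroup.subset] by fastforce
    then have "u \<in> carrier (Sp r)" "tri lo r u"
      using subgroup.subset[OF borel_subgroup] borel_tri by blast+
    then show "u \<in> unip lo r"
      using tri_unipotent_diag[OF Sp_carrier_mat] U by (auto simp: unip_def)
  qed
qed

lemma N_eq: "N_neg r = unip True r" "N_pos r = unip False r"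
  using unipotent_radical_borel[of r True] unipotent_radical_borel[of r False]
  by (simp_all add: N_neg_def N_pos_def borel_def)

section \<open>The torus and the big cell\<close>

text \<open>The fundamental weight of index \<open>d\<close> as a character of the torus: it is the
  sum of the weights of the first \<open>d\<close> basis vectors.\<close>

definition dprod :: "complex mat \<Rightarrow> nat \<Rightarrow> complex" where
  "dprod h d = (\<Prod>a\<in>{1..d}. mentry h a a)"

lemma torus_diag:
  assumes "h \<in> torus r" "a \<in> {1..2*r}"
  shows "mentry h a a * mentry h (2 * r + 1 - a) (2 * r + 1 - a) = 1"
proof -
  have h: "h \<in> carrier (Sp r)" using assms torus_Sp by blast
  have "mentry h a b = (if a = b then mentry h a a else 0)" if "a \<in> {1..2*r}" "b \<in> {1..2*r}" for a b
    using torus_offdiag[OF assms(1) that] by simp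
  then show ?thesis using diagonal_Sp[OF Sp_carrier_mat[OF h], of "\<lambda>a. mentry h a a"] h assms(2) by blast
qed

lemma dprod_nonzero: "h \<in> torus r \<Longrightarrow> d \<le> 2 * r \<Longrightarrow> dprod h d \<noteq> 0"
  unfolding dprod_def using torus_diag[of h r] by (fastforce simp: prod_zero_iff)

lemma dprod_mult:
  assumes "g \<in> torus r" "h \<in> torus r" "d \<le> 2 * r"
  shows "dprod (g * h) d = dprod g d * dprod h d"
proof -
  have "mentry (g * h) a a = mentry g a a * mentry h a a" if "a \<in> {1..d}" for a
    using assms that torus_Sp Sp_carrier_mat torus_tri[of _ r True]
    by (intro tri_mult(2)[of g r h True]) auto
  then show ?thesis by (simp add: dprod_def prod.distrib)
qed

lemma torus_mult: "g \<in> torus r \<Longrightarrow> h \<in> torus r \<Longrightarrow> g * h \<in> torus r"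
proof -
  assume gh: "g \<in> torus r" "h \<in> torus r"
  then have S: "g \<in> carrier (Sp r)" "h \<in> carrier (Sp r)" using torus_Sp by blast+
  note c = Sp_carrier_mat[OF S(1)] Sp_carrier_mat[OF S(2)]
  have "tri lo r (g * h)" for lo using tri_mult(1)[OF c] gh torus_tri by blast
  then show ?thesis using triD[of True r "g * h"] triD[of False r "g * h"] Sp_mult_closed[OF S]
    by (intro torusI) (metis linorder_neqE_nat)+
qed

lemma torus_one: "1\<^sub>m (2*r) \<in> torus r"
  by (rule torusI) (auto simp: one_Sp mentry_one)

text \<open>Successive quotients of the \<open>dprod\<close> values give the first \<open>r\<close>
  diagonal entries; the others are inverses of their mirror entries.\<close>

lemma torus_eqI:
  assumes g: "g \<in> torus r" and h: "h \<in> torus r" and eq: "\<And>d. d \<in> {1..r} \<Longrightarrow> dprod g d = dprod h d"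
  shows "g = h"
proof -
  have S: "g \<in> carrier_mat (2*r) (2*r)" "h \<in> carrier_mat (2*r) (2*r)"
    using g h torus_Sp Sp_carrier_mat by blast+
  have low: "mentry g a a = mentry h a a" if a: "a \<in> {1..r}" for a
  proof -
    obtain d where d: "a = Suc d" using a by (cases a) auto
    have "dprod g d = dprod h d"
      using eq[of d] d a by (cases d) (auto simp: dprod_def)
    moreover have "dprod g (Suc d) = dprod g d * mentry g a a" "dprod h (Suc d) = dprod h d * mentry h a a"
      by (simp_all add: dprod_def d)
    moreover have "dprod h d \<noteq> 0" using dprod_nonzero[OF h] a d by simp
    ultimately show ?thesis using eq[OF a] d by simp
  qed
  have "mentry g a a = mentry h a a" if a: "a \<in> {1..2*r}" for a
  proof (cases "a \<le> r")
    case True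
    then show ?thesis using low a by simp
  next
    case False
    let ?a' = "2 * r + 1 - a"
    have "?a' \<in> {1..r}" using a False by auto
    from low[OF this] torus_diag[OF g a] torus_diag[OF h a] show ?thesis
      by (metis mult.commute mult_cancel_right mult_zero_left zero_neq_one)
  qed
  then show ?thesis using torus_offdiag[OF g] torus_offdiag[OF h] by (intro mat_eqI_mentry[OF S]) metis
qed

lemma coroot_torus: "i \<in> {1..r} \<Longrightarrow> t \<noteq> 0 \<Longrightarrow> coroot r i t \<in> torus r"
  by (rule torusI) (auto simp: coroot_Sp mentry_coroot)

lemma dprod_coroot:
  assumes "i \<in> {1..r}" "d \<in> {1..r}" "t \<noteq> 0"
  shows "dprod (coroot r i t) d = (if i = d then t else 1)"
proof -
  have m: "mentry (coroot r i t) a a = (if a = i then t else 1) * (if a = Suc i then inverse t else 1)"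
    if a: "a \<in> {1..d}" for a
  proof -
    have "step r i a \<longleftrightarrow> a = i" "step r i (a - 1) \<longleftrightarrow> a = Suc i"
      using assms a by (auto simp: step_def)
    then show ?thesis using assms a by (simp add: mentry_coroot)
  qed
  have "dprod (coroot r i t) d = (\<Prod>a\<in>{1..d}. (if a = i then t else 1) * (if a = Suc i then inverse t else 1))"
    unfolding dprod_def by (intro prod.cong refl m)
  also have "\<dots> = (if i \<in> {1..d} then t else 1) * (if Suc i \<in> {1..d} then inverse t else 1)"
    by (simp add: prod.distrib)
  finally show ?thesis using assms by auto
qed

lemma torus_coroot_product:
  assumes "\<And>j. j \<in> {1..r} \<Longrightarrow> t j \<noteq> 0" "set js \<subseteq> {1..r}" "distinct js"
  shows "gprod (Sp r) (map (\<lambda>j. coroot r j (t j)) js) \<in> torus r"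
    and "d \<in> {1..r} \<Longrightarrow> dprod (gprod (Sp r) (map (\<lambda>j. coroot r j (t j)) js)) d = (if d \<in> set js then t d else 1)"
proof -
  have "gprod (Sp r) (map (\<lambda>j. coroot r j (t j)) js) \<in> torus r \<and>
    (\<forall>d\<in>{1..r}. dprod (gprod (Sp r) (map (\<lambda>j. coroot r j (t j)) js)) d = (if d \<in> set js then t d else 1))"
    using assms(2,3)
  proof (induction js)
    case Nil
    have "dprod (1\<^sub>m (2*r)) d = 1" if "d \<in> {1..r}" for d
      unfolding dprod_def using that by (intro prod.neutral) (auto simp: mentry_one)
    then show ?case using torus_one by simp
  next
    case (Cons j js)
    let ?P = "gprod (Sp r) (map (\<lambda>j. coroot r j (t j)) js)"
    have j: "j \<in> {1..r}" "t j \<noteq> 0" using Cons.prems assms(1) by auto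
    have IH: "?P \<in> torus r" "\<And>d. d \<in> {1..r} \<Longrightarrow> dprod ?P d = (if d \<in> set js then t d else 1)"
      using Cons by auto
    have "dprod (coroot r j (t j) * ?P) d = (if d \<in> set (j # js) then t d else 1)" if d: "d \<in> {1..r}" for d
      using dprod_mult[OF coroot_torus[OF j] IH(1), of d] d Cons.prems IH(2)[OF d] dprod_coroot[OF j(1) d j(2)]
      by auto
    then show ?case using torus_mult[OF coroot_torus[OF j] IH(1)] by simp
  qed
  then show "gprod (Sp r) (map (\<lambda>j. coroot r j (t j)) js) \<in> torus r"
    "d \<in> {1..r} \<Longrightarrow> dprod (gprod (Sp r) (map (\<lambda>j. coroot r j (t j)) js)) d = (if d \<in> set js then t d else 1)"
    by auto
qed

text \<open>\<open>dprod\<close> reads off the coordinates with respect to the coroots, so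
  \<open>dprod h\<close> itself is a decomposition of \<open>h\<close>, and every other one takes
  the same value at \<open>d\<close>.\<close>

lemma torus_char_fund_weight:
  assumes h: "h \<in> torus r" and d: "d \<in> {1..r}"
  shows "torus_char r (fund_weight d) h = dprod h d"
  unfolding torus_char_def
proof (rule the_equality)
  have char: "(\<Prod>j = 1..r. t j powi fund_weight d j) = t d" for t :: "nat \<Rightarrow> complex"
  proof -
    have "(\<Prod>j = 1..r. t j powi fund_weight d j) = (\<Prod>j = 1..r. if j = d then t j else 1)"
      by (intro prod.cong) (auto simp: fund_weight_def)
    then show ?thesis using d by simp
  qed
  have upt: "set [1..<Suc r] \<subseteq> {1..r}" "distinct [1..<Suc r]" "j \<in> {1..r} \<Longrightarrow> j \<in> set [1..<Suc r]" for j by auto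
  let ?t = "dprod h"
  have nz: "\<forall>j\<in>{1..r}. ?t j \<noteq> 0" using dprod_nonzero[OF h] by auto
  have "h = gprod (Sp r) (map (\<lambda>j. coroot r j (?t j)) [1..<Suc r])"
    using nz torus_coroot_product(2)[OF _ upt(1,2), of ?t] upt(3)
    by (intro torus_eqI[OF h] torus_coroot_product(1)[OF _ upt(1,2)]) (simp_all del: upt_Suc)
  then show "\<exists>t. (\<forall>j\<in>{1..r}. t j \<noteq> 0) \<and> h = gprod (Sp r) (map (\<lambda>j. coroot r j (t j)) [1..<Suc r]) \<and>
     dprod h d = (\<Prod>j = 1..r. t j powi fund_weight d j)"
    using nz char[of ?t] by (intro exI[of _ ?t]) auto
  fix c assume "\<exists>t. (\<forall>j\<in>{1..r}. t j \<noteq> 0) \<and> h = gprod (Sp r) (map (\<lambda>j. coroot r j (t j)) [1..<Suc r]) \<and>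
     c = (\<Prod>j = 1..r. t j powi fund_weight d j)"
  then obtain t where t: "\<forall>j\<in>{1..r}. t j \<noteq> 0" "h = gprod (Sp r) (map (\<lambda>j. coroot r j (t j)) [1..<Suc r])" "c = t d"
    using char by auto
  then show "c = dprod h d" using torus_coroot_product(2)[OF _ upt(1,2) d, of t] upt(3)[OF d] by (simp del: upt_Suc)
qed

lemma lead_gauss:
  assumes "y \<in> unip True r" "h \<in> torus r" "x \<in> unip False r" "d \<le> 2 * r"
  shows "lead (y * h * x) d = dprod h d"
proof -
  have hS: "h \<in> carrier (Sp r)" using assms torus_Sp by blast
  note c = unipD(2)[OF assms(1)] Sp_carrier_mat[OF hS] unipD(2)[OF assms(3)]
  have "lead (y * h * x) d = lead (y * (h * x)) d" using c by simp
  also have "\<dots> = lead (h * x) d"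
    using assms(1,4) c by (intro lead_lower_mult) auto
  also have "\<dots> = (\<Prod>a\<in>{1..d}. mentry (h * x) a a)"
    unfolding lead_def using tri_mult(1)[OF c(2,3) torus_tri[OF assms(2)] unipD(3)[OF assms(3)]] assms(4)
    by (intro minor_upper_triangular triD[of False r]) auto
  also have "\<dots> = dprod h d"
    unfolding dprod_def
  proof (rule prod.cong[OF refl])
    fix a assume "a \<in> {1..d}"
    then have a: "a \<in> {1..2*r}" using assms(4) by auto
    show "mentry (h * x) a a = mentry h a a"
      using tri_mult(2)[OF c(2,3) torus_tri[OF assms(2)] unipD(3)[OF assms(3)] a] unipD(4)[OF assms(3) a] by simp
  qed
  finally show ?thesis .
qed

text \<open>The diagonal part of a triangular symplectic matrix is symplectic: in the pairing of two
  mirror columns only the product of their diagonal entries survives.\<close>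

lemma upper_factor:
  assumes b: "b \<in> carrier (Sp r)" "tri False r b"
  shows "\<exists>h\<in>torus r. \<exists>x\<in>unip False r. b = h * x"
proof -
  note bc = Sp_carrier_mat[OF b(1)]
  define h where "h = mat (2*r) (2*r) (\<lambda>(i, j). if i = j then b $$ (i, j) else 0)"
  have hc: "h \<in> carrier_mat (2*r) (2*r)" by (simp add: h_def)
  have he: "mentry h a c = (if a = c then mentry b a a else 0)" if "a \<in> {1..2*r}" "c \<in> {1..2*r}" for a c
    using that by (auto simp: h_def mentry_def)
  have D: "mentry b a a * mentry b (2 * r + 1 - a) (2 * r + 1 - a) = 1" if a: "a \<in> {1..2*r}" for a
  proof -
    let ?a' = "2 * r + 1 - a"
    have a': "?a' \<in> {1..2*r}" using a by auto
    have z: "(-1) ^ (c + 1) * mentry b c a * mentry b (2 * r + 1 - c) ?a' = 0" if c: "c \<in> {1..2*r} - {a}" for c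
    proof -
      have c': "c \<in> {1..2*r}" "2 * r + 1 - c \<in> {1..2*r}" using c by auto
      consider "a < c" | "?a' < 2 * r + 1 - c" using c a by force
      then show ?thesis using triD[OF b(2) c'(1) a] triD[OF b(2) c'(2) a'] by cases auto
    qed
    have z0: "(\<Sum>c\<in>{1..2*r} - {a}. (-1) ^ (c + 1) * mentry b c a * mentry b (2 * r + 1 - c) ?a') = 0"
      by (rule sum.neutral) (use z in blast)
    have "(-1) ^ (a + 1) = sp_pair r (\<lambda>c. mentry b c a) (\<lambda>c. mentry b c ?a')"
      using Sp_pair[OF b(1) a a'] a by simp
    also have "\<dots> = (-1) ^ (a + 1) * mentry b a a * mentry b ?a' ?a'"
      unfolding sp_pair_def by (subst sum.remove[OF _ a]) (simp_all only: z0 finite_atLeastAtMost add_0_right)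
    finally show ?thesis by simp
  qed
  have hS: "h \<in> carrier (Sp r)" using diagonal_Sp[OF hc he] D by blast
  have hT: "h \<in> torus r" by (rule torusI[OF hS]) (simp add: he)
  note ic = sp_inv_carrier[OF hc]
  have ti: "tri False r (sp_inv r h)" by (rule tri_sp_inv[OF hc torus_tri[OF hT]])
  have "mentry (sp_inv r h * b) a a = 1" if a: "a \<in> {1..2*r}" for a
  proof -
    have "2 * r + 1 - a \<in> {1..2*r}" using a by auto
    then have "mentry (sp_inv r h) a a = mentry b (2 * r + 1 - a) (2 * r + 1 - a)"
      using mentry_sp_inv[OF hc a a] he by (simp add: power_add power_mult_distrib[symmetric])
    then show ?thesis using tri_mult(2)[OF ic bc ti b(2) a] D[OF a] by (simp add: mult.commute)
  qed
  then have "sp_inv r h * b \<in> unip False r"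
    using tri_mult(1)[OF ic bc ti b(2)] Sp_mult_closed[OF sp_inv_Sp[OF hS] b(1)] by (simp add: unip_def)
  moreover have "h * (sp_inv r h * b) = b"
    using assoc_mult_mat[OF hc ic bc] sp_inv_right[OF hS] bc by simp
  ultimately show ?thesis using hT by metis
qed

text \<open>One direction reads the leading minors off the factorization; the other eliminates below
  the diagonal and splits the resulting upper triangular matrix.\<close>

lemma G0_iff: "g \<in> G0 r \<longleftrightarrow> g \<in> carrier (Sp r) \<and> (\<forall>d\<in>{1..r}. lead g d \<noteq> 0)"
proof
  assume "g \<in> G0 r"
  then obtain y h x where g: "g = y * h * x" "y \<in> unip True r" "h \<in> torus r" "x \<in> unip False r"
    unfolding G0_def N_eq by blast
  then have "g \<in> carrier (Sp r)" using unipD(1) subsetD[OF torus_Sp] by (simp add: Sp_mult_closed)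
  moreover have "lead g d \<noteq> 0" if "d \<in> {1..r}" for d
    using lead_gauss[OF g(2-4), of d] dprod_nonzero[OF g(3), of d] that g(1) by simp
  ultimately show "g \<in> carrier (Sp r) \<and> (\<forall>d\<in>{1..r}. lead g d \<noteq> 0)" by blast
next
  assume g: "g \<in> carrier (Sp r) \<and> (\<forall>d\<in>{1..r}. lead g d \<noteq> 0)"
  then obtain \<gamma> where \<gamma>: "\<gamma> \<in> y_group r" "cols_upper r (\<gamma> * g) (2 * r)"
    using y_group_eliminate by blast
  have \<gamma>S: "\<gamma> \<in> carrier (Sp r)" using \<gamma>(1) y_group_Sp by blast
  have "\<gamma> \<in> unip True r" using \<gamma>(1) y_group_unip by blast
  have "tri False r (\<gamma> * g)" using \<gamma>(2) by (simp add: tri_def cols_upper_def)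
  then obtain h x where hx: "h \<in> torus r" "x \<in> unip False r" "\<gamma> * g = h * x"
    using upper_factor[OF Sp_mult_closed[OF \<gamma>S]] g by blast
  note c = Sp_carrier_mat[OF \<gamma>S] sp_inv_carrier[OF Sp_carrier_mat[OF \<gamma>S]]
  have gc: "g \<in> carrier_mat (2*r) (2*r)" using g Sp_carrier_mat by blast
  have hc: "h \<in> carrier_mat (2*r) (2*r)" using hx(1) torus_Sp Sp_carrier_mat by blast
  have "g = sp_inv r \<gamma> * (\<gamma> * g)"
    using assoc_mult_mat[OF c(2,1) gc] sp_inv_left[OF \<gamma>S] gc by simp
  also have "\<dots> = sp_inv r \<gamma> * h * x"
    unfolding hx(3) using assoc_mult_mat[OF c(2) hc unipD(2)[OF hx(2)]] by simp
  finally show "g \<in> G0 r"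
    unfolding G0_def N_eq using sp_inv_unip[OF \<open>\<gamma> \<in> unip True r\<close>] hx(1,2) by blast
qed

text \<open>Leading minors determine the \<open>dprod\<close> values of the middle factor and with
  them that factor, so the description in \<open>gauss0\<close> is unique.\<close>

lemma torus_char_gauss0:
  assumes "g \<in> G0 r" "d \<in> {1..r}"
  shows "torus_char r (fund_weight d) (gauss0 r g) = lead g d"
proof -
  obtain y h x where g: "g = y * h * x" "y \<in> unip True r" "h \<in> torus r" "x \<in> unip False r"
    using assms(1) unfolding G0_def N_eq by blast
  have "gauss0 r g = h" unfolding gauss0_def N_eq
  proof (rule the_equality)
    show "h \<in> torus r \<and> (\<exists>y\<in>unip True r. \<exists>x\<in>unip False r. g = y * h * x)" using g by blast
    fix h' assume h': "h' \<in> torus r \<and> (\<exists>y\<in>unip True r. \<exists>x\<in>unip False r. g = y * h' * x)"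
    then obtain y' x' where "g = y' * h' * x'" "y' \<in> unip True r" "x' \<in> unip False r" by blast
    then have "dprod h' d = dprod h d" if "d \<in> {1..r}" for d
      using lead_gauss[of y' r h' x' d] lead_gauss[OF g(2-4), of d] h' g(1) that by simp
    then show "h' = h" using h' g(3) by (intro torus_eqI) auto
  qed
  then show ?thesis using torus_char_fund_weight[OF g(3) assms(2)] lead_gauss[OF g(2-4), of d] g(1) assms(2) by simp
qed


text \<open>Zariski density of the big cell: the set of points where every polynomial vanishing on \<open>G0\<close> vanishes
  is stable under left multiplication by the one-parameter subgroups, and every symplectic matrix
  becomes upper triangular after finitely many such multiplications.\<close>

definition G0_closure :: "nat \<Rightarrow> complex mat set" where
  "G0_closure r = {g \<in> carrier (Sp r). \<forall>f\<in>poly_fun (2*r). (\<forall>x\<in>G0 r. f x = 0) \<longrightarrow> f g = 0}"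

lemma poly_fun_left_mult:
  assumes "f \<in> poly_fun n" "y \<in> carrier_mat n n"
  shows "\<exists>f'\<in>poly_fun n. \<forall>x\<in>carrier_mat n n. f' x = f (y * x)"
proof -
  \<comment> \<open>The product written out entrywise, so that the result is a polynomial function
    on all arguments, not only on matrices of the right size.\<close>
  define \<phi> where "\<phi> x = mat n n (\<lambda>(i, j). \<Sum>k\<in>{0..<n}. y $$ (i, k) * x $$ (k, j))" for x :: "complex mat"
  have "\<phi> x = y * x" if "x \<in> carrier_mat n n" for x
    using that assms(2) by (intro eq_matI) (auto simp: \<phi>_def scalar_prod_def)
  moreover have "(\<lambda>x. f (\<phi> x)) \<in> poly_fun n"
    using assms(1)
  proof (rule poly_fun_compose)
    fix i j assume "i < n" "j < n"
    then show "(\<lambda>x. \<phi> x $$ (i, j)) \<in> poly_fun n"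
      by (auto simp: \<phi>_def intro!: poly_fun_sum poly_fun.mult poly_fun.const poly_fun.entry)
  qed
  ultimately show ?thesis by (intro bexI[of _ "\<lambda>x. f (\<phi> x)"]) auto
qed

text \<open>If \<open>f\<close> vanishes on the cell, so does its translate by \<open>y\<close>,
  since \<open>y\<close> sends the cell into the closure; evaluate that translate at
  \<open>g\<close>.\<close>

lemma G0_closure_left_mult:
  assumes y: "y \<in> carrier (Sp r)" and yG: "\<And>x. x \<in> G0 r \<Longrightarrow> y * x \<in> G0_closure r" and g: "g \<in> G0_closure r"
  shows "y * g \<in> G0_closure r"
proof -
  have gS: "g \<in> carrier (Sp r)" using g by (simp add: G0_closure_def)
  have "f (y * g) = 0" if f: "f \<in> poly_fun (2*r)" "\<forall>x\<in>G0 r. f x = 0" for f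
  proof -
    obtain f' where f': "f' \<in> poly_fun (2*r)" "\<forall>x\<in>carrier_mat (2*r) (2*r). f' x = f (y * x)"
      using poly_fun_left_mult[OF f(1) Sp_carrier_mat[OF y]] by blast
    have "f' x = 0" if "x \<in> G0 r" for x
      using f f' yG[OF that] that Sp_carrier_mat by (simp add: G0_closure_def G0_iff)
    then have "f' g = 0" using g f'(1) by (simp add: G0_closure_def)
    then show ?thesis using f'(2) Sp_carrier_mat[OF gS] by simp
  qed
  then show ?thesis using Sp_mult_closed[OF y gS] by (simp add: G0_closure_def)
qed

lemma G0_subset_closure: "G0 r \<subseteq> G0_closure r"
  by (auto simp: G0_closure_def G0_iff)

text \<open>The curve \<open>t \<mapsto> x_sub r i t * g\<close> starts in the cell, so the product
  of leading minors vanishes for finitely many \<open>t\<close> only. A polynomial vanishing on the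
  cell thus has infinitely many zeros on the curve.\<close>

lemma x_sub_mult_G0:
  assumes i: "i \<in> {1..r}" and g: "g \<in> G0 r"
  shows "x_sub r i t * g \<in> G0_closure r"
proof -
  have gS: "g \<in> carrier (Sp r)" and lead: "\<And>d. d \<in> {1..r} \<Longrightarrow> lead g d \<noteq> 0"
    using g by (auto simp: G0_iff)
  note gc = Sp_carrier_mat[OF gS]
  define c where "c t = x_sub r i t * g" for t
  have cS: "c t \<in> carrier (Sp r)" for t unfolding c_def by (rule Sp_mult_closed[OF x_sub_Sp[OF i] gS])
  have curve: "poly_curve (2*r) c" unfolding poly_curve_def
  proof (intro conjI allI impI Sp_carrier_mat[OF cS])
    fix j k assume jk: "j < 2 * r" "k < 2 * r"
    have "c t $$ (j, k) = poly [:mentry g (Suc j) (Suc k), if step r i (Suc j) then mentry g (Suc j + 1) (Suc k) else 0:] t" for t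
    proof -
      have "c t $$ (j, k) = mentry (c t) (Suc j) (Suc k)" by (simp add: mentry_def)
      also have "\<dots> = mentry g (Suc j) (Suc k) + (if step r i (Suc j) then t * mentry g (Suc j + 1) (Suc k) else 0)"
        unfolding c_def using jk by (intro mentry_x_sub_mult[OF i gc]) auto
      finally show ?thesis by simp
    qed
    then show "\<exists>P. \<forall>t. c t $$ (j, k) = poly P t" by blast
  qed
  define D where "D x = (\<Prod>d\<in>{1..r}. lead x d)" for x
  have D: "D \<in> poly_fun (2*r)" unfolding D_def lead_def
    by (intro poly_fun_prod poly_fun_minor) (auto simp: path_start_simps)
  have "c 0 = g"
    by (rule mat_eqI_mentry[OF Sp_carrier_mat[OF cS] gc]) (simp add: c_def mentry_x_sub_mult[OF i gc])
  then have "D (c 0) \<noteq> 0" using lead by (simp add: D_def)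
  then have fin: "finite {t. D (c t) = 0}"
    using poly_fun_zero_on_curve[OF D curve] by blast
  have "f (c t) = 0" if f: "f \<in> poly_fun (2*r)" "\<forall>x\<in>G0 r. f x = 0" for f
  proof (rule poly_fun_zero_on_curve[OF f(1) curve])
    have "c t \<in> G0 r" if "D (c t) \<noteq> 0" for t
      using that cS unfolding G0_iff D_def prod_zero_iff[OF finite_atLeastAtMost] by blast
    then have "UNIV = {t. D (c t) = 0} \<union> {t. f (c t) = 0}"
      using f(2) by blast
    then show "infinite {t. f (c t) = 0}" using fin by (metis finite_UnI infinite_UNIV_char_0)
  qed
  then show ?thesis using cS by (simp add: G0_closure_def c_def)
qed

lemma y_group_mult_G0:
  assumes y: "y \<in> y_group r" and x: "x \<in> G0 r"
  shows "y * x \<in> G0_closure r"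
proof -
  have "y \<in> carrier (Sp r)" "x \<in> carrier (Sp r)" using y y_group_Sp x by (auto simp: G0_iff)
  then have "y * x \<in> G0 r"
    using x lead_lower_mult[OF subsetD[OF y_group_unip y] Sp_carrier_mat] Sp_mult_closed
    by (auto simp: G0_iff)
  then show ?thesis using G0_subset_closure by blast
qed

lemma step_range: "i \<in> {1..r} \<Longrightarrow> step r i a \<Longrightarrow> a + 1 \<in> {1..2*r}"
  by (auto simp: step_def)

text \<open>A nonzero entry of column \<open>p\<close> is pushed up row by row with
  \<open>x_sub\<close> until it reaches the diagonal, where \<open>clear_column\<close> applies.
  Each move is undone inside the closure.\<close>

lemma G0_closure_of_pivot:
  assumes p: "p \<in> {1..r}"
    and cleared: "\<And>g. g \<in> carrier (Sp r) \<Longrightarrow> cols_upper r g p \<Longrightarrow> (\<And>a. a \<in> {1..p} \<Longrightarrow> mentry g a a \<noteq> 0) \<Longrightarrow> g \<in> G0_closure r"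
  shows "p \<le> q \<Longrightarrow> q \<le> 2 * r + 1 - p \<Longrightarrow> h \<in> carrier (Sp r) \<Longrightarrow> cols_upper r h (p - 1) \<Longrightarrow>
    (\<And>a. a \<in> {1..p - 1} \<Longrightarrow> mentry h a a \<noteq> 0) \<Longrightarrow> mentry h q p \<noteq> 0 \<Longrightarrow> h \<in> G0_closure r"
proof (induction q arbitrary: h rule: dec_induct)
  case base
  have "mentry h a a \<noteq> 0" if a: "a \<in> {1..p}" for a
  proof (cases "a = p")
    case False
    then have "a \<in> {1..p - 1}" using a by auto
    then show ?thesis by (rule base(4))
  qed (use base(5) in simp)
  then obtain \<gamma> where \<gamma>: "\<gamma> \<in> y_group r" "cols_upper r (\<gamma> * h) p" "\<And>a. a \<in> {1..p} \<Longrightarrow> mentry (\<gamma> * h) a a \<noteq> 0"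
    using clear_column[OF base(2) p base(3)] by auto
  have \<gamma>S: "\<gamma> \<in> carrier (Sp r)" using \<gamma>(1) y_group_Sp by blast
  then have cl: "\<gamma> * h \<in> G0_closure r" using base(2) \<gamma>(2,3) by (intro cleared Sp_mult_closed)
  have inv: "sp_inv r \<gamma> \<in> y_group r"
    using subgroup.m_inv_closed[OF y_group_subgroup \<gamma>(1)] inv_Sp[OF \<gamma>S] by simp
  have "sp_inv r \<gamma> * (\<gamma> * h) \<in> G0_closure r"
    by (rule G0_closure_left_mult[OF sp_inv_Sp[OF \<gamma>S] y_group_mult_G0[OF inv] cl])
  moreover have "sp_inv r \<gamma> * (\<gamma> * h) = h"
    using assoc_mult_mat[OF sp_inv_carrier[OF Sp_carrier_mat[OF \<gamma>S]] Sp_carrier_mat[OF \<gamma>S] Sp_carrier_mat[OF base(2)]]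
      sp_inv_left[OF \<gamma>S] Sp_carrier_mat[OF base(2)] by simp
  ultimately show ?case by simp
next
  case (step q)
  have pq: "p \<le> q" "Suc q \<le> 2 * r + 1 - p" using step.hyps(1) step.prems(1) by simp_all
  then have q: "q \<le> 2 * r + 1 - p" "q \<in> {1..2*r}" "p \<in> {1..2*r}" using p by auto
  show ?case
  proof (cases "mentry h q p = 0")
    case False
    show ?thesis by (rule step.IH[OF q(1) step.prems(2,3,4) False])
  next
    case True
    \<comment> \<open>The simple root adding row \<open>q + 1\<close> to row \<open>q\<close>. Its
      second arrow starts at \<open>2 * r - q\<close>, which is still at least \<open>p\<close>, so
      the columns cleared before stay intact.\<close>
    define i where "i = (if q \<le> r then q else 2 * r - q)"
    have st: "step r i a \<longleftrightarrow> a = q \<or> a = 2 * r - q" for a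
    proof (cases "q \<le> r")
      case False
      then have "2 * r - (2 * r - q) = q" using q(2) by auto
      then show ?thesis using False by (auto simp: i_def step_def)
    qed (simp add: i_def step_def)
    have "step r i q" by (simp add: st)
    moreover have "i \<in> {1..r}" using pq p by (auto simp: i_def)
    ultimately have i: "i \<in> {1..r}" "step r i q" by simp_all
    have "p \<le> 2 * r - q" using pq p by auto
    then have ge: "p \<le> a" if "step r i a" for a using that pq(1) unfolding st by auto
    let ?h = "x_sub r i 1 * h"
    note hc = Sp_carrier_mat[OF step.prems(2)]
    have hS: "?h \<in> carrier (Sp r)" by (rule Sp_mult_closed[OF x_sub_Sp[OF i(1)] step.prems(2)])
    have m: "mentry ?h a b = mentry h a b + (if step r i a then mentry h (a + 1) b else 0)"
      if "a \<in> {1..2*r}" "b \<in> {1..2*r}" for a b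
      using mentry_x_sub_mult[OF i(1) hc that, of 1] by simp
    have low: "mentry h a b = 0" if "a \<in> {1..2*r}" "b \<in> {1..p - 1}" "b < a" for a b
      using step.prems(3) that unfolding cols_upper_def by blast
    have "cols_upper r ?h (p - 1)" unfolding cols_upper_def
    proof (intro allI impI)
      fix a b assume ab: "b \<in> {1..p - 1}" "a \<in> {1..2*r}" "b < a"
      have b: "b \<in> {1..2*r}" using ab p by auto
      have "mentry h (a + 1) b = 0" if "step r i a"
      proof -
        show ?thesis by (rule low[OF step_range[OF i(1) that] ab(1)]) (use ab(3) in simp)
      qed
      then show "mentry ?h a b = 0" using m[OF ab(2) b] low[OF ab(2,1,3)] by simp
    qed
    moreover have "mentry ?h a a \<noteq> 0" if a: "a \<in> {1..p - 1}" for a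
    proof -
      have "a \<in> {1..2*r}" "\<not> p \<le> a" using a p by auto
      then show ?thesis using m[of a a] ge[of a] step.prems(4)[OF a] by auto
    qed
    moreover have "mentry ?h q p \<noteq> 0"
      using m[OF q(2,3)] step.prems(5) i(2) True by simp
    ultimately have "?h \<in> G0_closure r"
      by (intro step.IH[OF q(1) hS])
    from G0_closure_left_mult[OF x_sub_Sp[OF i(1)] x_sub_mult_G0[OF i(1)] this]
    have "x_sub r i (-1) * ?h \<in> G0_closure r" .
    moreover have "x_sub r i (-1) * ?h = h"
    proof (rule mat_eqI_mentry[OF _ hc])
      show "x_sub r i (-1) * ?h \<in> carrier_mat (2*r) (2*r)"
        by (rule mult_carrier_mat[OF x_sub_carrier Sp_carrier_mat[OF hS]])
      fix a b assume ab: "a \<in> {1..2*r}" "b \<in> {1..2*r}"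
      have "mentry ?h (a + 1) b = mentry h (a + 1) b" if "step r i a"
      proof -
        have "\<not> step r i (a + 1)" using step_Suc[OF i(1) that] by simp
        then show ?thesis using m[OF step_range[OF i(1) that] ab(2)] by simp
      qed
      then show "mentry (x_sub r i (-1) * ?h) a b = mentry h a b"
        using mentry_x_sub_mult[OF i(1) Sp_carrier_mat[OF hS] ab, of "-1"] m[OF ab] by simp
    qed
    ultimately show ?thesis by simp
  qed
qed

text \<open>Descending induction on the number of columns already cleared, starting from
  \<open>r\<close>, where the matrix is upper triangular and lies in the cell.\<close>

lemma G0_dense: "carrier (Sp r) \<subseteq> G0_closure r"
proof -
  have "g \<in> G0_closure r" if "k \<le> r" "g \<in> carrier (Sp r)" "cols_upper r g k" "\<And>a. a \<in> {1..k} \<Longrightarrow> mentry g a a \<noteq> 0" for g k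
    using that
  proof (induction k arbitrary: g rule: inc_induct)
    case base
    then have "cols_upper r g (2 * r)" by (intro cols_upper_complete)
    then have "tri False r g" by (simp add: tri_def cols_upper_def)
    then obtain h x where "h \<in> torus r" "x \<in> unip False r" "g = h * x" using upper_factor base(1) by blast
    moreover have "1\<^sub>m (2*r) * h * x = h * x"
      using \<open>h \<in> torus r\<close> torus_Sp Sp_carrier_mat[of h r] by (auto simp: subset_iff)
    ultimately have "g = 1\<^sub>m (2*r) * h * x" "h \<in> torus r" "x \<in> unip False r" by simp_all
    then have "g \<in> G0 r" unfolding G0_def N_eq using one_unip[of r True] by blast
    then show ?case using G0_subset_closure by blast
  next
    case (step k)
    let ?p = "Suc k" and ?p' = "2 * r + 1 - Suc k"
    have p: "?p \<in> {1..r}" using step.hyps by auto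
    have pp: "?p \<in> {1..2*r}" "?p' \<in> {1..2*r}" using p by auto
    \<comment> \<open>Otherwise every term in the pairing of column \<open>?p\<close> with its
      mirror column would vanish, although this pairing is a sign.\<close>
    have "\<exists>q\<in>{?p..?p'}. mentry g q ?p \<noteq> 0"
    proof (rule ccontr)
      assume none: "\<not> (\<exists>q\<in>{?p..?p'}. mentry g q ?p \<noteq> 0)"
      have "k \<le> 2 * r" using p by auto
      note sz = symplectic_zero_entries[OF step.prems(1,2,3) this]
      have "(-1) ^ (c + 1) * mentry g c ?p * mentry g (2 * r + 1 - c) ?p' = 0" if c: "c \<in> {1..2*r}" for c
      proof -
        consider "c \<in> {1..k}" | "c \<in> {?p..?p'}" | "?p' < c" using c unfolding atLeastAtMost_iff by linarith
        then show ?thesis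
        proof cases
          case 1
          then have "mentry g (2 * r + 1 - c) ?p' = 0" using p by (intro sz pp) auto
          then show ?thesis by simp
        next
          case 2
          then show ?thesis using none by simp
        next
          case 3
          then have "mentry g (2 * r + 1 - (2 * r + 1 - c)) ?p = 0" using c p by (intro sz pp) auto
          then show ?thesis using c by simp
        qed
      qed
      then have "sp_pair r (\<lambda>c. mentry g c ?p) (\<lambda>c. mentry g c ?p') = 0"
        unfolding sp_pair_def by (intro sum.neutral) blast
      then show False using Sp_pair[OF step.prems(1) pp] p by simp
    qed
    then obtain q where q: "q \<in> {?p..?p'}" "mentry g q ?p \<noteq> 0" by blast
    show ?case
    proof (rule G0_closure_of_pivot[OF p, of q])
      fix g' assume "g' \<in> carrier (Sp r)" "cols_upper r g' ?p" "\<And>a. a \<in> {1..?p} \<Longrightarrow> mentry g' a a \<noteq> 0"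
      then show "g' \<in> G0_closure r" by (rule step.IH)
    next
      show "?p \<le> q" "q \<le> 2 * r + 1 - ?p" "mentry g q ?p \<noteq> 0" using q by auto
      show "cols_upper r g (?p - 1)" using step.prems(2) by simp
      show "mentry g a a \<noteq> 0" if "a \<in> {1..?p - 1}" for a using step.prems(3)[of a] that by simp
    qed (rule step.prems(1))
  qed
  from this[of 0] show ?thesis by (auto simp: cols_upper_def)
qed

text \<open>Density of the translated cell: translating the difference of the two functions by
  \<open>w\<close> reduces it to \<open>G0_dense\<close>.\<close>

lemma poly_fun_eq_on_Sp:
  assumes f: "f \<in> poly_fun (2*r)" "f' \<in> poly_fun (2*r)" and w: "w \<in> carrier (Sp r)"
    and eq: "\<And>g. g \<in> G0 r \<Longrightarrow> f (w * g) = f' (w * g)" and g: "g \<in> carrier (Sp r)"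
  shows "f g = f' g"
proof -
  note wc = Sp_carrier_mat[OF w] and gc = Sp_carrier_mat[OF g]
  obtain F where F: "F \<in> poly_fun (2*r)" "\<forall>x\<in>carrier_mat (2*r) (2*r). F x = f (w * x) - f' (w * x)"
    using poly_fun_left_mult[OF poly_fun_minus[OF f] wc] by blast
  have "F x = 0" if "x \<in> G0 r" for x
    using F(2) eq[OF that] that Sp_carrier_mat by (simp add: G0_iff)
  moreover have S: "sp_inv r w * g \<in> carrier (Sp r)" by (rule Sp_mult_closed[OF sp_inv_Sp[OF w] g])
  moreover have "sp_inv r w * g \<in> G0_closure r" using S G0_dense by blast
  ultimately have "F (sp_inv r w * g) = 0" using F(1) by (simp add: G0_closure_def)
  moreover have "w * (sp_inv r w * g) = g"
    using assoc_mult_mat[OF wc sp_inv_carrier[OF wc] gc] sp_inv_right[OF w] gc by simp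
  ultimately show ?thesis using F(2) Sp_carrier_mat[OF S] by simp
qed

text \<open>The minor is regular and has the prescribed values on the translated cell; density makes
  it the only such function, so the description in \<open>gen_minor\<close> picks it.\<close>

lemma gen_minor_eq:
  assumes w: "weyl_rep r w \<in> carrier (Sp r)" and w': "weyl_rep r w' = 1\<^sub>m (2*r)"
    and d: "d \<in> {1..r}" and I: "length I = d" "set I \<subseteq> {1..2*r}"
    and lead: "\<And>g. g \<in> carrier (Sp r) \<Longrightarrow> minor (mentry (weyl_rep r w * g)) I (path_start d) = lead g d"
  shows "gen_minor r w w' d = restrict (\<lambda>g. minor (mentry g) I (path_start d)) (carrier (Sp r))"
proof -
  let ?w = "weyl_rep r w" and ?f = "restrict (\<lambda>g. minor (mentry g) I (path_start d)) (carrier (Sp r))"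
  note wc = Sp_carrier_mat[OF w]
  have inv1: "inv\<^bsub>Sp r\<^esub> (1\<^sub>m (2*r)) = 1\<^sub>m (2*r)"
    using monoid.inv_one[OF group.is_monoid[OF group_Sp], of r] by simp
  have cell: "?w * g * inv\<^bsub>Sp r\<^esub> (weyl_rep r w') = ?w * g"
    "inv\<^bsub>Sp r\<^esub> ?w * (?w * g) * weyl_rep r w' = g" if "g \<in> carrier (Sp r)" for g
  proof -
    note gc = Sp_carrier_mat[OF that]
    show "?w * g * inv\<^bsub>Sp r\<^esub> (weyl_rep r w') = ?w * g"
      unfolding w' inv1 by (rule right_mult_one_mat[OF mult_carrier_mat[OF wc gc]])
    show "inv\<^bsub>Sp r\<^esub> ?w * (?w * g) * weyl_rep r w' = g"
      unfolding w' inv_Sp[OF w] using assoc_mult_mat[OF sp_inv_carrier[OF wc] wc gc] sp_inv_left[OF w] gc by simp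
  qed
  have GS: "g \<in> carrier (Sp r)" if "g \<in> G0 r" for g using that by (simp add: G0_iff)
  have cond: "(\<forall>x \<in> (\<lambda>g. ?w * g * inv\<^bsub>Sp r\<^esub> (weyl_rep r w')) ` G0 r.
        f x = torus_char r (fund_weight d) (gauss0 r (inv\<^bsub>Sp r\<^esub> ?w * x * weyl_rep r w')))
     \<longleftrightarrow> (\<forall>g\<in>G0 r. f (?w * g) = lead g d)" for f
    using cell GS torus_char_gauss0[OF _ d] by simp
  have poly: "(\<lambda>g. minor (mentry g) I (path_start d)) \<in> poly_fun (2*r)"
    using I d by (intro poly_fun_minor) (auto simp: path_start_simps)
  show ?thesis unfolding gen_minor_def cond
  proof (rule the_equality)
    show "regular_on_Sp r ?f \<and> (\<forall>g\<in>G0 r. ?f (?w * g) = lead g d)"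
      using poly lead GS Sp_mult_closed[OF w] by (auto simp: regular_on_Sp_def)
    fix f assume f: "regular_on_Sp r f \<and> (\<forall>g\<in>G0 r. f (?w * g) = lead g d)"
    then obtain q where q: "q \<in> poly_fun (2*r)" "\<And>g. g \<in> carrier (Sp r) \<Longrightarrow> f g = q g"
      and ext: "f \<in> extensional (carrier (Sp r))" by (auto simp: regular_on_Sp_def)
    have "q g = minor (mentry g) I (path_start d)" if "g \<in> carrier (Sp r)" for g
    proof (rule poly_fun_eq_on_Sp[OF q(1) poly w _ that])
      fix x assume "x \<in> G0 r"
      then show "q (?w * x) = minor (mentry (?w * x)) I (path_start d)"
        using f q(2) lead GS Sp_mult_closed[OF w] by metis
    qed
    then show "f = ?f" using q(2) by (intro extensionalityI[OF ext restrict_extensional]) simp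
  qed
qed

section \<open>Reduced words\<close>

text \<open>The action on rows of one block of a simple reflection representative: rows
  \<open>j\<close> and \<open>Suc j\<close> are exchanged, and the row moving up to \<open>j\<close>
  is negated.\<close>

definition swp :: "nat \<Rightarrow> (nat \<Rightarrow> nat \<Rightarrow> 'a::comm_ring_1) \<Rightarrow> nat \<Rightarrow> nat \<Rightarrow> 'a" where
  "swp j g a b = (if a = j then - g (Suc j) b else if a = Suc j then g j b else g a b)"

text \<open>With \<open>j\<close> alone the row moves down without a sign; with both rows the sign
  of the exchange cancels the negation. The excluded case, \<open>Suc j\<close> alone, is the only
  one producing a sign.\<close>

lemma minor_swp:
  assumes L: "L \<in> incl S d" and L': "L' \<in> incl S d" and set: "set L' = transpose j (Suc j) ` set L"
    and up: "Suc j \<in> set L \<Longrightarrow> j \<in> set L" and A: "length A = d"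
  shows "minor (swp j g) L' A = minor g L A"
proof -
  have len: "length L = d" "length L' = d" and sort: "sorted_wrt (<) L" "sorted_wrt (<) L'"
    using L L' by (auto simp: incl_def)
  consider "j \<notin> set L" "Suc j \<notin> set L" | "j \<in> set L" "Suc j \<notin> set L" | "j \<in> set L" "Suc j \<in> set L"
    using up by blast
  then show ?thesis
  proof cases
    case 1
    then have "set L' = set L" using set by (auto simp: transpose_def image_iff)
    then have "L' = L" using L L' incl_eqI by blast
    moreover have "minor (swp j g) L A = minor g L A"
    proof (rule minor_cong)
      fix x y assume "x \<in> set L"
      then have "x \<noteq> j" "x \<noteq> Suc j" using 1 by auto
      then show "swp j g x y = g x y" by (simp add: swp_def)
    qed (use len A in simp)
    ultimately show ?thesis by simp
  next
    case 2
    have "sorted_wrt (<) (map (transpose j (Suc j)) L)"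
      unfolding sorted_wrt_map
    proof (rule sorted_wrt_mono_rel[OF _ sort(1)])
      fix x y assume "x \<in> set L" "y \<in> set L" "x < y"
      then have "x \<noteq> Suc j" "y \<noteq> Suc j" "x < y" using 2 by auto
      then show "transpose j (Suc j) x < transpose j (Suc j) y" by (auto simp: transpose_def)
    qed
    then have "L' = map (transpose j (Suc j)) L"
      using sort set by (intro strict_sorted_equal) auto
    moreover have "swp j g (transpose j (Suc j) x) b = g x b" if "x \<in> set L" for x b
      using that 2 by (auto simp: swp_def transpose_def)
    ultimately show ?thesis
      unfolding minor_def using len by (intro arg_cong[of _ _ det] eq_matI) auto
  next
    case 3
    have "set L' = set L" unfolding set using 3 by (auto simp: transpose_def image_iff)
    then have eq: "L' = L" using L L' incl_eqI by blast
    obtain p q where pq: "p < d" "L ! p = j" "q < d" "L ! q = Suc j"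
      using 3 len by (metis in_set_conv_nth)
    have dist: "distinct L" using sort(1) by (simp add: strict_sorted_iff)
    then have ind: "L ! i = j \<longleftrightarrow> i = p" "L ! i = Suc j \<longleftrightarrow> i = q" if "i < d" for i
      using that pq len by (metis nth_eq_iff_index_eq)+
    have "p \<noteq> q" using pq by auto
    let ?M = "mat d d (\<lambda>(i, k). g (L ! i) (A ! k))"
    have M: "?M \<in> carrier_mat d d" by simp
    have "mat d d (\<lambda>(i, k). swp j g (L ! i) (A ! k)) = multrow p (-1) (swaprows p q ?M)"
      using pq(1,3) ind \<open>p \<noteq> q\<close> by (intro eq_matI) (auto simp: swp_def pq(2,4))
    then have "det (mat d d (\<lambda>(i, k). swp j g (L ! i) (A ! k))) = det ?M"
      using det_multrow[OF pq(1), of "swaprows p q ?M" "-1"] det_swaprows[OF pq(1,3) \<open>p \<noteq> q\<close> M] by simp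
    then show ?thesis unfolding minor_def eq len .
  qed
qed

section \<open>Simple reflections as permutations of \<open>J\<close>\<close>

definition sperm :: "nat \<Rightarrow> nat \<Rightarrow> nat \<Rightarrow> nat" where
  "sperm r i a = (if step r i a then Suc a else if step r i (a - 1) then a - 1 else a)"

lemma step_pos: "i \<in> {1..r} \<Longrightarrow> step r i a \<Longrightarrow> 0 < a"
  by (auto simp: step_def)

lemma sperm_sperm: assumes "i \<in> {1..r}" shows "sperm r i (sperm r i a) = a"
proof -
  consider "step r i a" | "\<not> step r i a" "step r i (a - 1)" | "\<not> step r i a" "\<not> step r i (a - 1)" by blast
  then show ?thesis
  proof cases
    case 1
    then show ?thesis using step_Suc[OF assms 1] by (simp add: sperm_def)
  next
    case 2
    then have "0 < a - 1" by (intro step_pos[OF assms])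
    then show ?thesis using 2 by (simp add: sperm_def)
  qed (simp add: sperm_def)
qed

lemma sperm_range: assumes "i \<in> {1..r}" "a \<in> {1..2*r}" shows "sperm r i a \<in> {1..2*r}"
  using assms step_range[OF assms(1), of a] step_pos[OF assms(1), of "a - 1"]
  by (auto simp: sperm_def)

lemma sperm_bar:
  assumes "i \<in> {1..r}" "a \<in> {1..2*r}"
  shows "sperm r i (2 * r + 1 - a) = 2 * r + 1 - sperm r i a"
proof -
  have s: "step r i (2 * r + 1 - a) \<longleftrightarrow> step r i (a - 1)" "step r i (2 * r + 1 - a - 1) \<longleftrightarrow> step r i a"
    using assms(2) by (auto intro!: step_reflect[OF assms(1)])
  have "\<not> (step r i a \<and> step r i (a - 1))" using step_Suc[OF assms(1), of "a - 1"] assms(2) by auto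
  then show ?thesis unfolding sperm_def s using assms(2) by auto
qed

lemma mentry_s_rep_mult:
  assumes i: "i \<in> {1..r}" and g: "g \<in> carrier_mat (2*r) (2*r)" and a: "a \<in> {1..2*r}" and b: "b \<in> {1..2*r}"
  shows "mentry (s_rep r i * g) a b
    = (if step r i a then - mentry g (Suc a) b else if step r i (a - 1) then mentry g (a - 1) b else mentry g a b)"
proof -
  let ?x = "x_sub r i (-1)" and ?y = "y_sub r i 1"
  note mx = mult_carrier_mat[OF x_sub_carrier] and my = mult_carrier_mat[OF y_sub_carrier]
  have eq: "s_rep r i * g = ?x * (?y * (?x * g))"
    unfolding s_rep_def using g x_sub_carrier[of r i] y_sub_carrier[of r i]
    by (simp add: square_mult[where r = r])
  define v1 where "v1 a = mentry (?x * g) a b" for a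
  define v2 where "v2 a = mentry (?y * (?x * g)) a b" for a
  have v1: "v1 a = mentry g a b - (if step r i a then mentry g (Suc a) b else 0)" if "a \<in> {1..2*r}" for a
    using mentry_x_sub_mult[OF i g that b, of "-1"] by (simp add: v1_def)
  have v2: "v2 a = v1 a + (if step r i (a - 1) then v1 (a - 1) else 0)" if "a \<in> {1..2*r}" for a
    using mentry_y_sub_mult[OF i mx[OF g] that b, of 1] by (simp add: v1_def v2_def)
  have v3: "mentry (s_rep r i * g) a b = v2 a - (if step r i a then v2 (Suc a) else 0)"
    using mentry_x_sub_mult[OF i my[OF mx[OF g]] a b, of "-1"] unfolding eq by (simp add: v2_def)
  consider "step r i a" | "\<not> step r i a" "step r i (a - 1)" | "\<not> step r i a" "\<not> step r i (a - 1)" by blast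
  then show ?thesis
  proof cases
    case 1
    have a1: "Suc a \<in> {1..2*r}" using step_range[OF i 1] by simp
    have n: "\<not> step r i (Suc a)" "\<not> step r i (a - 1)"
      using step_Suc[OF i 1] step_Suc[OF i, of "a - 1"] 1 a by auto
    show ?thesis unfolding v3 using 1 n by (simp add: v2[OF a] v2[OF a1] v1[OF a] v1[OF a1])
  next
    case 2
    have a1: "a - 1 \<in> {1..2*r}" using step_pos[OF i 2(2)] a by auto
    have "Suc (a - 1) = a" using a by auto
    then show ?thesis unfolding v3 using 2 by (simp add: v2[OF a] v1[OF a] v1[OF a1, simplified])
  next
    case 3
    then show ?thesis unfolding v3 by (simp add: v2[OF a] v1[OF a])
  qed
qed

lemma s_rep_Sp: "i \<in> {1..r} \<Longrightarrow> s_rep r i \<in> carrier (Sp r)"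
  unfolding s_rep_def by (intro Sp_mult_closed x_sub_Sp y_sub_Sp)

text \<open>For \<open>i = r\<close> there is one arrow and \<open>minor_swp\<close> applies
  directly; for \<open>i < r\<close> the arrows are disjoint and it is applied twice.\<close>

lemma minor_s_rep:
  assumes i: "i \<in> {1..r}" and g: "g \<in> carrier_mat (2*r) (2*r)" and L: "L \<in> incl {1..2*r} d" "L' \<in> incl {1..2*r} d"
    and set: "set L' = sperm r i ` set L" and up: "\<And>a. step r i a \<Longrightarrow> Suc a \<in> set L \<Longrightarrow> a \<in> set L"
    and A: "length A = d" "set A \<subseteq> {1..2*r}"
  shows "minor (mentry (s_rep r i * g)) L' A = minor (mentry g) L A"
proof (cases "i = r")
  case True
  have st: "step r i a \<longleftrightarrow> a = r" for a using True by (simp add: step_def)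
  have "minor (mentry (s_rep r i * g)) L' A = minor (swp r (mentry g)) L' A"
  proof (rule minor_cong)
    fix x y assume "x \<in> set L'" "y \<in> set A"
    then have xy: "x \<in> {1..2*r}" "y \<in> {1..2*r}" using L A by (auto simp: incl_def)
    show "mentry (s_rep r i * g) x y = swp r (mentry g) x y"
      unfolding mentry_s_rep_mult[OF i g xy] st swp_def using xy(1) by auto
  qed (use L A in \<open>auto simp: incl_def\<close>)
  also have "\<dots> = minor (mentry g) L A"
  proof (rule minor_swp[OF L _ up A(1)])
    have "sperm r i x = transpose r (Suc r) x" if "x \<in> set L" for x
      using that L unfolding sperm_def st transpose_def by (auto simp: incl_def)
    then show "set L' = transpose r (Suc r) ` set L" unfolding set by (rule image_cong[OF refl])
  qed (simp add: st)
  finally show ?thesis .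
next
  case False
  define j where "j = 2 * r - i"
  have ij: "1 \<le> i" "Suc i < j" "Suc j \<le> 2 * r" using i False by (auto simp: j_def)
  have st: "step r i a \<longleftrightarrow> a = i \<or> a = j" for a by (simp add: step_def j_def)
  let ?ti = "transpose i (Suc i)" and ?tj = "transpose j (Suc j)"
  \<comment> \<open>The row set between the two exchanges, after the mirror arrow at
    \<open>j\<close> has acted.\<close>
  define K where "K = sorted_list_of_set (?tj ` set L)"
  have Lset: "set L \<subseteq> {1..2*r}" "length L = d" "distinct L" using L by (auto simp: incl_def strict_sorted_iff)
  have tj: "x \<in> {1..2*r} \<Longrightarrow> ?tj x \<in> {1..2*r}" for x using ij by (auto simp: transpose_def)
  have setK: "set K = ?tj ` set L" by (simp add: K_def)
  have "card (?tj ` set L) = d" using Lset by (simp add: card_image distinct_card)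
  then have K: "K \<in> incl {1..2*r} d"
    unfolding incl_def K_def using Lset tj by auto
  have "minor (mentry (s_rep r i * g)) L' A = minor (swp i (swp j (mentry g))) L' A"
  proof (rule minor_cong)
    fix x y assume "x \<in> set L'" "y \<in> set A"
    then have xy: "x \<in> {1..2*r}" "y \<in> {1..2*r}" using L A by (auto simp: incl_def)
    show "mentry (s_rep r i * g) x y = swp i (swp j (mentry g)) x y"
      unfolding mentry_s_rep_mult[OF i g xy] st swp_def using xy(1) ij by auto
  qed (use L A in \<open>auto simp: incl_def\<close>)
  also have "\<dots> = minor (swp j (mentry g)) K A"
  proof (rule minor_swp[OF K L(2) _ _ A(1)])
    have "sperm r i x = ?ti (?tj x)" if "x \<in> set L" for x
    proof -
      have x: "1 \<le> x" using that Lset(1) by auto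
      have pred: "x - 1 = i \<longleftrightarrow> x = Suc i" "x - 1 = j \<longleftrightarrow> x = Suc j" using x by auto
      have d: "j \<noteq> i" "Suc j \<noteq> i" "j \<noteq> Suc i" using ij by auto
      consider "x = i" | "x = Suc i" | "x = j" | "x = Suc j" | "x \<noteq> i" "x \<noteq> Suc i" "x \<noteq> j" "x \<noteq> Suc j" by blast
      then show ?thesis
        unfolding sperm_def st pred transpose_def by cases (simp_all add: d d[symmetric])
    qed
    then show "set L' = ?ti ` set K" unfolding set setK image_image by (rule image_cong[OF refl])
    have fix_i: "?tj x = x" if "x = i \<or> x = Suc i" for x using that ij by (auto simp: transpose_def)
    assume "Suc i \<in> set K"
    then have "Suc i \<in> set L" unfolding setK using fix_i by (metis imageE transpose_involutory)
    then have "i \<in> set L" using up st by blast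
    then show "i \<in> set K" unfolding setK using fix_i by (metis imageI)
  qed
  also have "\<dots> = minor (mentry g) L A"
    by (rule minor_swp[OF L(1) K setK _ A(1)]) (use up st in blast)
  finally show ?thesis .
qed

section \<open>Words in the simple reflections\<close>

definition wmat :: "nat \<Rightarrow> nat list \<Rightarrow> complex mat" where
  "wmat r js = gprod (Sp r) (map (s_rep r) js)"

definition wperm :: "nat \<Rightarrow> nat list \<Rightarrow> nat \<Rightarrow> nat" where
  "wperm r js = foldr (\<lambda>i f. sperm r i \<circ> f) js id"

lemma wperm_simps[simp]: "wperm r [] = id" "wperm r (i # js) = sperm r i \<circ> wperm r js"
  by (simp_all add: wperm_def)

lemma wperm_append: "wperm r (is @ js) = wperm r is \<circ> wperm r js"
  by (induction "is") (simp_all add: o_assoc)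

lemma wmat_simps[simp]: "wmat r [] = 1\<^sub>m (2*r)" "wmat r (i # js) = s_rep r i * wmat r js"
  by (simp_all add: wmat_def)

lemma wmat_Sp: "set js \<subseteq> {1..r} \<Longrightarrow> wmat r js \<in> carrier (Sp r)"
  by (induction js) (auto intro!: one_Sp Sp_mult_closed s_rep_Sp)

lemma wperm_range: "set js \<subseteq> {1..r} \<Longrightarrow> a \<in> {1..2*r} \<Longrightarrow> wperm r js a \<in> {1..2*r}"
proof (induction js)
  case (Cons i js)
  then have "i \<in> {1..r}" "wperm r js a \<in> {1..2*r}" by auto
  from sperm_range[OF this] show ?case by simp
qed simp

lemma inj_wperm: "set js \<subseteq> {1..r} \<Longrightarrow> inj (wperm r js)"
proof (induction js)
  case (Cons i js)
  have "inj (sperm r i)" by (rule inj_on_inverseI[of _ "sperm r i"]) (use Cons.prems in \<open>simp add: sperm_sperm\<close>)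
  moreover have "inj (wperm r js)" using Cons by simp
  ultimately show ?case unfolding wperm_simps by (rule inj_compose)
qed simp

lemma wperm_surj: assumes "set js \<subseteq> {1..r}" shows "wperm r js ` {1..2*r} = {1..2*r}"
  by (rule endo_inj_surj) (use assms wperm_range inj_wperm[THEN inj_on_subset] in blast)+

text \<open>The reflection in the Weyl group exchanging \<open>x\<close> with \<open>y\<close> and
  at the same time their mirror images.\<close>

definition reflect :: "nat \<Rightarrow> nat \<Rightarrow> nat \<Rightarrow> nat \<Rightarrow> nat" where
  "reflect r x y c = (if c = x then y else if c = y then x
     else if c = 2 * r + 1 - x then 2 * r + 1 - y else if c = 2 * r + 1 - y then 2 * r + 1 - x else c)"

text \<open>Conjugating a reflection by a simple one gives the reflection of the moved pair, because
  \<open>sperm\<close> commutes with taking mirror images.\<close>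

lemma sperm_reflect:
  assumes i: "i \<in> {1..r}" and x: "x \<in> {1..2*r}" and y: "y \<in> {1..2*r}" and c: "c \<in> {1..2*r}"
  shows "sperm r i (reflect r x y c) = reflect r (sperm r i x) (sperm r i y) (sperm r i c)"
proof -
  have inj: "sperm r i u = sperm r i v \<longleftrightarrow> u = v" for u v by (metis i sperm_sperm)
  have b: "sperm r i (2 * r + 1 - u) = 2 * r + 1 - sperm r i u" if "u \<in> {1..2*r}" for u
    by (rule sperm_bar[OF i that])
  show ?thesis unfolding reflect_def b[OF x, symmetric] b[OF y, symmetric] inj by simp
qed

lemma sperm_eq_reflect:
  assumes i: "i \<in> {1..r}" and x: "step r i x" and c: "c \<in> {1..2*r}"
  shows "sperm r i c = reflect r x (Suc x) c"
proof -
  have x': "1 \<le> x" "Suc x \<le> 2 * r" using step_range[OF i x] step_pos[OF i x] by auto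
  have st: "step r i a \<longleftrightarrow> a = x \<or> a = 2 * r - x" for a
    using x i by (auto simp: step_def)
  define x2 where "x2 = 2 * r - x"
  have e: "2 * r + 1 - x = Suc x2" "2 * r + 1 - Suc x = x2" "2 * r - x = x2" using x' by (auto simp: x2_def)
  have pred: "c - 1 = z \<longleftrightarrow> c = Suc z" for z using c by auto
  have n: "x \<noteq> Suc x2" "Suc x \<noteq> x2" using x' unfolding x2_def by presburger+
  show ?thesis unfolding sperm_def st pred reflect_def e using n by auto
qed

text \<open>A simple reflection moves indices by at most one, so it reverses only the order of the
  two ends of an arrow.\<close>

lemma sperm_order:
  assumes "i \<in> {1..r}" "x \<in> {1..2*r}" "x < y" "sperm r i y \<le> sperm r i x"
  shows "y = Suc x \<and> step r i x"
proof -
  have "sperm r i x \<noteq> sperm r i y" using assms(1,3) by (metis less_irrefl sperm_sperm)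
  then have lt: "sperm r i y < sperm r i x" using assms(4) by simp
  have "sperm r i x \<le> Suc x" "y - 1 \<le> sperm r i y" by (auto simp: sperm_def)
  then have "y \<le> Suc x \<or> sperm r i x = x" using lt assms(3) unfolding sperm_def by (auto split: if_splits)
  show ?thesis
  proof (cases "step r i x")
    case True
    then have sx: "sperm r i x = Suc x" by (simp add: sperm_def)
    show ?thesis
    proof (rule ccontr)
      assume "\<not> (y = Suc x \<and> step r i x)"
      then have "Suc (Suc x) \<le> y" using True assms(3) by simp
      moreover have "sperm r i y = y - 1" "step r i (y - 1)"
        using lt sx \<open>Suc (Suc x) \<le> y\<close> by (auto simp: sperm_def split: if_splits)
      moreover have "y = Suc (Suc x)" using lt sx calculation by simp
      ultimately show False using step_Suc[OF assms(1) True] by simp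
    qed
  next
    case False
    then have "sperm r i x \<le> x" by (auto simp: sperm_def)
    then have "sperm r i y < x" using lt by simp
    then show ?thesis using assms(3) \<open>y - 1 \<le> sperm r i y\<close> by simp
  qed
qed

text \<open>The exchange condition. Going through the word from its left end: as long as the
  remaining letters already invert the pair, the reflection is conjugated past the letter; at the
  letter that creates the inversion it equals that simple reflection and cancels it.\<close>

lemma exchange:
  assumes "set js \<subseteq> {1..r}" "a < b" "a \<in> {1..2*r}" "b \<in> {1..2*r}" "wperm r js b < wperm r js a"
  shows "\<exists>js'. length js' < length js \<and> set js' \<subseteq> {1..r} \<and>
    (\<forall>c\<in>{1..2*r}. reflect r (wperm r js b) (wperm r js a) (wperm r js c) = wperm r js' c)"
  using assms(1,5)
proof (induction js)
  case Nil
  then show ?case using assms(2) by simp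
next
  case (Cons k ks)
  have k: "k \<in> {1..r}" and ks: "set ks \<subseteq> {1..r}" using Cons.prems(1) by auto
  let ?x = "wperm r ks b" and ?y = "wperm r ks a"
  have xy: "?x \<in> {1..2*r}" "?y \<in> {1..2*r}" using wperm_range[OF ks] assms by auto
  show ?case
  proof (cases "?x < ?y")
    case True
    then obtain js' where js': "length js' < length ks" "set js' \<subseteq> {1..r}"
      "\<And>c. c \<in> {1..2*r} \<Longrightarrow> reflect r ?x ?y (wperm r ks c) = wperm r js' c"
      using Cons.IH[OF ks] by blast
    have "reflect r (wperm r (k # ks) b) (wperm r (k # ks) a) (wperm r (k # ks) c) = wperm r (k # js') c"
      if c: "c \<in> {1..2*r}" for c
      using sperm_reflect[OF k xy wperm_range[OF ks c]] js'(3)[OF c] by simp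
    then show ?thesis using js'(1,2) k by (intro exI[of _ "k # js'"]) auto
  next
    case False
    have "?x \<noteq> ?y" using inj_wperm[OF ks] assms(2) by (metis injD less_irrefl)
    then have "?y < ?x" using False by simp
    moreover have "sperm r k ?x \<le> sperm r k ?y" using Cons.prems(2) by simp
    ultimately have s: "?x = Suc ?y" "step r k ?y" using sperm_order[OF k xy(2)] by blast+
    have v: "sperm r k ?x = ?y" "sperm r k ?y = ?x"
      using s step_Suc[OF k s(2)] by (simp_all add: sperm_def)
    have "reflect r (wperm r (k # ks) b) (wperm r (k # ks) a) (wperm r (k # ks) c) = wperm r ks c"
      if c: "c \<in> {1..2*r}" for c
    proof -
      have w: "wperm r (k # ks) c \<in> {1..2*r}" by (rule wperm_range[OF Cons.prems(1) c])
      have "reflect r ?y (Suc ?y) (wperm r (k # ks) c) = sperm r k (wperm r (k # ks) c)"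
        by (rule sperm_eq_reflect[OF k s(2) w, symmetric])
      then show ?thesis using v s(1) by (simp add: sperm_sperm[OF k])
    qed
    then show ?thesis using ks by (intro exI[of _ ks]) auto
  qed
qed

text \<open>Words act as monomial matrices. The form with a right factor \<open>g\<close> allows the
  identity and inverses to be inserted directly.\<close>

lemma wmat_monomial:
  assumes "set js \<subseteq> {1..r}"
  shows "\<exists>\<epsilon>. \<forall>a\<in>{1..2*r}. \<epsilon> a \<noteq> 0 \<and> (\<forall>g\<in>carrier_mat (2*r) (2*r). \<forall>b\<in>{1..2*r}.
    mentry (wmat r js * g) (wperm r js a) b = \<epsilon> a * mentry g a b)"
  using assms
proof (induction js)
  case Nil
  show ?case by (rule exI[of _ "\<lambda>_. 1"]) simp
next
  case (Cons i js)
  have i: "i \<in> {1..r}" and js: "set js \<subseteq> {1..r}" using Cons.prems by auto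
  obtain \<epsilon> where \<epsilon>: "\<And>a. a \<in> {1..2*r} \<Longrightarrow> \<epsilon> a \<noteq> 0"
    "\<And>a g b. a \<in> {1..2*r} \<Longrightarrow> g \<in> carrier_mat (2*r) (2*r) \<Longrightarrow> b \<in> {1..2*r} \<Longrightarrow>
       mentry (wmat r js * g) (wperm r js a) b = \<epsilon> a * mentry g a b"
    using Cons.IH[OF js] by blast
  \<comment> \<open>A letter changes the sign exactly for the rows that it moves up, from the target
    of an arrow to its source.\<close>
  define \<delta> where "\<delta> a = (if step r i (wperm r js a) then \<epsilon> a else if step r i (wperm r js a - 1) then - \<epsilon> a else \<epsilon> a)" for a
  have "mentry (wmat r (i # js) * g) (wperm r (i # js) a) b = \<delta> a * mentry g a b"
    if a: "a \<in> {1..2*r}" and g: "g \<in> carrier_mat (2*r) (2*r)" and b: "b \<in> {1..2*r}" for a g b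
  proof -
    let ?c = "wperm r js a"
    have c: "?c \<in> {1..2*r}" by (rule wperm_range[OF js a])
    note wc = Sp_carrier_mat[OF wmat_Sp[OF js]] and sc = Sp_carrier_mat[OF s_rep_Sp[OF i]]
    have "wmat r (i # js) * g = s_rep r i * (wmat r js * g)"
      using wc sc g by simp
    then have e: "mentry (wmat r (i # js) * g) (sperm r i ?c) b = (if step r i (sperm r i ?c) then - mentry (wmat r js * g) (Suc (sperm r i ?c)) b
        else if step r i (sperm r i ?c - 1) then mentry (wmat r js * g) (sperm r i ?c - 1) b
        else mentry (wmat r js * g) (sperm r i ?c) b)"
      using mentry_s_rep_mult[OF i mult_carrier_mat[OF wc g] sperm_range[OF i c] b] by simp
    consider "step r i ?c" | "\<not> step r i ?c" "step r i (?c - 1)" | "\<not> step r i ?c" "\<not> step r i (?c - 1)" by blast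
    then have "mentry (wmat r (i # js) * g) (sperm r i ?c) b = (if step r i ?c then 1 else if step r i (?c - 1) then -1 else 1) * mentry (wmat r js * g) ?c b"
    proof cases
      case 1
      then show ?thesis unfolding e using step_Suc[OF i 1] by (simp add: sperm_def)
    next
      case 2
      moreover have "Suc (?c - 1) = ?c" using c by simp
      ultimately show ?thesis unfolding e by (simp add: sperm_def)
    next
      case 3
      then show ?thesis unfolding e by (simp add: sperm_def)
    qed
    then show ?thesis using \<epsilon>(2)[OF a g b] by (simp add: \<delta>_def)
  qed
  moreover have "\<delta> a \<noteq> 0" if "a \<in> {1..2*r}" for a using \<epsilon>(1)[OF that] by (simp add: \<delta>_def)
  ultimately show ?case by blast
qed

text \<open>Two monomial matrices with the same underlying permutation differ by a diagonal
  factor.\<close>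

lemma wmat_coset:
  assumes js: "set js \<subseteq> {1..r}" "set js' \<subseteq> {1..r}" and eq: "\<And>c. c \<in> {1..2*r} \<Longrightarrow> wperm r js c = wperm r js' c"
  shows "wmat r js * sp_inv r (wmat r js') \<in> torus r"
proof (rule torusI)
  note S = wmat_Sp[OF js(1)] wmat_Sp[OF js(2)]
  let ?g = "sp_inv r (wmat r js')"
  have g: "?g \<in> carrier_mat (2*r) (2*r)" using sp_inv_carrier[OF Sp_carrier_mat[OF S(2)]] .
  show "wmat r js * ?g \<in> carrier (Sp r)" by (rule Sp_mult_closed[OF S(1) sp_inv_Sp[OF S(2)]])
  fix c b assume cb: "c \<in> {1..2*r}" "b \<in> {1..2*r}" "c \<noteq> b"
  then obtain a where a: "a \<in> {1..2*r}" "c = wperm r js a" using wperm_surj[OF js(1)] by blast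
  obtain \<epsilon>' where \<epsilon>': "\<epsilon>' a \<noteq> 0" "mentry (wmat r js' * ?g) (wperm r js' a) b = \<epsilon>' a * mentry ?g a b"
    using wmat_monomial[OF js(2)] a(1) g cb(2) by metis
  have "mentry (wmat r js' * ?g) (wperm r js' a) b = 0"
    using cb a eq[OF a(1)] by (simp add: sp_inv_right[OF S(2)] mentry_one)
  then have "mentry ?g a b = 0" using \<epsilon>' by simp
  moreover obtain \<epsilon> where "mentry (wmat r js * ?g) (wperm r js a) b = \<epsilon> a * mentry ?g a b"
    using wmat_monomial[OF js(1)] a(1) g cb(2) by metis
  ultimately show "mentry (wmat r js * ?g) c b = 0" using a(2) by simp
qed

lemma wmat_coset_conv:
  assumes js: "set js \<subseteq> {1..r}" "set js' \<subseteq> {1..r}" and h: "h \<in> torus r" "wmat r js = h * wmat r js'" and c: "c \<in> {1..2*r}"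
  shows "wperm r js c = wperm r js' c"
proof -
  note S = wmat_Sp[OF js(1)] wmat_Sp[OF js(2)]
  note Sc = Sp_carrier_mat[OF S(1)] Sp_carrier_mat[OF S(2)]
  have hc: "h \<in> carrier_mat (2*r) (2*r)" using h(1) torus_Sp Sp_carrier_mat by blast
  let ?d = "wperm r js c"
  have d: "?d \<in> {1..2*r}" by (rule wperm_range[OF js(1) c])
  obtain \<epsilon> where \<epsilon>: "\<epsilon> c \<noteq> 0" "mentry (wmat r js * 1\<^sub>m (2*r)) ?d c = \<epsilon> c * mentry (1\<^sub>m (2*r)) c c"
    using wmat_monomial[OF js(1)] c one_carrier_mat by metis
  then have "mentry (wmat r js) ?d c \<noteq> 0" using c Sc(1) by (simp add: mentry_one)
  moreover have "mentry (wmat r js) ?d c = mentry h ?d ?d * mentry (wmat r js') ?d c"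
  proof -
    have "mentry (wmat r js) ?d c = (\<Sum>k\<in>{1..2*r}. mentry h ?d k * mentry (wmat r js') k c)"
      unfolding h(2) by (rule mentry_mult[OF hc Sc(2) d c])
    also have "\<dots> = (\<Sum>k\<in>{1..2*r}. if k = ?d then mentry h ?d ?d * mentry (wmat r js') ?d c else 0)"
    proof (rule sum.cong[OF refl])
      fix k assume k: "k \<in> {1..2*r}"
      show "mentry h ?d k * mentry (wmat r js') k c = (if k = ?d then mentry h ?d ?d * mentry (wmat r js') ?d c else 0)"
        using torus_offdiag[OF h(1) d k] by (cases "k = ?d") auto
    qed
    finally show ?thesis using d by simp
  qed
  ultimately have nz: "mentry (wmat r js') ?d c \<noteq> 0" by auto
  obtain a where a: "a \<in> {1..2*r}" "?d = wperm r js' a" using wperm_surj[OF js(2)] d by (metis imageE)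
  obtain \<epsilon>' where "mentry (wmat r js' * 1\<^sub>m (2*r)) (wperm r js' a) c = \<epsilon>' a * mentry (1\<^sub>m (2*r)) a c"
    using wmat_monomial[OF js(2)] a c one_carrier_mat by metis
  then have "mentry (wmat r js') ?d c = \<epsilon>' a * (if a = c then 1 else 0)"
    using a c Sc(2) by (simp add: mentry_one)
  then have "a = c" using nz by (auto split: if_splits)
  then show ?thesis using a(2) by simp
qed

lemma s_rep_normalizes_torus:
  assumes i: "i \<in> {1..r}" and h: "h \<in> torus r"
  shows "s_rep r i * h * sp_inv r (s_rep r i) \<in> torus r"
proof (rule torusI)
  have js: "set [i] \<subseteq> {1..r}" using i by simp
  let ?s = "s_rep r i"
  note sS = s_rep_Sp[OF i] and sc = Sp_carrier_mat[OF s_rep_Sp[OF i]]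
  have hS: "h \<in> carrier (Sp r)" using h torus_Sp by blast
  note hc = Sp_carrier_mat[OF hS] and ic = sp_inv_carrier[OF sc]
  have ws: "wmat r [i] = ?s" using sc by simp
  show "?s * h * sp_inv r ?s \<in> carrier (Sp r)"
    by (intro Sp_mult_closed sp_inv_Sp sS hS)
  fix c b assume cb: "c \<in> {1..2*r}" "b \<in> {1..2*r}" "c \<noteq> b"
  then obtain a where a: "a \<in> {1..2*r}" "c = wperm r [i] a" using wperm_surj[OF js] by blast
  obtain \<epsilon> where \<epsilon>: "\<epsilon> a \<noteq> 0" "\<And>g. g \<in> carrier_mat (2*r) (2*r) \<Longrightarrow> mentry (?s * g) c b = \<epsilon> a * mentry g a b"
    using wmat_monomial[OF js] a cb(2) unfolding ws by metis
  have "mentry (sp_inv r ?s) a b = 0"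
    using \<epsilon>(2)[OF ic] \<epsilon>(1) cb by (simp add: sp_inv_right[OF sS] mentry_one)
  moreover have "mentry (h * sp_inv r ?s) a b = (\<Sum>k\<in>{1..2*r}. mentry h a k * mentry (sp_inv r ?s) k b)"
    by (rule mentry_mult[OF hc ic a(1) cb(2)])
  moreover have "mentry h a k * mentry (sp_inv r ?s) k b = 0" if "k \<in> {1..2*r}" for k
    using torus_offdiag[OF h a(1) that] calculation(1) by (cases "k = a") auto
  ultimately have "mentry (h * sp_inv r ?s) a b = 0" by simp
  then show "mentry (?s * h * sp_inv r ?s) c b = 0"
    using \<epsilon>(2)[OF mult_carrier_mat[OF hc ic]] assoc_mult_mat[OF sc hc ic] by simp
qed

section \<open>The Weyl group modulo the torus\<close>

lemma weyl_simps: "\<one>\<^bsub>weyl r\<^esub> = torus r"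
  "X \<otimes>\<^bsub>weyl r\<^esub> Y = {x * y | x y. x \<in> X \<and> y \<in> Y}"
  unfolding weyl_def FactGroup_def set_mult_def by auto

lemma torus_coset: "torus r #>\<^bsub>Sp r\<^esub> g = {h * g | h. h \<in> torus r}"
  by (auto simp: r_coset_def)

lemma weyl_word_eq:
  assumes "set js \<subseteq> {1..r}"
  shows "weyl_word r js = {h * wmat r js | h. h \<in> torus r}"
  using assms
proof (induction js)
  case Nil
  have "h * 1\<^sub>m (2*r) = h" if "h \<in> torus r" for h
    using that torus_Sp Sp_carrier_mat by (metis right_mult_one_mat subsetD)
  then show ?case by (force simp: weyl_word_def weyl_simps)
next
  case (Cons i js)
  have i: "i \<in> {1..r}" and js: "set js \<subseteq> {1..r}" using Cons.prems by auto
  let ?s = "s_rep r i" and ?w = "wmat r js"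
  note sc = Sp_carrier_mat[OF s_rep_Sp[OF i]] and wc = Sp_carrier_mat[OF wmat_Sp[OF js]]
  have tc: "h \<in> carrier_mat (2*r) (2*r)" if "h \<in> torus r" for h using that torus_Sp Sp_carrier_mat by blast
  have "weyl_word r (i # js) = {x * y | x y. x \<in> {h * ?s | h. h \<in> torus r} \<and> y \<in> {h * ?w | h. h \<in> torus r}}"
    using Cons.IH[OF js] by (simp add: weyl_word_def weyl_simps simple_refl_def torus_coset)
  also have "\<dots> = {h * (?s * ?w) | h. h \<in> torus r}"
  proof (intro Set.equalityI subsetI)
    fix z assume "z \<in> {x * y | x y. x \<in> {h * ?s | h. h \<in> torus r} \<and> y \<in> {h * ?w | h. h \<in> torus r}}"
    then obtain h h' where h: "h \<in> torus r" "h' \<in> torus r" "z = h * ?s * (h' * ?w)" by blast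
    \<comment> \<open>The torus factor that appears on the left when \<open>h'\<close> is moved past
      the representative.\<close>
    define t where "t = ?s * h' * sp_inv r ?s"
    have t: "t \<in> torus r" unfolding t_def by (rule s_rep_normalizes_torus[OF i h(2)])
    note ic = sp_inv_carrier[OF sc]
    have "t * ?s = ?s * h' * (sp_inv r ?s * ?s)"
      unfolding t_def using sc ic tc[OF h(2)] by (simp add: square_mult)
    then have "t * ?s = ?s * h'"
      using sc tc[OF h(2)] by (simp add: sp_inv_left[OF s_rep_Sp[OF i]] mult_carrier_mat[of _ "2*r" "2*r"])
    moreover have "z = h * (?s * h') * ?w"
      unfolding h(3) using sc wc tc[OF h(1)] tc[OF h(2)]
      by (simp add: square_mult)
    ultimately have "z = h * (t * ?s) * ?w" by simp
    then have "z = h * t * (?s * ?w)"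
      using sc wc tc[OF h(1)] tc[OF t] by (simp add: square_mult)
    then show "z \<in> {h * (?s * ?w) | h. h \<in> torus r}" using torus_mult[OF h(1) t] by blast
  next
    fix z assume "z \<in> {h * (?s * ?w) | h. h \<in> torus r}"
    then obtain h where h: "h \<in> torus r" "z = h * (?s * ?w)" by blast
    then have "z = h * ?s * (1\<^sub>m (2*r) * ?w)" using sc wc tc[OF h(1)] by simp
    then show "z \<in> {x * y | x y. x \<in> {h * ?s | h. h \<in> torus r} \<and> y \<in> {h * ?w | h. h \<in> torus r}}"
      using h(1) torus_one by blast
  qed
  finally show ?case by simp
qed

text \<open>Equality in the Weyl group becomes equality of permutations, so the length arguments can
  be carried out on \<open>J\<close>.\<close>

lemma weyl_word_eq_iff:
  assumes js: "set js \<subseteq> {1..r}" "set js' \<subseteq> {1..r}"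
  shows "weyl_word r js = weyl_word r js' \<longleftrightarrow> (\<forall>c\<in>{1..2*r}. wperm r js c = wperm r js' c)"
proof
  note S = wmat_Sp[OF js(1)] wmat_Sp[OF js(2)]
  note Sc = Sp_carrier_mat[OF S(1)] Sp_carrier_mat[OF S(2)]
  {
    assume "weyl_word r js = weyl_word r js'"
    moreover have "wmat r js \<in> weyl_word r js"
      unfolding weyl_word_eq[OF js(1)] using torus_one Sc(1) by force
    ultimately obtain h where "h \<in> torus r" "wmat r js = h * wmat r js'"
      unfolding weyl_word_eq[OF js(2)] by blast
    then show "\<forall>c\<in>{1..2*r}. wperm r js c = wperm r js' c" using wmat_coset_conv[OF js] by blast
  }
  have sub: "weyl_word r js \<subseteq> weyl_word r js'"
    if js: "set js \<subseteq> {1..r}" "set js' \<subseteq> {1..r}" and eq: "\<forall>c\<in>{1..2*r}. wperm r js c = wperm r js' c" for js js'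
  proof
    note S = wmat_Sp[OF js(1)] wmat_Sp[OF js(2)]
    note Sc = Sp_carrier_mat[OF S(1)] Sp_carrier_mat[OF S(2)]
    fix z assume "z \<in> weyl_word r js"
    then obtain h where h: "h \<in> torus r" "z = h * wmat r js" unfolding weyl_word_eq[OF js(1)] by blast
    define t where "t = wmat r js * sp_inv r (wmat r js')"
    have t: "t \<in> torus r" unfolding t_def using wmat_coset[OF js] eq by blast
    have tc: "h \<in> carrier_mat (2*r) (2*r)" if "h \<in> torus r" for h using that torus_Sp Sp_carrier_mat by blast
    have "t * wmat r js' = wmat r js"
      unfolding t_def using assoc_mult_mat[OF Sc(1) sp_inv_carrier[OF Sc(2)] Sc(2)] sp_inv_left[OF S(2)] Sc by simp
    then have "z = h * t * wmat r js'" using h(2) assoc_mult_mat[OF tc[OF h(1)] tc[OF t] Sc(2)] by simp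
    then show "z \<in> weyl_word r js'" unfolding weyl_word_eq[OF js(2)] using torus_mult[OF h(1) t] by blast
  qed
  assume "\<forall>c\<in>{1..2*r}. wperm r js c = wperm r js' c"
  then show "weyl_word r js = weyl_word r js'" using sub[OF js] sub[OF js(2,1)] by (intro Set.equalityI) auto
qed


section \<open>Representatives by reduced words and their minors\<close>

lemma reduced_word_exists:
  assumes "set ws \<subseteq> {1..r}"
  shows "\<exists>js. reduced_word r js (weyl_word r ws)"
proof -
  let ?P = "\<lambda>js. set js \<subseteq> {1..r} \<and> weyl_word r js = weyl_word r ws"
  have "?P (arg_min length ?P) \<and> (\<forall>js. ?P js \<longrightarrow> length (arg_min length ?P) \<le> length js)"
    by (rule arg_min_nat_lemma[of ?P ws length]) (use assms in simp)
  then show ?thesis unfolding reduced_word_def by blast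
qed

lemma reduced_word_Cons:
  assumes "reduced_word r (i # js) w"
  shows "reduced_word r js (weyl_word r js)"
  unfolding reduced_word_def
proof (intro conjI allI impI)
  have iw: "set (i # js) \<subseteq> {1..r}" "weyl_word r (i # js) = w"
    "\<And>js'. set js' \<subseteq> {1..r} \<Longrightarrow> weyl_word r js' = w \<Longrightarrow> length (i # js) \<le> length js'"
    using assms unfolding reduced_word_def by blast+
  then show "set js \<subseteq> {1..r}" by simp
  fix js' assume js': "set js' \<subseteq> {1..r} \<and> weyl_word r js' = weyl_word r js"
  then have "weyl_word r (i # js') = w" using iw(2) by (simp add: weyl_word_def)
  then show "length js \<le> length js'" using iw(3)[of "i # js'"] iw(1) js' by simp
qed simp

text \<open>A reduced word moves the set of the first \<open>d\<close> indices only upwards in the order of \<open>J\<close>, so no signs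
  arise and \<open>wmat r js\<close> maps the highest weight vector to the basis vector of the extremal weight.\<close>

lemma minor_reduced_word:
  assumes "reduced_word r js w" "d \<le> r" "g \<in> carrier (Sp r)"
    and "L \<in> incl {1..2*r} d" "set L = wperm r js ` {1..d}"
  shows "minor (mentry (wmat r js * g)) L (path_start d) = lead g d"
  using assms(1,4,5)
proof (induction js arbitrary: w L)
  case Nil
  have "path_start d \<in> incl {1..2*r} d" using assms(2) by (intro path_start_incl) simp
  then have "L = path_start d" using Nil by (intro incl_eqI[of L "{1..2*r}" d]) (auto simp: path_start_simps)
  then show ?case using Sp_carrier_mat[OF assms(3)] by (simp add: lead_def)
next
  case (Cons i js)
  have red: "set (i # js) \<subseteq> {1..r}" "weyl_word r (i # js) = w"
    "\<And>js'. set js' \<subseteq> {1..r} \<Longrightarrow> weyl_word r js' = w \<Longrightarrow> length (i # js) \<le> length js'"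
    using Cons.prems(1) unfolding reduced_word_def by blast+
  have i: "i \<in> {1..r}" and js: "set js \<subseteq> {1..r}" using red(1) by auto
  define S where "S = wperm r js ` {1..d}"
  define K where "K = sorted_list_of_set S"
  have dr: "{1..d} \<subseteq> {1..2*r}" using assms(2) by auto
  have Ssub: "S \<subseteq> {1..2*r}" unfolding S_def using wperm_range[OF js] dr by blast
  have "card S = d" unfolding S_def using inj_wperm[OF js] by (simp add: card_image inj_on_subset)
  moreover have "finite S" unfolding S_def by simp
  ultimately have K: "K \<in> incl {1..2*r} d" "set K = S"
    unfolding incl_def K_def using Ssub by auto
  have IH: "minor (mentry (wmat r js * g)) K (path_start d) = lead g d"
    using Cons.IH[OF reduced_word_Cons[OF Cons.prems(1)] K(1)] K(2) by (simp add: S_def)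
  have up: "x \<in> S" if x: "step r i x" "Suc x \<in> S" for x
  proof (rule ccontr)
    assume xS: "x \<notin> S"
    have xr: "x \<in> {1..2*r}" using step_range[OF i x(1)] step_pos[OF i x(1)] by auto
    obtain a where a: "a \<in> {1..d}" "Suc x = wperm r js a" using x(2) unfolding S_def by blast
    obtain b where b: "b \<in> {1..2*r}" "x = wperm r js b" using xr wperm_surj[OF js] by blast
    have "b \<notin> {1..d}" using xS b(2) unfolding S_def by blast
    then have ab: "a < b" "a \<in> {1..2*r}" using a(1) b(1) dr by auto
    have inv: "wperm r js b < wperm r js a" using a(2) b(2) by simp
    \<comment> \<open>The reflection exchanging \<open>x\<close> and \<open>Suc x\<close> is the
      simple one with index \<open>i\<close>, so the exchange produces a word for
      \<open>i # js\<close> shorter than \<open>js\<close>, against reducedness.\<close>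
    obtain js' where js': "length js' < length js" "set js' \<subseteq> {1..r}"
      "\<And>c. c \<in> {1..2*r} \<Longrightarrow> reflect r x (Suc x) (wperm r js c) = wperm r js' c"
      using exchange[OF js ab b(1) inv] unfolding a(2)[symmetric] b(2)[symmetric] by blast
    have "wperm r (i # js) c = wperm r js' c" if c: "c \<in> {1..2*r}" for c
      using js'(3)[OF c] sperm_eq_reflect[OF i x(1) wperm_range[OF js c]] by simp
    then have "weyl_word r js' = w"
      using weyl_word_eq_iff[OF red(1) js'(2)] red(2) by blast
    then show False using red(3)[OF js'(2)] js'(1) by simp
  qed
  have wc: "wmat r js * g \<in> carrier_mat (2*r) (2*r)"
    by (rule mult_carrier_mat[OF Sp_carrier_mat[OF wmat_Sp[OF js]] Sp_carrier_mat[OF assms(3)]])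
  have "set L = sperm r i ` set K"
    unfolding Cons.prems(3) K(2) S_def wperm_simps image_comp ..
  then have "minor (mentry (s_rep r i * (wmat r js * g))) L (path_start d) = minor (mentry (wmat r js * g)) K (path_start d)"
    using up K(2) dr by (intro minor_s_rep[OF i wc K(1) Cons.prems(2)]) (auto simp: path_start_simps)
  moreover have "wmat r (i # js) * g = s_rep r i * (wmat r js * g)"
    using assoc_mult_mat[OF Sp_carrier_mat[OF s_rep_Sp[OF i]] Sp_carrier_mat[OF wmat_Sp[OF js]] Sp_carrier_mat[OF assms(3)]] by simp
  ultimately show ?case using IH by simp
qed

lemma weyl_rep_word:
  assumes ws: "set ws \<subseteq> {1..r}"
  obtains js where "reduced_word r js (weyl_word r ws)" "weyl_rep r (weyl_word r ws) = wmat r js"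
    "set js \<subseteq> {1..r}" "\<And>c. c \<in> {1..2*r} \<Longrightarrow> wperm r js c = wperm r ws c"
proof -
  let ?js = "SOME js. reduced_word r js (weyl_word r ws)"
  have red: "reduced_word r ?js (weyl_word r ws)"
    using reduced_word_exists[OF ws] by (rule someI_ex)
  then have js: "set ?js \<subseteq> {1..r}" "weyl_word r ?js = weyl_word r ws" unfolding reduced_word_def by blast+
  have "weyl_rep r (weyl_word r ws) = wmat r ?js" by (simp add: weyl_rep_def wmat_def)
  then show ?thesis using that[of ?js] red js weyl_word_eq_iff[OF js(1) ws] by blast
qed

lemma weyl_rep_one: "weyl_rep r \<one>\<^bsub>weyl r\<^esub> = 1\<^sub>m (2*r)"
proof -
  have one: "\<one>\<^bsub>weyl r\<^esub> = weyl_word r []" by (simp add: weyl_word_def)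
  obtain js where js: "reduced_word r js (weyl_word r [])" "weyl_rep r (weyl_word r []) = wmat r js"
    by (rule weyl_rep_word[of "[]" r]) auto
  have "length js \<le> length ([] :: nat list)"
    using js(1) unfolding reduced_word_def by (metis empty_subsetI list.set(1))
  then show ?thesis using js(2) one by simp
qed

lemma gen_minor_weyl_word:
  assumes ws: "set ws \<subseteq> {1..r}" and d: "d \<in> {1..r}" and I: "I \<in> incl {1..2*r} d" "set I = wperm r ws ` {1..d}"
    and g: "g \<in> carrier (Sp r)"
  shows "gen_minor r (weyl_word r ws) \<one>\<^bsub>weyl r\<^esub> d g = minor (mentry g) I (path_start d)"
proof -
  obtain js where js: "reduced_word r js (weyl_word r ws)" "weyl_rep r (weyl_word r ws) = wmat r js"
    "set js \<subseteq> {1..r}" "\<And>c. c \<in> {1..2*r} \<Longrightarrow> wperm r js c = wperm r ws c"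
    using weyl_rep_word[OF ws] by metis
  have "wperm r js ` {1..d} = wperm r ws ` {1..d}"
    using d by (intro image_cong refl js(4)) auto
  then have "minor (mentry (weyl_rep r (weyl_word r ws) * g)) I (path_start d) = lead g d"
    if "g \<in> carrier (Sp r)" for g
    unfolding js(2) using minor_reduced_word[OF js(1) _ that I(1)] I(2) d by simp
  then have "gen_minor r (weyl_word r ws) \<one>\<^bsub>weyl r\<^esub> d
      = restrict (\<lambda>g. minor (mentry g) I (path_start d)) (carrier (Sp r))"
    using I(1) d wmat_Sp[OF js(3)] js(2)
    by (intro gen_minor_eq weyl_rep_one) (auto simp: incl_def)
  then show ?thesis using g by simp
qed

text \<open>For \<open>j = r\<close> this is the Coxeter element: every unbarred index goes up by
  one and \<open>r\<close> goes to the barred 1. The incomplete cycles are recorded for the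
  induction, in which the last letter acts first.\<close>

lemma wperm_cycle:
  assumes "j \<le> r" "a \<in> {1..2*r}"
  shows "wperm r [1..<Suc j] a =
    (if a \<le> r then if a \<le> j then if a < r then a + 1 else 2 * r else if a = j + 1 then 1 else a
     else if 2 * r + 1 - a \<le> j then if a = r + 1 then 1 else a - 1
     else if 2 * r + 1 - a = j + 1 then 2 * r else a)"
  using assms
proof (induction j arbitrary: a)
  case 0
  then show ?case by auto
next
  case (Suc j)
  let ?F = "\<lambda>j a. if a \<le> r then if a \<le> j then if a < r then a + 1 else 2 * r else if a = j + 1 then 1 else a
     else if 2 * r + 1 - a \<le> j then if a = r + 1 then 1 else a - 1
     else if 2 * r + 1 - a = j + 1 then 2 * r else a"
  have J: "Suc j \<in> {1..r}" using Suc.prems by simp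
  have "[1..<Suc (Suc j)] = [1..<Suc j] @ [Suc j]" by simp
  then have "wperm r [1..<Suc (Suc j)] a = wperm r [1..<Suc j] (sperm r (Suc j) a)"
    by (simp only: wperm_append wperm_simps comp_apply id_apply)
  also have "\<dots> = ?F j (sperm r (Suc j) a)"
    using Suc.prems by (intro Suc.IH sperm_range[OF J]) auto
  also have "\<dots> = ?F (Suc j) a"
  proof -
    have st: "step r (Suc j) x \<longleftrightarrow> x = Suc j \<or> x = 2 * r - Suc j" for x by (simp add: step_def)
    have a: "1 \<le> a" "a \<le> 2 * r" "Suc j \<le> r" using Suc.prems by auto
    consider "a < Suc j" | "a = Suc j" "a < r" | "a = Suc j" "a = r" | "a = Suc (Suc j)" "a \<le> r" | "Suc (Suc j) < a" "a \<le> r"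
      | "r < a" "a < 2 * r - Suc j" | "r < a" "a = 2 * r - Suc j" | "r < a" "a = Suc (2 * r - Suc j)" | "r < a" "Suc (2 * r - Suc j) < a"
      by linarith
    then show ?thesis
    proof cases
      case 1
      then have "sperm r (Suc j) a = a" using a unfolding sperm_def st by auto
      then show ?thesis using 1 a by simp
    next
      case 2
      then have "sperm r (Suc j) a = Suc a" unfolding sperm_def st by simp
      then show ?thesis using 2 by simp
    next
      case 3
      then have "sperm r (Suc j) a = Suc a" unfolding sperm_def st by simp
      then show ?thesis using 3 by simp
    next
      case 4
      then have "sperm r (Suc j) a = Suc j" unfolding sperm_def st by auto
      then show ?thesis using 4 by simp
    next
      case 5
      then have "sperm r (Suc j) a = a" using a unfolding sperm_def st by auto
      then show ?thesis using 5 by simp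
    next
      case 6
      then have "sperm r (Suc j) a = a" using a unfolding sperm_def st by auto
      then show ?thesis using 6 a by auto
    next
      case 7
      then have "sperm r (Suc j) a = Suc a" unfolding sperm_def st by simp
      then show ?thesis using 7 a by auto
    next
      case 8
      then have "sperm r (Suc j) a = 2 * r - Suc j" using a unfolding sperm_def st by auto
      then show ?thesis using 8 a by auto
    next
      case 9
      then have "sperm r (Suc j) a = a" using a unfolding sperm_def st by auto
      then show ?thesis using 9 a by auto
    qed
  qed
  finally show ?case .
qed

section \<open>The theorem\<close>

lemma path_end_set:
  assumes "t \<le> r" "d \<in> {1..r}"
  shows "set (path_end r d t) = {a. t < a \<and> a \<le> r \<and> a \<le> t + d} \<union> {a. r < a \<and> a \<le> 2 * r \<and> 2 * r + 1 \<le> a + (d + t - r)}"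
proof (cases "r < t + d")
  case True
  have "bar r ` {1..d + t - r} = {a. r < a \<and> a \<le> 2 * r \<and> 2 * r + 1 \<le> a + (d + t - r)}"
  proof (intro Set.equalityI subsetI)
    fix a assume a: "a \<in> {a. r < a \<and> a \<le> 2 * r \<and> 2 * r + 1 \<le> a + (d + t - r)}"
    then have "a = bar r (2 * r + 1 - a)" "2 * r + 1 - a \<in> {1..d + t - r}" by (auto simp: bar_def)
    then show "a \<in> bar r ` {1..d + t - r}" by blast
  qed (use assms in \<open>auto simp: bar_def\<close>)
  moreover have "set (path_end r d t) = {t + 1..r} \<union> bar r ` {1..d + t - r}"
    using True by (simp add: path_end_def atLeastLessThanSuc_atLeastAtMost del: upt_Suc)
  ultimately show ?thesis using True by auto
next
  case False
  then show ?thesis by (auto simp: path_end_def)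
qed

lemma path_end_incl:
  assumes t: "t \<le> r" and d: "d \<in> {1..r}"
  shows "path_end r d t \<in> incl {1..2*r} d"
proof -
  have "sorted_wrt (<) (map (bar r) (rev [1..<Suc (d + t - r)]))"
    unfolding sorted_wrt_map sorted_wrt_rev
  proof (rule sorted_wrt_mono_rel[OF _ sorted_wrt_upt])
    fix x y assume "x \<in> set [1..<Suc (d + t - r)]" "y \<in> set [1..<Suc (d + t - r)]" "x < y"
    then show "bar r y < bar r x" using t d by (auto simp: bar_def)
  qed
  moreover have "x < y" if "x \<in> set [t + 1..<Suc r]" "y \<in> set (map (bar r) (rev [1..<Suc (d + t - r)]))" for x y
    using that t d by (auto simp: bar_def simp del: upt_Suc)
  ultimately have "sorted_wrt (<) (path_end r d t)"
    unfolding path_end_def by (simp add: sorted_wrt_append del: upt_Suc)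
  moreover have "length (path_end r d t) = d"
    using t d by (auto simp: path_end_def simp del: upt_Suc)
  moreover have "set (path_end r d t) \<subseteq> {1..2*r}"
    unfolding path_end_set[OF assms] by auto
  ultimately show ?thesis by (simp add: incl_def)
qed

lemma card_path_end: "t \<le> r \<Longrightarrow> d \<in> {1..r} \<Longrightarrow> card (set (path_end r d t)) = d"
  using path_end_incl[of t r d] distinct_card[of "path_end r d t"] by (simp add: incl_def strict_sorted_iff)

text \<open>The starting set is moved by the partial cycle and then by one Coxeter element per full
  cycle. Inclusion is checked elementwise; both sets have \<open>d\<close> elements.\<close>

lemma wperm_path_end:
  assumes d: "d \<in> {1..r}" and t: "q < r"
  shows "wperm r (concat (replicate q [1..<Suc r]) @ [1..<Suc d]) ` {1..d} = set (path_end r d (Suc q))"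
  using t
proof (induction q)
  case 0
  have sub: "wperm r [1..<Suc d] ` {1..d} \<subseteq> set (path_end r d 1)"
  proof
    fix x assume "x \<in> wperm r [1..<Suc d] ` {1..d}"
    then obtain a where a: "a \<in> {1..d}" "x = wperm r [1..<Suc d] a" by blast
    have "x = (if a < r then a + 1 else 2 * r)"
      using a d by (subst a(2), subst wperm_cycle) auto
    then show "x \<in> set (path_end r d 1)"
      using a d by (subst path_end_set) auto
  qed
  have js: "set [1..<Suc d] \<subseteq> {1..r}" using d by auto
  have "card (wperm r [1..<Suc d] ` {1..d}) = d"
    using inj_wperm[OF js] by (simp add: card_image inj_on_subset del: upt_Suc)
  moreover have "card (set (path_end r d 1)) = d" using 0 d by (intro card_path_end) auto
  ultimately have "wperm r [1..<Suc d] ` {1..d} = set (path_end r d 1)"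
    by (intro card_subset_eq[OF _ sub]) simp_all
  then show ?case by (simp del: upt_Suc)
next
  case (Suc q)
  let ?C = "[1..<Suc r]"
  have qr: "Suc q \<le> r" "Suc q < r" using Suc.prems by auto
  have "wperm r (concat (replicate (Suc q) ?C) @ [1..<Suc d]) ` {1..d}
      = wperm r ?C ` (wperm r (concat (replicate q ?C) @ [1..<Suc d]) ` {1..d})"
    by (simp only: replicate_Suc concat.simps append_assoc wperm_append[of r ?C] image_comp)
  also have "\<dots> = wperm r ?C ` set (path_end r d (Suc q))" using Suc by simp
  also have "\<dots> = set (path_end r d (Suc (Suc q)))"
  proof (rule card_subset_eq)
    show "wperm r ?C ` set (path_end r d (Suc q)) \<subseteq> set (path_end r d (Suc (Suc q)))"
    proof
      fix x assume "x \<in> wperm r ?C ` set (path_end r d (Suc q))"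
      then obtain a where a: "a \<in> set (path_end r d (Suc q))" "x = wperm r ?C a" by blast
      have a': "Suc q < a \<and> a \<le> r \<and> a \<le> Suc q + d \<or> r < a \<and> a \<le> 2 * r \<and> 2 * r + 1 \<le> a + (d + Suc q - r)"
        using a(1) unfolding path_end_set[OF qr(1) d] by blast
      then have "a \<in> {1..2*r}" by auto
      then have "x = (if a \<le> r then if a < r then a + 1 else 2 * r else if a = r + 1 then 1 else a - 1)"
        unfolding a(2) by (subst wperm_cycle) auto
      then show "x \<in> set (path_end r d (Suc (Suc q)))"
        using a' d qr by (subst path_end_set) auto
    qed
    have js: "set ?C \<subseteq> {1..r}" by auto
    show "card (wperm r ?C ` set (path_end r d (Suc q))) = card (set (path_end r d (Suc (Suc q))))"
      using card_path_end[OF qr(1) d] card_path_end[of "Suc (Suc q)" r d] qr d inj_wperm[OF js]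
      by (simp add: card_image inj_on_subset del: upt_Suc)
  qed simp
  finally show ?case .
qed

lemma iword_split:
  assumes "1 \<le> m" "i \<in> {1..r}" "k \<in> {1..(m - 1) * r + i}" "1 \<le> m'" "(m' - 1) * r < k" "k \<le> m' * r"
  shows "m' \<le> m \<and> iword r m i ! (k - 1) = k - (m' - 1) * r \<and>
    take k (iword r m i) = concat (replicate (m' - 1) [1..<Suc r]) @ [1..<Suc (k - (m' - 1) * r)]"
proof -
  \<comment> \<open>\<open>q\<close> counts the full cycles before position \<open>k\<close>, and
    \<open>j\<close> is the 0-based position inside cycle \<open>m'\<close>.\<close>
  define q j where "q = m' - 1" and "j = k - 1 - q * r"
  let ?C = "[1..<Suc r]"
  have k: "k = q * r + Suc j" using assms(5) by (simp add: q_def j_def)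
  have jr: "j < r" using assms(4,6) k by (cases m') (simp_all add: q_def)
  have qm: "q \<le> m - 1"
  proof (rule ccontr)
    assume "\<not> q \<le> m - 1"
    then have "m \<le> q" by simp
    then have "m * r \<le> q * r" by (rule mult_le_mono1)
    moreover have "(m - 1) * r + r = m * r" using assms(1) by (cases m) simp_all
    ultimately show False using assms(2,3) k unfolding atLeastAtMost_iff by linarith
  qed
  have len: "length (concat (replicate q ?C)) = q * r" for q
    by (simp add: length_concat sum_list_replicate del: upt_Suc)
  \<comment> \<open>The word after \<open>q\<close> full cycles begins either with the incomplete
    last cycle or with another full one; up to position \<open>j\<close> both look alike.\<close>
  obtain rest where rest: "iword r m i = concat (replicate q ?C) @ rest" "rest ! j = Suc j" "take (Suc j) rest = [1..<Suc (Suc j)]"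
  proof (cases "q = m - 1")
    case True
    then have "j < i" using assms(3) k by auto
    then have "[1..<Suc i] ! j = Suc j" "take (Suc j) [1..<Suc i] = [1..<Suc (Suc j)]"
      by (simp_all add: take_upt del: upt_Suc)
    then show ?thesis using that[of "[1..<Suc i]"] True by (simp add: iword_def del: upt_Suc)
  next
    case False
    then have "m - 1 = q + Suc (m - 2 - q)" using qm by simp
    then have "iword r m i = concat (replicate q ?C) @ ?C @ concat (replicate (m - 2 - q) ?C) @ [1..<Suc i]"
      unfolding iword_def by (simp only: replicate_add replicate_Suc concat_append concat.simps append_assoc)
    moreover have "(?C @ concat (replicate (m - 2 - q) ?C) @ [1..<Suc i]) ! j = Suc j"
      using jr by (simp add: nth_append del: upt_Suc)
    moreover have "take (Suc j) (?C @ concat (replicate (m - 2 - q) ?C) @ [1..<Suc i]) = [1..<Suc (Suc j)]"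
      using jr by (simp add: take_upt del: upt_Suc)
    ultimately show ?thesis using that by blast
  qed
  have "iword r m i ! (k - 1) = Suc j"
    unfolding rest(1) using rest(2) k len[of q] by (simp add: nth_append del: upt_Suc)
  moreover have "take k (iword r m i) = concat (replicate q ?C) @ [1..<Suc (Suc j)]"
    unfolding rest(1) using rest(3) k len[of q] by (simp del: upt_Suc)
  moreover have "k - q * r = Suc j" using k by simp
  moreover have "m' \<le> m" using qm assms(1,4) by (simp add: q_def)
  ultimately show ?thesis by (simp add: q_def)
qed

lemma x_L_Sp:
  assumes "i \<le> r" "\<And>s l. 1 \<le> s \<Longrightarrow> s < m \<Longrightarrow> 1 \<le> l \<Longrightarrow> l \<le> r \<Longrightarrow> Y s l \<noteq> 0" "\<And>l. 1 \<le> l \<Longrightarrow> l \<le> i \<Longrightarrow> Y m l \<noteq> 0"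
  shows "x_L r m i Y \<in> carrier (Sp r)"
  unfolding x_L_def using assms by (intro gprod_Sp) (auto intro!: x_neg_Sp simp del: upt_Suc)

theorem proposition6p7:
  fixes r m n i\<^sub>n k m' d :: nat and Y :: "nat \<Rightarrow> nat \<Rightarrow> complex"
  assumes "1 \<le> m" "m \<le> r" "1 \<le> i\<^sub>n" "i\<^sub>n \<le> r"
    and "n = (m - 1) * r + i\<^sub>n"
    and "k \<in> {1..n}"
    and "1 \<le> m'" "(m' - 1) * r < k" "k \<le> m' * r"
    and "d = iword r m i\<^sub>n ! (k - 1)" "d = i\<^sub>n"
    and "\<And>s l. 1 \<le> s \<Longrightarrow> s < m \<Longrightarrow> 1 \<le> l \<Longrightarrow> l \<le> r \<Longrightarrow> Y s l \<noteq> 0"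
    and "\<And>l. 1 \<le> l \<Longrightarrow> l \<le> i\<^sub>n \<Longrightarrow> Y m l \<noteq> 0"
  shows "Delta_L r m i\<^sub>n k Y = (\<Sum>p\<in>paths r d m m'. path_label r d m Y p)"
proof -
  have d: "d \<in> {1..r}" using assms(3,4,11) by simp
  \<comment> \<open>A cycle reads \<open>1, 2, ...\<close>, so a letter equals its position in the
    cycle. The prefix is thus \<open>m' - 1\<close> full cycles followed by
    \<open>1, ..., d\<close>, the input of \<open>wperm_path_end\<close>.\<close>
  have split: "m' \<le> m" "d = k - (m' - 1) * r"
    "take k (iword r m i\<^sub>n) = concat (replicate (m' - 1) [1..<Suc r]) @ [1..<Suc d]"
    using iword_split[of m i\<^sub>n r k m'] assms(1,3-10) by auto
  have m': "m' \<le> r" "m' - 1 < r" "Suc (m' - 1) = m'" using split(1) assms(2,7) by auto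
  have word: "set (take k (iword r m i\<^sub>n)) \<subseteq> {1..r}"
    unfolding split(3) using d by (auto simp del: upt_Suc)
  have Y: "Y m l \<noteq> 0" if "1 \<le> l" "l \<le> d" for l using assms(13) that assms(11) by simp
  have x: "x_L r m d Y \<in> carrier (Sp r)"
    by (rule x_L_Sp) (use d assms(12) Y in auto)
  have "Delta_L r m i\<^sub>n k Y = gen_minor r (weyl_word r (take k (iword r m i\<^sub>n))) \<one>\<^bsub>weyl r\<^esub> d (x_L r m d Y)"
    using assms(10,11) by (simp add: Delta_L_def Delta_k_def)
  also have "\<dots> = minor (mentry (x_L r m d Y)) (path_end r d m') (path_start d)"
    using wperm_path_end[OF d m'(2)] m'(3) split(3)
    by (intro gen_minor_weyl_word[OF word d path_end_incl[OF m'(1) d] _ x]) simp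
  also have "\<dots> = (\<Sum>p\<in>paths r d m m'. path_label r d m Y p)"
    by (rule minor_x_L_paths) (use d assms(1,12) Y path_end_incl[OF m'(1) d] in auto)
  finally show ?thesis .
qed

end
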